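(* Let $1<p<\infty$, $u_0\in L^p(\mathbb{R}^N)$, and let $u(t)=H_t*u_0$ be the solution of $\partial_tu+\log(I-\Delta)u=0$ with $u(0)=u_0$. Then $u(t)=(I-\Delta)^{-t}u_0\in L^p(\mathbb{R}^N)\cap L^p_{2t}(\mathbb{R}^N)$ and $$\|u(t)\|_{L^p_{2t}}=\|u_0\|_{L^p},\qquad\|u(t)\|_{L^p}\le\|u_0\|_{L^p}.$$ Thus $$u(t)\in L^p(\mathbb{R}^N)\cap\begin{cases}L^{\frac{Np}{N-2pt}}(\mathbb{R}^N),&0<t<\frac N{2p},\\ L^q(\mathbb{R}^N)\text{ for all }q\in[p,\infty),&t=\frac N{2p},\\ C_0(\mathbb{R}^N),&t>\frac N{2p}.\end{cases}$$ Given $p\le q<\infty$, the time required for the solution $u$ to get into $L^q(\mathbb{R}^N)$, i.e. the time $t_p^q$ with $\frac{Np}{N-2p\,t_p^q}=q$, is $$t_p^q=\frac N2\left(\frac1p-\frac1q\right).$$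
   Context: Fourier transform: $\widehat f(\xi)=\int f(x)e^{-ix\cdot\xi}dx$. The operator $\log(I-\Delta)$ has Fourier symbol $\log(1+|\xi|^2)$; the fundamental solution $H_t$ of $\partial_tu+\log(I-\Delta)u=0$ is defined by $\widehat{H_t}(\xi)=(1+|\xi|^2)^{-t}$, $t>0$. For $s\in\mathbb{R}$, $(I-\Delta)^{s}$ is the operator with Fourier symbol $(1+|\xi|^2)^{s}$. For $p>1$ and $\sigma\ge0$ the Bessel potential space is $L^p_\sigma(\mathbb{R}^N)=\{f\in L^p(\mathbb{R}^N):(I-\Delta)^{\sigma/2}f\in L^p(\mathbb{R}^N)\}$, with norm $\|f\|_{L^p_\sigma}=\|(I-\Delta)^{\sigma/2}f\|_{L^p}$. $C_0(\mathbb{R}^N)$ denotes continuous functions vanishing at infinity. *)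

theory Defs
  imports "HOL-Analysis.Analysis"
begin

text \<open>All functions are complex-valued, and functions that agree almost everywhere are not
  identified.\<close>

definition Lp :: "real \<Rightarrow> ('a::euclidean_space \<Rightarrow> complex) set" where
  "Lp p = {f \<in> borel_measurable lebesgue. integrable lebesgue (\<lambda>x. norm (f x) powr p)}"

definition Lp_norm :: "real \<Rightarrow> ('a::euclidean_space \<Rightarrow> complex) \<Rightarrow> real" where
  "Lp_norm p f = (LINT x|lebesgue. norm (f x) powr p) powr (1 / p)"

definition C0 :: "('a::euclidean_space \<Rightarrow> complex) set" where
  "C0 = {f. continuous_on UNIV f \<and> (f \<longlongrightarrow> 0) at_infinity}"

definition convolve ::
    "('a::euclidean_space \<Rightarrow> complex) \<Rightarrow> ('a \<Rightarrow> complex) \<Rightarrow> 'a \<Rightarrow> complex" where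
  "convolve f g x = (LINT y|lebesgue. f (x - y) * g y)"

definition fourier :: "('a::euclidean_space \<Rightarrow> complex) \<Rightarrow> 'a \<Rightarrow> complex" where
  "fourier f \<xi> = (LINT x|lebesgue. f x * exp (- (\<i> * complex_of_real (x \<bullet> \<xi>))))"

definition inv_fourier :: "('a::euclidean_space \<Rightarrow> complex) \<Rightarrow> 'a \<Rightarrow> complex" where
  "inv_fourier f x =
     complex_of_real (1 / (2 * pi) ^ DIM('a)) *
     (LINT \<xi>|lebesgue. f \<xi> * exp (\<i> * complex_of_real (x \<bullet> \<xi>)))"

fun iter_deriv :: "'a::euclidean_space list \<Rightarrow> ('a \<Rightarrow> complex) \<Rightarrow> 'a \<Rightarrow> complex" where
  "iter_deriv [] f = f"
| "iter_deriv (v # vs) f = (\<lambda>x. frechet_derivative (iter_deriv vs f) (at x) v)"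

definition schwartz :: "('a::euclidean_space \<Rightarrow> complex) set" where
  "schwartz = {\<phi>. \<forall>vs. set vs \<subseteq> Basis \<longrightarrow>
     (\<forall>x. iter_deriv vs \<phi> differentiable (at x)) \<and>
     (\<forall>k::nat. bounded (range (\<lambda>x. norm x ^ k *\<^sub>R iter_deriv vs \<phi> x)))}"

text \<open>A tempered distribution is represented by its action on test functions; only its values on
  Schwartz functions are meaningful, so equality of distributions is equality on
  \<open>schwartz\<close>. The operations below are the usual ones, defined by duality with respect to the
  bilinear pairing (no complex conjugation).\<close>

type_synonym 'a dist = "('a \<Rightarrow> complex) \<Rightarrow> complex"

definition dist_of :: "('a::euclidean_space \<Rightarrow> complex) \<Rightarrow> 'a dist" where
  "dist_of f \<phi> = (LINT x|lebesgue. f x * \<phi> x)"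

definition dist_eq :: "'a::euclidean_space dist \<Rightarrow> 'a dist \<Rightarrow> bool" where
  "dist_eq S T \<longleftrightarrow> (\<forall>\<phi>\<in>schwartz. S \<phi> = T \<phi>)"

definition fourier_dist :: "'a::euclidean_space dist \<Rightarrow> 'a dist" where
  "fourier_dist T \<phi> = T (fourier \<phi>)"

definition inv_fourier_dist :: "'a::euclidean_space dist \<Rightarrow> 'a dist" where
  "inv_fourier_dist T \<phi> = T (inv_fourier \<phi>)"

definition mult_dist :: "('a::euclidean_space \<Rightarrow> complex) \<Rightarrow> 'a dist \<Rightarrow> 'a dist" where
  "mult_dist m T \<phi> = T (\<lambda>\<xi>. m \<xi> * \<phi> \<xi>)"

definition bessel_symbol :: "real \<Rightarrow> 'a::euclidean_space \<Rightarrow> complex" where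
  "bessel_symbol s \<xi> = complex_of_real ((1 + (norm \<xi>)\<^sup>2) powr s)"

text \<open>\<open>bessel_op s\<close> is \<open>(I - \<Delta>)\<^sup>s\<close>. All its symbols are smooth with polynomially bounded
  derivatives, so it is defined on every tempered distribution.\<close>

definition bessel_op :: "real \<Rightarrow> 'a::euclidean_space dist \<Rightarrow> 'a dist" where
  "bessel_op s T = inv_fourier_dist (mult_dist (bessel_symbol s) (fourier_dist T))"

definition bessel_space :: "real \<Rightarrow> real \<Rightarrow> ('a::euclidean_space \<Rightarrow> complex) set" where
  "bessel_space p \<sigma> =
     {f \<in> Lp p. \<exists>g\<in>Lp p. dist_eq (dist_of g) (bessel_op (\<sigma> / 2) (dist_of f))}"

text \<open>The function chosen here is unique up to a null set, which does not affect its norm.\<close>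

definition bessel_norm :: "real \<Rightarrow> real \<Rightarrow> ('a::euclidean_space \<Rightarrow> complex) \<Rightarrow> real" where
  "bessel_norm p \<sigma> f =
     Lp_norm p (SOME g. g \<in> Lp p \<and> dist_eq (dist_of g) (bessel_op (\<sigma> / 2) (dist_of f)))"

text \<open>The fundamental solution \<open>H\<^sub>t\<close> of \<open>\<partial>\<^sub>t u + log (I - \<Delta>) u = 0\<close>, for \<open>t > 0\<close>:
  the integrable function, unique up to a null set,
  whose Fourier transform is \<open>exp (- t * log (1 + |\<xi>|\<^sup>2)) = (1 + |\<xi>|\<^sup>2) powr (- t)\<close>.\<close>

definition log_kernel :: "real \<Rightarrow> 'a::euclidean_space \<Rightarrow> complex" where
  "log_kernel t =
     (SOME H. integrable lebesgue H \<and> (\<forall>\<xi>. fourier H \<xi> = bessel_symbol (- t) \<xi>))"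

definition log_solution ::
    "('a::euclidean_space \<Rightarrow> complex) \<Rightarrow> real \<Rightarrow> 'a \<Rightarrow> complex" where
  "log_solution u0 t = (if t = 0 then u0 else convolve (log_kernel t) u0)"

end

theory Submission
  imports Defs "HOL-Probability.Characteristic_Functions"
begin

text \<open>
  Subordination, \<open>(1 + |\<xi>|\<^sup>2) powr - t = 1 / \<Gamma> t * \<integral> s powr (t - 1) * exp (- s) * exp (- s * |\<xi>|\<^sup>2) ds\<close>,
  writes \<open>H\<^sub>t\<close> as an average of heat kernels, hence as a probability density \<open>G\<^sub>t\<close>; uniqueness for the
  Fourier transform on \<open>L\<^sup>1\<close> identifies the two. Jensen's inequality then gives the contraction on
  \<open>L\<^sup>p\<close>. Membership in \<open>L\<^sup>q\<close> is the Hardy--Littlewood--Sobolev inequality for the potential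
  \<open>\<integral> s powr (\<alpha> - 1) * P\<^sub>s f ds\<close> with \<open>P\<^sub>s\<close> the heat semigroup; it follows from the layer-cake
  formula without interpolation or maximal functions, by splitting at each level \<open>\<tau>\<close> both the time
  integral and the function at suitable powers of \<open>\<tau>\<close>. In the range \<open>t > N / (2 p)\<close> the time integral
  converges absolutely and dominated convergence reduces the claim to the heat semigroup.

  On a Schwartz function \<open>\<phi>\<close> the transposed operator \<open>(I - \<Delta>) powr t\<close> is \<open>G\<^bsub>k - t\<^esub> * (I - \<Delta>)\<^sup>k \<phi>\<close> for any
  integer \<open>k > t\<close>. So it suffices to know that the image is bounded and integrable, and
  differentiability of the symbols is never needed.
\<close>

section \<open>The heat kernel\<close>

text \<open>Two mismatches shape the development. The definitions speak of the completed Lebesgue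
  measure, whereas Fubini and joint measurability are comfortable only for Borel functions. All
  analysis therefore runs on Borel representatives over \<open>lborel\<close>, and null sets are
  discarded only in the final section; convolutions and pairings do not see them.

  The norm identity is the second obstacle: \<open>bessel_norm\<close> is the norm of a chosen
  \<open>g\<close> representing \<open>(I - \<Delta>) powr t\<close> of the solution. That
  \<open>u0\<close> qualifies follows by moving the kernel onto the test function, where it cancels
  the operator. That every choice agrees with \<open>u0\<close> almost everywhere requires test
  functions that separate \<open>L\<^sup>p\<close>; Gaussians times characters do, because pairing
  with them computes the Fourier transform of an integrable function.

  For the \<open>L\<^sup>q\<close> claims, the factor \<open>exp (- s)\<close> bounds the Gamma
  density by a multiple of \<open>s powr (\<alpha> - 1)\<close> for every
  \<open>0 < \<alpha> \<le> t\<close>. One inequality, at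
  \<open>\<alpha> = N / 2 * (1 / p - 1 / q)\<close>, thus covers the endpoint exponent
  (\<open>\<alpha> = t\<close>) and all finite \<open>q\<close> at the critical time
  (\<open>\<alpha> < t\<close>).\<close>

lemma lborel_distr_reflect: "distr lborel borel (\<lambda>x. t - x) = (lborel :: 'a::euclidean_space measure)"
proof -
  have "lborel = density (distr lborel borel (\<lambda>x::'a. t + (-1) *\<^sub>R x)) (\<lambda>x. 1)"
    using lborel_affine[of "-1" t] by simp
  then show ?thesis
    by (simp add: density_1)
qed

lemma nn_integral_lborel_reflect:
  fixes f :: "'a::euclidean_space \<Rightarrow> ennreal"
  assumes [measurable]: "f \<in> borel_measurable borel"
  shows "(\<integral>\<^sup>+x. f (t - x) \<partial>lborel) = (\<integral>\<^sup>+x. f x \<partial>lborel)"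
  by (subst (2) lborel_distr_reflect[of t, symmetric], subst nn_integral_distr) auto

lemma nn_integral_lborel_translate:
  fixes f :: "'a::euclidean_space \<Rightarrow> ennreal"
  assumes [measurable]: "f \<in> borel_measurable borel"
  shows "(\<integral>\<^sup>+x. f (t + x) \<partial>lborel) = (\<integral>\<^sup>+x. f x \<partial>lborel)"
  by (subst (2) lborel_distr_plus[of t, symmetric], subst nn_integral_distr) auto

lemma integral_lborel_translate:
  fixes f :: "'a::euclidean_space \<Rightarrow> 'b::{banach, second_countable_topology}"
  assumes [measurable]: "f \<in> borel_measurable borel"
  shows "(\<integral>x. f (t + x) \<partial>lborel) = (\<integral>x. f x \<partial>lborel)"
  by (subst (2) lborel_distr_plus[of t, symmetric], subst integral_distr) auto

lemma integral_lborel_reflect: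
  fixes f :: "'a::euclidean_space \<Rightarrow> 'b::{banach, second_countable_topology}"
  assumes [measurable]: "f \<in> borel_measurable borel"
  shows "(\<integral>x. f (t - x) \<partial>lborel) = (\<integral>x. f x \<partial>lborel)"
  by (subst (2) lborel_distr_reflect[of t, symmetric], subst integral_distr) auto

lemma integrable_lborel_translate:
  fixes f :: "'a::euclidean_space \<Rightarrow> 'b::{banach, second_countable_topology}"
  assumes "integrable lborel f"
  shows "integrable lborel (\<lambda>x. f (t + x))"
proof (rule integrable_distr[where f = f and T = "(+) t" and M' = borel])
  show "(+) t \<in> measurable lborel borel" by auto
  show "integrable (distr lborel borel ((+) t)) f"
    using assms by (simp add: lborel_distr_plus)
qed

lemma integrable_lborel_reflect:
  fixes f :: "'a::euclidean_space \<Rightarrow> 'b::{banach, second_countable_topology}"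
  assumes "integrable lborel f"
  shows "integrable lborel (\<lambda>x. f (t - x))"
proof (rule integrable_distr[where f = f and T = "(-) t" and M' = borel])
  show "(-) t \<in> measurable lborel borel" by auto
  show "integrable (distr lborel borel ((-) t)) f"
    using assms lborel_distr_reflect[of t] by simp
qed

lemma AE_lborel_reflect:
  assumes "AE x in lborel. P x"
  shows "AE x in lborel. P (t - (x::'a::euclidean_space))"
proof (rule AE_distrD[where f = "(-) t" and M' = borel])
  show "(-) t \<in> measurable lborel borel" by auto
  show "AE x in distr lborel borel ((-) t). P x"
    unfolding lborel_distr_reflect by (rule assms)
qed

text \<open>\<open>lborel\<close> is the image of the product of the coordinate measures, so a
  product over coordinates integrates factor by factor. This reduces Gaussian integrals to one
  dimension.\<close>

lemma
  fixes f :: "'a::euclidean_space \<Rightarrow> real \<Rightarrow> 'c::{real_normed_field, banach, second_countable_topology}"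
  assumes f: "\<And>b. b \<in> Basis \<Longrightarrow> integrable lborel (f b)"
  shows integrable_lborel_prod: "integrable lborel (\<lambda>x. \<Prod>b\<in>Basis. f b (x \<bullet> b))" (is ?I)
    and integral_lborel_prod:
      "(\<integral>x. (\<Prod>b\<in>Basis. f b (x \<bullet> b)) \<partial>lborel) = (\<Prod>b\<in>Basis. \<integral>t. f b t \<partial>lborel)" (is ?E)
proof -
  interpret product_sigma_finite "\<lambda>_::'a. lborel :: real measure"
    by standard
  have eq: "(lborel :: 'a measure)
      = distr (\<Pi>\<^sub>M b\<in>Basis. lborel) borel (\<lambda>f. \<Sum>b\<in>Basis. f b *\<^sub>R b)"
    by (subst lborel_def) (simp add: lborel_eq_real)
  have m[measurable]: "(\<lambda>f. \<Sum>b\<in>Basis. f b *\<^sub>R b) \<in> measurable (\<Pi>\<^sub>M b\<in>Basis. lborel) (borel :: 'a measure)"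
    by measurable
  have fm[measurable]: "\<And>b. b \<in> Basis \<Longrightarrow> f b \<in> borel_measurable borel"
    using borel_measurable_integrable[OF f] by simp
  have mm: "(\<lambda>x. \<Prod>b\<in>Basis. f b (x \<bullet> b)) \<in> borel_measurable borel"
    by measurable
  have co: "(\<Prod>b\<in>Basis. f b ((\<Sum>c\<in>Basis. g c *\<^sub>R c) \<bullet> b)) = (\<Prod>b\<in>Basis. f b (g b))" for g :: "'a \<Rightarrow> real"
    by (intro prod.cong refl) (simp add: inner_sum_left_Basis)
  show ?I
    unfolding eq by (subst integrable_distr_eq[OF m mm]) (simp add: co product_integrable_prod f)
  show ?E
    by (subst eq, subst integral_distr[OF m mm]) (simp add: co product_integral_prod f)
qed

definition heat :: "real \<Rightarrow> 'a::euclidean_space \<Rightarrow> real" where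
  "heat s x = (4 * pi * s) powr (- (DIM('a) / 2)) * exp (- (norm x)\<^sup>2 / (4 * s))"

lemma heat_nonneg [simp]: "0 \<le> heat s x"
  by (simp add: heat_def)

lemma heat_minus [simp]: "heat s (- x) = heat s x"
  by (simp add: heat_def)

lemma heat_diff_commute: "heat s (x - y) = heat s (y - x)"
  using heat_minus[of s "y - x"] by simp

lemma heat_le: "0 < s \<Longrightarrow> heat s x \<le> (4 * pi * s) powr (- (DIM('a) / 2))" for x :: "'a::euclidean_space"
  by (simp add: heat_def mult_left_le)

lemma measurable_heat [measurable]: "(\<lambda>(s, x). heat s x) \<in> borel_measurable (borel \<Otimes>\<^sub>M borel)"
  unfolding heat_def by measurable

lemma measurable_heat' [measurable]: "heat s \<in> borel_measurable borel"
  unfolding heat_def by measurable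

lemma heat_eq_prod:
  fixes x :: "'a::euclidean_space"
  assumes "0 < s"
  shows "heat s x = (\<Prod>b\<in>Basis. normal_density 0 (sqrt (2 * s)) (x \<bullet> b))"
proof -
  have "(\<Prod>b\<in>Basis. normal_density 0 (sqrt (2 * s)) (x \<bullet> b))
     = (\<Prod>b\<in>(Basis::'a set). 1 / sqrt (4 * pi * s)) * (\<Prod>b\<in>Basis. exp (- (x \<bullet> b)\<^sup>2 / (4 * s)))"
    using assms by (simp add: normal_density_def prod.distrib prod_dividef power_divide algebra_simps)
  also have "(\<Prod>b\<in>(Basis::'a set). 1 / sqrt (4 * pi * s)) = (4 * pi * s) powr (- (DIM('a) / 2))"
    using assms by (simp add: powr_half_sqrt[symmetric] powr_minus_divide[symmetric] powr_powr
      powr_realpow[symmetric] del: prod_constant) (simp add: powr_realpow[symmetric] powr_powr)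
  also have "(\<Prod>b\<in>Basis. exp (- (x \<bullet> b)\<^sup>2 / (4 * s))) = exp (- (norm x)\<^sup>2 / (4 * s))"
    by (simp add: exp_sum[symmetric] norm_eq_sqrt_inner euclidean_inner[of x x] power2_eq_square
      sum_divide_distrib sum_negf sum_nonneg)
  finally show ?thesis
    by (simp add: heat_def)
qed

text \<open>This is the characteristic function of the standard normal distribution at
  \<open>\<sigma> * u\<close>, after the substitution that stretches the line by
  \<open>\<sigma>\<close>.\<close>

lemma
  assumes "0 < \<sigma>"
  shows integrable_normal_density_iexp:
      "integrable lborel (\<lambda>x. complex_of_real (normal_density 0 \<sigma> x) * iexp (u * x))" (is ?I)
    and integral_normal_density_iexp:
      "(\<integral>x. complex_of_real (normal_density 0 \<sigma> x) * iexp (u * x) \<partial>lborel)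
        = exp (- (\<sigma> * u)\<^sup>2 / 2)" (is ?E)
proof -
  show ?I
    by (rule Bochner_Integration.integrable_bound[OF integrable_normal_density[of \<sigma> 0]])
       (use assms in \<open>auto simp: norm_mult\<close>)
  have "complex_of_real (exp (- (\<sigma> * u)\<^sup>2 / 2)) = char std_normal_distribution (\<sigma> * u)"
    by (simp add: char_std_normal_distribution)
  also have "\<dots> = (\<integral>x. std_normal_density x *\<^sub>R iexp (\<sigma> * u * x) \<partial>lborel)"
    unfolding char_def by (subst integral_density) auto
  also have "\<dots> = (\<integral>x. \<sigma> *\<^sub>R (complex_of_real (normal_density 0 \<sigma> (0 + \<sigma> * x)) * iexp (u * (0 + \<sigma> * x))) \<partial>lborel)"
    using assms by (intro Bochner_Integration.integral_cong refl)
      (simp add: normal_density_def power_mult_distrib scaleR_conv_of_real real_sqrt_mult field_simps)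
  also have "\<dots> = (\<integral>x. complex_of_real (normal_density 0 \<sigma> x) * iexp (u * x) \<partial>lborel)"
    using assms by (subst (2) lborel_integral_real_affine[of \<sigma> _ 0]) simp_all
  finally show ?E by simp
qed

lemma
  fixes \<xi> :: "'a::euclidean_space"
  assumes "0 < s"
  shows integrable_heat_iexp: "integrable lborel (\<lambda>x. complex_of_real (heat s x) * iexp (x \<bullet> \<xi>))" (is ?I)
    and integral_heat_iexp:
      "(\<integral>x. complex_of_real (heat s x) * iexp (x \<bullet> \<xi>) \<partial>lborel) = exp (- (s * (norm \<xi>)\<^sup>2))" (is ?E)
proof -
  let ?\<sigma> = "sqrt (2 * s)"
  have \<sigma>: "0 < ?\<sigma>" using assms by simp
  have pr: "complex_of_real (heat s x) * iexp (x \<bullet> \<xi>)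
     = (\<Prod>b\<in>Basis. complex_of_real (normal_density 0 ?\<sigma> (x \<bullet> b)) * iexp ((\<xi> \<bullet> b) * (x \<bullet> b)))" for x
    by (simp add: heat_eq_prod[OF assms] prod.distrib euclidean_inner[of x \<xi>] exp_sum[symmetric]
      sum_distrib_left mult.commute)
  show ?I
    unfolding pr using assms by (intro integrable_lborel_prod integrable_normal_density_iexp) simp
  have "(\<integral>x. complex_of_real (heat s x) * iexp (x \<bullet> \<xi>) \<partial>lborel)
     = (\<Prod>b\<in>Basis. exp (complex_of_real (- (?\<sigma> * (\<xi> \<bullet> b))\<^sup>2 / 2)))"
    unfolding pr integral_lborel_prod[OF integrable_normal_density_iexp[OF \<sigma>]] integral_normal_density_iexp[OF \<sigma>]
    by (simp add: exp_of_real[symmetric])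
  also have "\<dots> = exp (complex_of_real (\<Sum>b\<in>Basis. - (?\<sigma> * (\<xi> \<bullet> b))\<^sup>2 / 2))"
    by (simp only: exp_sum[OF finite_Basis, symmetric] of_real_sum)
  also have "(\<Sum>b\<in>Basis. - (?\<sigma> * (\<xi> \<bullet> b))\<^sup>2 / 2) = - (s * (norm \<xi>)\<^sup>2)"
  proof -
    have "(norm \<xi>)\<^sup>2 = (\<Sum>b\<in>Basis. (\<xi> \<bullet> b)\<^sup>2)"
      unfolding power2_norm_eq_inner by (subst euclidean_inner) (simp add: power2_eq_square)
    then show ?thesis
      using assms by (simp add: power_mult_distrib sum_distrib_left sum_negf)
  qed
  finally show ?E by (simp add: exp_of_real[symmetric])
qed

lemma integrable_heat: "0 < s \<Longrightarrow> integrable lborel (heat s :: 'a::euclidean_space \<Rightarrow> real)"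
  using integrable_Re[OF integrable_heat_iexp[of s "0::'a"]] by simp

lemma integral_heat: "0 < s \<Longrightarrow> (\<integral>x. heat s (x::'a::euclidean_space) \<partial>lborel) = 1"
  using arg_cong[OF integral_heat_iexp[of s "0::'a"], of Re] by simp

lemma nn_integral_heat: "0 < s \<Longrightarrow> (\<integral>\<^sup>+x. ennreal (heat s (x::'a::euclidean_space)) \<partial>lborel) = 1"
  by (subst nn_integral_eq_integral) (simp_all add: integrable_heat integral_heat)

lemma integrable_heat_diff:
  "0 < s \<Longrightarrow> integrable lborel (\<lambda>y. heat s (x - y :: 'a::euclidean_space))"
  by (intro integrable_lborel_reflect integrable_heat)

lemma integral_heat_diff: "0 < s \<Longrightarrow> (\<integral>y. heat s (x - y :: 'a::euclidean_space) \<partial>lborel) = 1"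
  by (subst integral_lborel_reflect[of "heat s"]) (simp_all add: integral_heat)

lemma nn_integral_heat_diff:
  "0 < s \<Longrightarrow> (\<integral>\<^sup>+y. ennreal (heat s (x - y :: 'a::euclidean_space)) \<partial>lborel) = 1"
  by (subst nn_integral_lborel_reflect[of "\<lambda>y. ennreal (heat s y)"]) (simp_all add: nn_integral_heat)

section \<open>Subordination to the Gamma distribution and the Bessel kernel\<close>

lemma integral_swap_lborel:
  fixes f :: "'a::euclidean_space \<Rightarrow> 'b::euclidean_space \<Rightarrow> 'c::{banach, second_countable_topology}"
  assumes [measurable]: "(\<lambda>(x, y). f x y) \<in> borel_measurable (borel \<Otimes>\<^sub>M borel)"
    and fin: "(\<integral>\<^sup>+x. \<integral>\<^sup>+y. ennreal (norm (f x y)) \<partial>lborel \<partial>lborel) < \<infinity>"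
  shows "(\<integral>x. \<integral>y. f x y \<partial>lborel \<partial>lborel) = (\<integral>y. \<integral>x. f x y \<partial>lborel \<partial>lborel)"
proof -
  have "integrable (lborel \<Otimes>\<^sub>M lborel) (\<lambda>(x, y). f x y)"
  proof (rule integrableI_bounded)
    have "(\<integral>\<^sup>+z. ennreal (norm (case z of (x, y) \<Rightarrow> f x y)) \<partial>(lborel \<Otimes>\<^sub>M lborel))
       = (\<integral>\<^sup>+x. \<integral>\<^sup>+y. ennreal (norm (f x y)) \<partial>lborel \<partial>lborel)"
      by (subst lborel.nn_integral_fst[symmetric]) auto
    with fin show "(\<integral>\<^sup>+z. ennreal (norm (case z of (x, y) \<Rightarrow> f x y)) \<partial>(lborel \<Otimes>\<^sub>M lborel)) < \<infinity>"
      by simp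
  qed simp
  then show ?thesis
    by (rule lborel_pair.Fubini_integral[symmetric])
qed

lemma nn_integral_swap_lborel:
  fixes f :: "'a::euclidean_space \<Rightarrow> 'b::euclidean_space \<Rightarrow> ennreal"
  assumes [measurable]: "(\<lambda>(x, y). f x y) \<in> borel_measurable (borel \<Otimes>\<^sub>M borel)"
  shows "(\<integral>\<^sup>+x. \<integral>\<^sup>+y. f x y \<partial>lborel \<partial>lborel) = (\<integral>\<^sup>+y. \<integral>\<^sup>+x. f x y \<partial>lborel \<partial>lborel)"
proof -
  show ?thesis by (rule lborel_pair.Fubini'[symmetric]) simp
qed

text \<open>Euler's integral for \<open>Gamma t\<close> after stretching the variable by
  \<open>c\<close>.\<close>

lemma nn_integral_powr_exp:
  assumes t: "0 < (t::real)" and c: "0 < (c::real)"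
  shows "(\<integral>\<^sup>+s. ennreal (indicator {0<..} s * (s powr (t - 1) * exp (- (c * s)))) \<partial>lborel)
    = ennreal (Gamma t / c powr t)"
proof -
  let ?I = "\<integral>\<^sup>+s. ennreal (indicator {0<..} s * (s powr (t - 1) * exp (- (c * s)))) \<partial>lborel"
  have "ennreal (Gamma t) = (\<integral>\<^sup>+s. ennreal (indicat_real {0..} s * s powr (t - 1) / exp s) \<partial>lborel)"
    by (rule Gamma_conv_nn_integral_real[OF t])
  also have "\<dots> = ennreal \<bar>c\<bar> * (\<integral>\<^sup>+s. ennreal (indicat_real {0..} (0 + c * s) * (0 + c * s) powr (t - 1) / exp (0 + c * s)) \<partial>lborel)"
    using c by (intro nn_integral_real_affine) auto
  also have "(\<integral>\<^sup>+s. ennreal (indicat_real {0..} (0 + c * s) * (0 + c * s) powr (t - 1) / exp (0 + c * s)) \<partial>lborel)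
     = (\<integral>\<^sup>+s. ennreal (c powr (t - 1)) * ennreal (indicator {0<..} s * (s powr (t - 1) * exp (- (c * s)))) \<partial>lborel)"
    using c by (intro nn_integral_cong)
      (auto simp: ennreal_mult'[symmetric] indicator_def powr_mult exp_minus field_simps zero_le_mult_iff)
  also have "\<dots> = ennreal (c powr (t - 1)) * ?I"
    by (rule nn_integral_cmult) auto
  also have "ennreal \<bar>c\<bar> * (ennreal (c powr (t - 1)) * ?I) = ennreal (c powr t) * ?I"
    using c by (simp add: mult.assoc[symmetric] ennreal_mult'[symmetric] powr_diff)
  finally have *: "ennreal (Gamma t) = ennreal (c powr t) * ?I" .
  have "?I = ennreal (1 / c powr t) * (ennreal (c powr t) * ?I)"
    using c by (simp add: mult.assoc[symmetric] ennreal_mult'[symmetric])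
  also have "\<dots> = ennreal (Gamma t / c powr t)"
    unfolding *[symmetric] using c by (simp add: ennreal_mult'[symmetric])
  finally show ?thesis .
qed

text \<open>The density of the Gamma distribution with shape \<open>t\<close> and rate 1. It
  vanishes for \<open>s \<le> 0\<close>, so the meaningless values of \<open>heat\<close> at
  nonpositive times never contribute.\<close>

definition gamma_weight :: "real \<Rightarrow> real \<Rightarrow> real" where
  "gamma_weight t s = indicator {0<..} s * (s powr (t - 1) * exp (- s)) / Gamma t"

lemma measurable_gamma_weight [measurable]: "gamma_weight t \<in> borel_measurable borel"
  unfolding gamma_weight_def by measurable

lemma gamma_weight_nonneg: "0 < t \<Longrightarrow> 0 \<le> gamma_weight t s"
  by (simp add: gamma_weight_def)

lemma gamma_weight_nonpos [simp]: "s \<le> 0 \<Longrightarrow> gamma_weight t s = 0"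
  by (simp add: gamma_weight_def)

lemma nn_integral_gamma_weight_exp:
  assumes "0 < t" "0 \<le> a"
  shows "(\<integral>\<^sup>+s. ennreal (gamma_weight t s * exp (- (s * a))) \<partial>lborel) = ennreal ((1 + a) powr (- t))"
proof -
  have "(\<integral>\<^sup>+s. ennreal (gamma_weight t s * exp (- (s * a))) \<partial>lborel)
    = (\<integral>\<^sup>+s. ennreal (1 / Gamma t) * ennreal (indicator {0<..} s * (s powr (t - 1) * exp (- ((1 + a) * s)))) \<partial>lborel)"
    using assms by (intro nn_integral_cong)
      (simp add: gamma_weight_def ennreal_mult'[symmetric] exp_add[symmetric] algebra_simps)
  also have "\<dots> = ennreal (1 / Gamma t) * ennreal (Gamma t / (1 + a) powr t)"
    using assms by (subst nn_integral_cmult) (auto simp: nn_integral_powr_exp)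
  also have "\<dots> = ennreal ((1 + a) powr (- t))"
    using assms Gamma_real_pos[of t] by (simp add: ennreal_mult'[symmetric] powr_minus_divide less_imp_neq[THEN not_sym])
  finally show ?thesis .
qed

lemma integral_gamma_weight_exp:
  assumes "0 < t" "0 \<le> a"
  shows "(\<integral>s. gamma_weight t s * exp (- (s * a)) \<partial>lborel) = (1 + a) powr (- t)"
  using nn_integral_gamma_weight_exp[OF assms] gamma_weight_nonneg[OF assms(1)]
  by (simp add: integral_eq_nn_integral)

lemma nn_integral_gamma_weight: "0 < t \<Longrightarrow> (\<integral>\<^sup>+s. ennreal (gamma_weight t s) \<partial>lborel) = 1"
  using nn_integral_gamma_weight_exp[of t 0] by simp

text \<open>Subordination replaces polar coordinates: the power is a Gamma mixture of Gaussians in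
  \<open>x\<close>, and integrating over \<open>x\<close> first leaves a Gamma integral of shape
  \<open>k - N\<close>, with \<open>N\<close> half the dimension. It converges because that shape is
  positive.\<close>

lemma integrable_bessel_symbol:
  assumes k: "DIM('a) / 2 < k"
  shows "integrable lborel (\<lambda>x::'a::euclidean_space. (1 + (norm x)\<^sup>2) powr (- k))"
proof (rule integrableI_nonneg)
  have k0: "0 < k" using k by (simp add: order_less_trans[rotated])
  define N where "N = DIM('a) / 2"
  have N: "0 < k - N" using k by (simp add: N_def)
  have "(\<integral>\<^sup>+(x::'a). ennreal ((1 + (norm x)\<^sup>2) powr (- k)) \<partial>lborel)
     = (\<integral>\<^sup>+(x::'a). \<integral>\<^sup>+s. ennreal (gamma_weight k s * exp (- (s * (norm x)\<^sup>2))) \<partial>lborel \<partial>lborel)"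
    using k0 by (simp add: nn_integral_gamma_weight_exp)
  also have "\<dots> = (\<integral>\<^sup>+s. \<integral>\<^sup>+(x::'a). ennreal (gamma_weight k s * exp (- (s * (norm x)\<^sup>2))) \<partial>lborel \<partial>lborel)"
    by (rule nn_integral_swap_lborel) measurable
  also have "\<dots> = (\<integral>\<^sup>+s. ennreal (pi powr N / Gamma k) * ennreal (indicator {0<..} s * (s powr (k - N - 1) * exp (- (1 * s)))) \<partial>lborel)"
  proof (intro nn_integral_cong)
    fix s :: real
    show "(\<integral>\<^sup>+(x::'a). ennreal (gamma_weight k s * exp (- (s * (norm x)\<^sup>2))) \<partial>lborel)
      = ennreal (pi powr N / Gamma k) * ennreal (indicator {0<..} s * (s powr (k - N - 1) * exp (- (1 * s))))"
    proof (cases "0 < s")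
      case True
      \<comment> \<open>The Gaussian is a multiple of the heat kernel at time
        \<open>1 / (4 * s)\<close>, whose total mass is known.\<close>
      have e: "gamma_weight k s * exp (- (s * (norm x)\<^sup>2))
          = (gamma_weight k s * (pi / s) powr N) * heat (1 / (4 * s)) x" for x :: 'a
        using True by (simp add: heat_def N_def powr_minus_divide)
      have "(\<integral>\<^sup>+(x::'a). ennreal (gamma_weight k s * exp (- (s * (norm x)\<^sup>2))) \<partial>lborel)
          = ennreal (gamma_weight k s * (pi / s) powr N) * (\<integral>\<^sup>+(x::'a). ennreal (heat (1 / (4 * s)) x) \<partial>lborel)"
        unfolding e using k0 by (subst nn_integral_cmult[symmetric]) (simp_all add: ennreal_mult gamma_weight_nonneg)
      also have "\<dots> = ennreal (gamma_weight k s * (pi / s) powr N)"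
        using True by (simp add: nn_integral_heat)
      also have "gamma_weight k s * (pi / s) powr N
          = (pi powr N / Gamma k) * (indicator {0<..} s * (s powr (k - N - 1) * exp (- (1 * s))))"
        using True by (simp add: gamma_weight_def powr_divide powr_diff mult_ac)
      finally show ?thesis
        using k0 by (subst ennreal_mult'[symmetric]) (simp_all add: Gamma_real_pos less_imp_le)
    qed simp
  qed
  also have "\<dots> = ennreal (pi powr N / Gamma k) * ennreal (Gamma (k - N) / 1 powr (k - N))"
    using nn_integral_powr_exp[OF N, of 1] by (subst nn_integral_cmult) simp_all
  also have "\<dots> < \<infinity>"
    by (simp add: ennreal_mult_less_top)
  finally show "(\<integral>\<^sup>+(x::'a). ennreal ((1 + (norm x)\<^sup>2) powr (- k)) \<partial>lborel) < \<infinity>" .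
qed auto

text \<open>Where the integral diverges (at \<open>0\<close> if \<open>2 t \<le> N\<close>), its value is the junk value \<open>0\<close>.\<close>

definition bessel_kernel :: "real \<Rightarrow> 'a::euclidean_space \<Rightarrow> real" where
  "bessel_kernel t x = (\<integral>s. gamma_weight t s * heat s x \<partial>lborel)"

lemma measurable_bessel_kernel [measurable]: "bessel_kernel t \<in> borel_measurable borel"
  unfolding bessel_kernel_def by measurable

lemma bessel_kernel_nonneg: "0 < t \<Longrightarrow> 0 \<le> bessel_kernel t x"
  by (simp add: bessel_kernel_def gamma_weight_nonneg)

lemma bessel_kernel_minus [simp]: "bessel_kernel t (- x) = bessel_kernel t x"
  by (simp add: bessel_kernel_def)

lemma nn_integral_weight_heat:
  assumes "0 < t"
  shows "(\<integral>\<^sup>+x. \<integral>\<^sup>+s. ennreal (gamma_weight t s * heat s (x::'a::euclidean_space)) \<partial>lborel \<partial>lborel) = 1"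
proof -
  have "(\<integral>\<^sup>+(x::'a). \<integral>\<^sup>+s. ennreal (gamma_weight t s * heat s x) \<partial>lborel \<partial>lborel)
      = (\<integral>\<^sup>+s. \<integral>\<^sup>+(x::'a). ennreal (gamma_weight t s * heat s x) \<partial>lborel \<partial>lborel)"
    by (rule nn_integral_swap_lborel) measurable
  also have "\<dots> = (\<integral>\<^sup>+s. ennreal (gamma_weight t s) \<partial>lborel)"
  proof (intro nn_integral_cong)
    fix s :: real
    show "(\<integral>\<^sup>+(x::'a). ennreal (gamma_weight t s * heat s x) \<partial>lborel) = ennreal (gamma_weight t s)"
      using assms by (cases "0 < s")
        (simp_all add: ennreal_mult gamma_weight_nonneg nn_integral_cmult nn_integral_heat)
  qed
  also have "\<dots> = 1" by (rule nn_integral_gamma_weight[OF assms])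
  finally show ?thesis .
qed

text \<open>The iterated integral equals 1, so the inner integral is finite almost everywhere, and
  there the Bochner integral defining \<open>bessel_kernel\<close> has the same value.\<close>

lemma AE_bessel_kernel:
  assumes "0 < t"
  shows "AE x in lborel.
    ennreal (bessel_kernel t (x::'a::euclidean_space)) = (\<integral>\<^sup>+s. ennreal (gamma_weight t s * heat s x) \<partial>lborel)"
proof -
  have "AE x::'a in lborel. (\<integral>\<^sup>+s. ennreal (gamma_weight t s * heat s x) \<partial>lborel) \<noteq> \<infinity>"
    by (rule nn_integral_PInf_AE) (simp_all add: nn_integral_weight_heat assms)
  then show ?thesis
    by eventually_elim
      (simp add: bessel_kernel_def integral_eq_nn_integral gamma_weight_nonneg assms less_top)
qed

lemma nn_integral_bessel_kernel:
  assumes "0 < t"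
  shows "(\<integral>\<^sup>+x. ennreal (bessel_kernel t (x::'a::euclidean_space)) \<partial>lborel) = 1"
  using nn_integral_cong_AE[OF AE_bessel_kernel[OF assms, where 'a='a]] nn_integral_weight_heat[OF assms, where 'a='a]
  by simp

lemma integrable_bessel_kernel:
  "0 < t \<Longrightarrow> integrable lborel (bessel_kernel t :: 'a::euclidean_space \<Rightarrow> real)"
  by (rule integrableI_nonneg) (simp_all add: nn_integral_bessel_kernel bessel_kernel_nonneg)

lemma integral_bessel_kernel_iexp:
  fixes \<xi> :: "'a::euclidean_space"
  assumes t: "0 < t"
  shows "(\<integral>x. complex_of_real (bessel_kernel t x) * iexp (x \<bullet> \<xi>) \<partial>lborel) = bessel_symbol (- t) \<xi>"
proof -
  \<comment> \<open>No exceptional set is needed: where the integral over \<open>s\<close> diverges,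
    both integrands are 0 by default.\<close>
  have "(\<integral>x. complex_of_real (bessel_kernel t x) * iexp (x \<bullet> \<xi>) \<partial>lborel)
     = (\<integral>x. \<integral>s. complex_of_real (gamma_weight t s) * (complex_of_real (heat s x) * iexp (x \<bullet> \<xi>)) \<partial>lborel \<partial>lborel)"
    by (simp add: bessel_kernel_def mult.assoc[symmetric] of_real_mult[symmetric] del: of_real_mult)
  also have "\<dots> = (\<integral>s. \<integral>x. complex_of_real (gamma_weight t s) * (complex_of_real (heat s x) * iexp (x \<bullet> \<xi>)) \<partial>lborel \<partial>lborel)"
  proof (rule integral_swap_lborel)
    show "(\<integral>\<^sup>+x. \<integral>\<^sup>+s. ennreal (cmod (complex_of_real (gamma_weight t s) * (complex_of_real (heat s x) * iexp (x \<bullet> \<xi>)))) \<partial>lborel \<partial>lborel) < \<infinity>"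
      using nn_integral_weight_heat[OF t, where 'a='a] t by (simp add: norm_mult gamma_weight_nonneg)
  qed measurable
  also have "\<dots> = (\<integral>s. complex_of_real (gamma_weight t s * exp (- (s * (norm \<xi>)\<^sup>2))) \<partial>lborel)"
  proof (intro Bochner_Integration.integral_cong refl)
    fix s :: real
    show "(\<integral>x. complex_of_real (gamma_weight t s) * (complex_of_real (heat s x) * iexp (x \<bullet> \<xi>)) \<partial>lborel)
        = complex_of_real (gamma_weight t s * exp (- (s * (norm \<xi>)\<^sup>2)))"
      using integral_heat_iexp[of s \<xi>] by (cases "0 < s") (simp_all add: exp_of_real[symmetric])
  qed
  also have "\<dots> = bessel_symbol (- t) \<xi>"
    using integral_gamma_weight_exp[OF t, of "(norm \<xi>)\<^sup>2"]
    by (simp add: bessel_symbol_def del: of_real_mult)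
  finally show ?thesis .
qed

section \<open>Fourier inversion and uniqueness\<close>

text \<open>Parabolic scaling: time \<open>r\<^sup>2\<close> corresponds to length \<open>r\<close>.
  The shrinking kernel becomes a fixed one and only the argument of \<open>h\<close> moves, which is
  the form that dominated convergence needs as \<open>r\<close> tends to 0.\<close>

lemma integral_heat_scale:
  fixes h :: "'a::euclidean_space \<Rightarrow> complex"
  assumes r: "0 < r" and [measurable]: "h \<in> borel_measurable borel"
  shows "(\<integral>y. complex_of_real (heat (r\<^sup>2) (x - y)) * h y \<partial>lborel)
    = (\<integral>y. complex_of_real (heat 1 y) * h (x - r *\<^sub>R y) \<partial>lborel)"
proof -
  let ?F = "\<lambda>y. complex_of_real (heat (r\<^sup>2) (x - y)) * h y"
  have sc: "r ^ DIM('a) * heat (r\<^sup>2) (r *\<^sub>R y) = heat 1 y" for y :: 'a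
  proof -
    have "(4 * pi * r\<^sup>2) powr (- (DIM('a) / 2)) = (4 * pi) powr (- (DIM('a) / 2)) * (r\<^sup>2) powr (- (DIM('a) / 2))"
      by (rule powr_mult)
    also have "(r\<^sup>2) powr (- (DIM('a) / 2)) = (r powr 2) powr (- (DIM('a) / 2))"
      using r by simp
    also have "\<dots> = r powr (- real DIM('a))"
      by (subst powr_powr) simp
    also have "\<dots> = 1 / r ^ DIM('a)"
      using r by (simp only: powr_minus_divide powr_realpow)
    finally show ?thesis
      using r by (simp add: heat_def power_mult_distrib)
  qed
  have "(\<integral>y. ?F y \<partial>lborel)
     = integral\<^sup>L (density (distr lborel borel (\<lambda>y. x + (- r) *\<^sub>R y)) (\<lambda>_. ennreal (\<bar>- r\<bar> ^ DIM('a)))) ?F"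
    using r by (subst lborel_affine[of "- r" x]) simp_all
  also have "\<dots> = (\<integral>y. (r ^ DIM('a)) *\<^sub>R ?F (x + (- r) *\<^sub>R y) \<partial>lborel)"
    using r by (subst integral_density) (simp_all add: integral_distr)
  also have "\<dots> = (\<integral>y. complex_of_real (r ^ DIM('a) * heat (r\<^sup>2) (r *\<^sub>R y)) * h (x - r *\<^sub>R y) \<partial>lborel)"
    by (simp add: scaleR_conv_of_real mult.assoc)
  finally show ?thesis unfolding sc .
qed

lemma heat_approx_identity:
  fixes h :: "'a::euclidean_space \<Rightarrow> complex"
  assumes cont: "continuous_on UNIV h" and bd: "\<And>x. norm (h x) \<le> B"
    and r: "\<And>n. 0 < r n" "r \<longlonglongrightarrow> 0"
  shows "(\<lambda>n. \<integral>y. complex_of_real (heat ((r n)\<^sup>2) (x - y)) * h y \<partial>lborel) \<longlonglongrightarrow> h x"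
proof -
  have [measurable]: "h \<in> borel_measurable borel"
    using cont by (rule borel_measurable_continuous_onI)
  have "(\<lambda>n. \<integral>y. complex_of_real (heat 1 y) * h (x - r n *\<^sub>R y) \<partial>lborel)
     \<longlonglongrightarrow> (\<integral>y. complex_of_real (heat 1 (y::'a)) * h x \<partial>lborel)"
  proof (rule integral_dominated_convergence[where w = "\<lambda>y. heat 1 y * B"])
    show "integrable lborel (\<lambda>y::'a. heat 1 y * B)"
      by (intro integrable_mult_left integrable_heat) simp
    show "AE y in lborel. (\<lambda>n. complex_of_real (heat 1 (y::'a)) * h (x - r n *\<^sub>R y)) \<longlonglongrightarrow> complex_of_real (heat 1 y) * h x"
    proof (intro AE_I2 tendsto_mult tendsto_const)
      fix y :: 'a
      have "(\<lambda>n. x - r n *\<^sub>R y) \<longlonglongrightarrow> x - 0 *\<^sub>R y"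
        by (intro tendsto_intros r)
      moreover have "isCont h x"
        using cont by (simp add: continuous_on_eq_continuous_at)
      ultimately show "(\<lambda>n. h (x - r n *\<^sub>R y)) \<longlonglongrightarrow> h x"
        by (auto intro: isCont_tendsto_compose)
    qed
    show "AE y in lborel. norm (complex_of_real (heat 1 (y::'a)) * h (x - r n *\<^sub>R y)) \<le> heat 1 y * B" for n
      by (auto simp: norm_mult intro!: mult_left_mono bd)
  qed auto
  moreover have "(\<integral>y. complex_of_real (heat 1 (y::'a)) * h x \<partial>lborel) = h x"
    using integrable_heat[of 1, where 'a='a] integral_heat[of 1, where 'a='a] by simp
  ultimately show ?thesis
    by (simp only: integral_heat_scale[OF r(1) \<open>h \<in> borel_measurable borel\<close>])
qed

lemma exp_eq_heat:
  fixes \<xi> :: "'a::euclidean_space"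
  assumes "0 < \<epsilon>"
  shows "exp (- (\<epsilon> * (norm \<xi>)\<^sup>2)) = (pi / \<epsilon>) powr (DIM('a) / 2) * heat (1 / (4 * \<epsilon>)) \<xi>"
  using assms by (simp add: heat_def powr_minus_divide)

text \<open>Bookkeeping for the transform of the regulariser
  \<open>exp (- (\<epsilon> * (norm \<xi>)\<^sup>2))\<close>: since
  \<open>4 * pi * \<epsilon> * (pi / \<epsilon>)\<close> is the square of \<open>2 * pi\<close>, the
  transform is the inversion constant times the heat kernel at time
  \<open>\<epsilon>\<close>.\<close>

lemma two_pi_powr_heat:
  fixes z :: "'a::euclidean_space"
  assumes "0 < \<epsilon>"
  shows "(pi / \<epsilon>) powr (DIM('a) / 2) * exp (- ((norm z)\<^sup>2 / (4 * \<epsilon>))) = (2 * pi) ^ DIM('a) * heat \<epsilon> z"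
proof -
  have "(4 * pi * \<epsilon>) powr (DIM('a) / 2) * (pi / \<epsilon>) powr (DIM('a) / 2) = (4 * pi * \<epsilon> * (pi / \<epsilon>)) powr (DIM('a) / 2)"
    by (rule powr_mult[symmetric])
  also have "4 * pi * \<epsilon> * (pi / \<epsilon>) = (2 * pi) powr 2"
    using assms by (simp add: power2_eq_square)
  also have "\<dots> powr (DIM('a) / 2) = (2 * pi) ^ DIM('a)"
    by (simp only: powr_powr) (simp add: powr_realpow)
  finally show ?thesis
    using assms by (simp add: heat_def powr_minus_divide field_simps)
qed

text \<open>The Gaussian factor makes the double integral absolutely convergent for every integrable
  \<open>f\<close>, with no assumption on its transform. Integrating over \<open>\<xi>\<close> first
  leaves a heat average of \<open>f\<close>. Inversion and uniqueness both come from this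
  identity.\<close>

lemma gauss_inversion:
  fixes f :: "'a::euclidean_space \<Rightarrow> complex"
  assumes f: "integrable lborel f" and \<epsilon>: "0 < \<epsilon>"
  shows "(\<integral>\<xi>. complex_of_real (exp (- (\<epsilon> * (norm \<xi>)\<^sup>2))) * iexp (- (x \<bullet> \<xi>)) * (\<integral>y. f y * iexp (y \<bullet> \<xi>) \<partial>lborel) \<partial>lborel)
    = complex_of_real ((2 * pi) ^ DIM('a)) * (\<integral>y. complex_of_real (heat \<epsilon> (x - y)) * f y \<partial>lborel)"
proof -
  let ?c = "(pi / \<epsilon>) powr (DIM('a) / 2)" and ?h = "heat (1 / (4 * \<epsilon>)) :: 'a \<Rightarrow> real"
  have \<epsilon>': "0 < 1 / (4 * \<epsilon>)" using \<epsilon> by simp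
  note [measurable] = borel_measurable_integrable[OF f, simplified]
  have e: "iexp (\<xi> \<bullet> (y - x)) = iexp (- (x \<bullet> \<xi>)) * iexp (y \<bullet> \<xi>)" for \<xi> y
    unfolding exp_add[symmetric]
    by (rule arg_cong[where f = exp])
       (simp add: inner_diff_right inner_commute[of \<xi>] algebra_simps)
  have "(\<integral>\<xi>. complex_of_real (exp (- (\<epsilon> * (norm \<xi>)\<^sup>2))) * iexp (- (x \<bullet> \<xi>)) * (\<integral>y. f y * iexp (y \<bullet> \<xi>) \<partial>lborel) \<partial>lborel)
     = (\<integral>\<xi>. \<integral>y. complex_of_real ?c * f y * (complex_of_real (?h \<xi>) * iexp (\<xi> \<bullet> (y - x))) \<partial>lborel \<partial>lborel)"
    unfolding exp_eq_heat[OF \<epsilon>] e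
    by (intro Bochner_Integration.integral_cong refl, subst integral_mult_right_zero[symmetric])
       (intro Bochner_Integration.integral_cong refl, simp only: of_real_mult mult_ac)
  also have "\<dots> = (\<integral>y. \<integral>\<xi>. complex_of_real ?c * f y * (complex_of_real (?h \<xi>) * iexp (\<xi> \<bullet> (y - x))) \<partial>lborel \<partial>lborel)"
  proof (rule integral_swap_lborel)
    have "(\<integral>\<^sup>+\<xi>. \<integral>\<^sup>+y. ennreal (norm (complex_of_real ?c * f y * (complex_of_real (?h \<xi>) * iexp (\<xi> \<bullet> (y - x))))) \<partial>lborel \<partial>lborel)
      = (\<integral>\<^sup>+\<xi>. \<integral>\<^sup>+y. ennreal ?c * (ennreal (?h \<xi>) * ennreal (norm (f y))) \<partial>lborel \<partial>lborel)"
      by (intro nn_integral_cong) (simp add: norm_mult ennreal_mult mult_ac)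
    also have "\<dots> = ennreal ?c * ((\<integral>\<^sup>+\<xi>. ennreal (?h \<xi>) \<partial>lborel) * (\<integral>\<^sup>+y. ennreal (norm (f y)) \<partial>lborel))"
      by (simp add: nn_integral_cmult nn_integral_multc)
    also have "\<dots> < \<infinity>"
      using f \<epsilon>' by (simp add: nn_integral_heat integrable_iff_bounded ennreal_mult_less_top)
    finally show "(\<integral>\<^sup>+\<xi>. \<integral>\<^sup>+y. ennreal (norm (complex_of_real ?c * f y * (complex_of_real (?h \<xi>) * iexp (\<xi> \<bullet> (y - x))))) \<partial>lborel \<partial>lborel) < \<infinity>" .
  qed measurable
  also have "\<dots> = (\<integral>y. complex_of_real ((2 * pi) ^ DIM('a)) * (complex_of_real (heat \<epsilon> (x - y)) * f y) \<partial>lborel)"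
  proof (intro Bochner_Integration.integral_cong refl)
    fix y
    have "(\<integral>\<xi>. complex_of_real ?c * f y * (complex_of_real (?h \<xi>) * iexp (\<xi> \<bullet> (y - x))) \<partial>lborel)
      = complex_of_real (?c * exp (- ((norm (x - y))\<^sup>2 / (4 * \<epsilon>)))) * f y"
      using \<epsilon> by (subst integral_mult_right_zero, subst integral_heat_iexp[OF \<epsilon>'])
        (simp add: norm_minus_commute exp_of_real[symmetric])
    then show "(\<integral>\<xi>. complex_of_real ?c * f y * (complex_of_real (?h \<xi>) * iexp (\<xi> \<bullet> (y - x))) \<partial>lborel)
      = complex_of_real ((2 * pi) ^ DIM('a)) * (complex_of_real (heat \<epsilon> (x - y)) * f y)"
      unfolding two_pi_powr_heat[OF \<epsilon>] by simp
  qed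
  finally show ?thesis by simp
qed

lemma LIMSEQ_inverse_Suc: "(\<lambda>n. 1 / real (Suc n)) \<longlonglongrightarrow> 0"
  using LIMSEQ_inverse_real_of_nat by (simp add: inverse_eq_divide)

theorem fourier_inversion_lborel:
  fixes f :: "'a::euclidean_space \<Rightarrow> complex"
  assumes f: "integrable lborel f" and cont: "continuous_on UNIV f" and bd: "\<And>x. norm (f x) \<le> B"
    and A: "integrable lborel (\<lambda>\<xi>. \<integral>y. f y * iexp (y \<bullet> \<xi>) \<partial>lborel)" (is "integrable lborel ?A")
  shows "(\<integral>\<xi>. ?A \<xi> * iexp (- (x \<bullet> \<xi>)) \<partial>lborel) = complex_of_real ((2 * pi) ^ DIM('a)) * f x"
proof -
  define r where "r n = 1 / real (Suc n)" for n
  have r: "0 < r n" for n by (simp add: r_def)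
  have r0: "r \<longlonglongrightarrow> 0" unfolding r_def by (rule LIMSEQ_inverse_Suc)
  note [measurable] = borel_measurable_integrable[OF f, simplified] borel_measurable_integrable[OF A, simplified]
  \<comment> \<open>The limit keeps the literal \<open>0\<^sup>2\<close> so that it has the shape
    produced by the limit rules.\<close>
  have "(\<lambda>n. \<integral>\<xi>. complex_of_real (exp (- ((r n)\<^sup>2 * (norm \<xi>)\<^sup>2))) * iexp (- (x \<bullet> \<xi>)) * ?A \<xi> \<partial>lborel)
     \<longlonglongrightarrow> (\<integral>\<xi>. complex_of_real (exp (- (0\<^sup>2 * (norm \<xi>)\<^sup>2))) * iexp (- (x \<bullet> \<xi>)) * ?A \<xi> \<partial>lborel)"
  proof (rule integral_dominated_convergence[where w = "\<lambda>\<xi>. norm (?A \<xi>)"])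
    show "AE \<xi> in lborel. (\<lambda>n. complex_of_real (exp (- ((r n)\<^sup>2 * (norm \<xi>)\<^sup>2))) * iexp (- (x \<bullet> \<xi>)) * ?A \<xi>)
       \<longlonglongrightarrow> complex_of_real (exp (- (0\<^sup>2 * (norm \<xi>)\<^sup>2))) * iexp (- (x \<bullet> \<xi>)) * ?A \<xi>"
      by (intro AE_I2 tendsto_mult tendsto_const tendsto_of_real tendsto_exp tendsto_minus tendsto_power r0)
    show "AE \<xi> in lborel. norm (complex_of_real (exp (- ((r n)\<^sup>2 * (norm \<xi>)\<^sup>2))) * iexp (- (x \<bullet> \<xi>)) * ?A \<xi>) \<le> norm (?A \<xi>)" for n
      by (auto simp: norm_mult norm_exp_i_times intro!: mult_left_le_one_le)
  qed (use A in \<open>auto\<close>)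
  moreover have "(\<lambda>n. \<integral>\<xi>. complex_of_real (exp (- ((r n)\<^sup>2 * (norm \<xi>)\<^sup>2))) * iexp (- (x \<bullet> \<xi>)) * ?A \<xi> \<partial>lborel)
     \<longlonglongrightarrow> complex_of_real ((2 * pi) ^ DIM('a)) * f x"
    by (subst gauss_inversion[OF f zero_less_power[OF r]]) (auto intro!: tendsto_intros heat_approx_identity[OF cont bd r r0])
  ultimately have "(\<integral>\<xi>. complex_of_real (exp (- (0\<^sup>2 * (norm \<xi>)\<^sup>2))) * iexp (- (x \<bullet> \<xi>)) * ?A \<xi> \<partial>lborel)
     = complex_of_real ((2 * pi) ^ DIM('a)) * f x"
    by (rule LIMSEQ_unique)
  then show ?thesis by (simp add: mult.commute)
qed

text \<open>By \<open>gauss_inversion\<close> every heat average of \<open>f\<close> vanishes. Hence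
  \<open>f\<close> integrates to 0 against bounded continuous functions, then over closed sets, then
  over all Borel sets, which forces it to vanish almost everywhere.\<close>

theorem fourier_unique_lborel:
  fixes f :: "'a::euclidean_space \<Rightarrow> complex"
  assumes f: "integrable lborel f" and A: "\<And>\<xi>. (\<integral>y. f y * iexp (y \<bullet> \<xi>) \<partial>lborel) = 0"
  shows "AE x in lborel. f x = 0"
proof -
  note [measurable] = borel_measurable_integrable[OF f, simplified]
  have conv0: "(\<integral>y. complex_of_real (heat \<epsilon> (x - y)) * f y \<partial>lborel) = 0" if "0 < \<epsilon>" for \<epsilon> x
  proof -
    have "complex_of_real ((2 * pi) ^ DIM('a)) * (\<integral>y. complex_of_real (heat \<epsilon> (x - y)) * f y \<partial>lborel) = 0"
      by (subst gauss_inversion[OF f that, symmetric]) (simp only: A mult_zero_right integral_zero)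
    then show ?thesis by (simp del: of_real_power)
  qed
  \<comment> \<open>Heat averages of \<open>h\<close> converge boundedly to \<open>h\<close>; by
    symmetry of the kernel, pairing \<open>f\<close> with such an average is pairing
    \<open>h\<close> with a heat average of \<open>f\<close>.\<close>
  have test: "(\<integral>y. f y * h y \<partial>lborel) = 0"
    if cont: "continuous_on UNIV h" and bd: "\<And>x. norm (h x) \<le> B" for h B
  proof -
    define r where "r n = 1 / real (Suc n)" for n
    have r: "0 < r n" for n by (simp add: r_def)
    have r0: "r \<longlonglongrightarrow> 0" unfolding r_def by (rule LIMSEQ_inverse_Suc)
    have [measurable]: "h \<in> borel_measurable borel"
      using cont by (rule borel_measurable_continuous_onI)
    define hn where "hn n y = (\<integral>x. complex_of_real (heat ((r n)\<^sup>2) (y - x)) * h x \<partial>lborel)" for n y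
    have [measurable]: "hn n \<in> borel_measurable borel" for n
      unfolding hn_def by measurable
    have B0: "0 \<le> B"
      using bd[of 0] by (rule order_trans[OF norm_ge_zero])
    have hnB: "norm (hn n y) \<le> B" for n y
    proof -
      have i: "integrable lborel (\<lambda>x. heat ((r n)\<^sup>2) (y - x) * B)"
        using r[of n] by (intro integrable_mult_left integrable_heat_diff) simp
      have "norm (hn n y) \<le> (\<integral>x. heat ((r n)\<^sup>2) (y - x) * B \<partial>lborel)"
        unfolding hn_def by (rule Bochner_Integration.integral_norm_bound_integral[OF Bochner_Integration.integrable_bound[OF i] i])
          (auto simp: norm_mult abs_mult B0 intro!: mult_left_mono bd)
      also have "\<dots> = B"
        using r[of n] by (simp add: integral_heat_diff)
      finally show ?thesis .
    qed
    have "(\<lambda>n. \<integral>y. f y * hn n y \<partial>lborel) \<longlonglongrightarrow> (\<integral>y. f y * h y \<partial>lborel)"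
    proof (rule integral_dominated_convergence[where w = "\<lambda>y. norm (f y) * B"])
      show "AE y in lborel. (\<lambda>n. f y * hn n y) \<longlonglongrightarrow> f y * h y"
        unfolding hn_def by (intro AE_I2 tendsto_mult tendsto_const heat_approx_identity[OF cont bd r r0])
      show "AE y in lborel. norm (f y * hn n y) \<le> norm (f y) * B" for n
        by (auto simp: norm_mult intro!: mult_left_mono hnB)
    qed (use f in auto)
    moreover have "(\<integral>y. f y * hn n y \<partial>lborel) = 0" for n
    proof -
      have "(\<integral>y. f y * hn n y \<partial>lborel)
        = (\<integral>y. \<integral>x. f y * (complex_of_real (heat ((r n)\<^sup>2) (y - x)) * h x) \<partial>lborel \<partial>lborel)"
        unfolding hn_def by simp
      also have "\<dots> = (\<integral>x. \<integral>y. f y * (complex_of_real (heat ((r n)\<^sup>2) (y - x)) * h x) \<partial>lborel \<partial>lborel)"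
      proof (rule integral_swap_lborel)
        have "(\<integral>\<^sup>+y. \<integral>\<^sup>+x. ennreal (norm (f y * (complex_of_real (heat ((r n)\<^sup>2) (y - x)) * h x))) \<partial>lborel \<partial>lborel)
          \<le> (\<integral>\<^sup>+y. \<integral>\<^sup>+x. ennreal (norm (f y)) * (ennreal (heat ((r n)\<^sup>2) (y - x)) * ennreal B) \<partial>lborel \<partial>lborel)"
          by (intro nn_integral_mono)
             (auto simp: norm_mult ennreal_mult'[symmetric] intro!: ennreal_leI mult_left_mono bd)
        also have "\<dots> = (\<integral>\<^sup>+y. ennreal (norm (f y)) \<partial>lborel) * ennreal B"
          using r[of n] by (simp add: nn_integral_cmult nn_integral_multc nn_integral_heat_diff)
        also have "\<dots> < \<infinity>"
          using f by (simp add: integrable_iff_bounded ennreal_mult_less_top)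
        finally show "(\<integral>\<^sup>+y. \<integral>\<^sup>+x. ennreal (norm (f y * (complex_of_real (heat ((r n)\<^sup>2) (y - x)) * h x))) \<partial>lborel \<partial>lborel) < \<infinity>" .
      qed measurable
      also have "\<dots> = (\<integral>x. h x * (\<integral>y. complex_of_real (heat ((r n)\<^sup>2) (x - y)) * f y \<partial>lborel) \<partial>lborel)"
      proof -
        have eq: "f y * (complex_of_real (heat ((r n)\<^sup>2) (y - x)) * h x)
            = h x * (complex_of_real (heat ((r n)\<^sup>2) (x - y)) * f y)" for x y
          by (simp add: heat_diff_commute[of _ y x])
        show ?thesis unfolding eq by simp
      qed
      also have "\<dots> = 0"
        using r[of n] by (simp add: conv0)
      finally show ?thesis .
    qed
    ultimately show ?thesis
      by (simp add: LIMSEQ_const_iff)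
  qed
  have closed0: "(\<integral>x. indicator C x *\<^sub>R f x \<partial>lborel) = 0" if C: "closed C" for C
  \<comment> \<open>\<open>infdist x {}\<close> is 0 by convention, so the cutoffs used below would
    not tend to the indicator of the empty set. For nonempty closed \<open>C\<close>, points outside
    have positive distance and the cutoffs eventually vanish there.\<close>
  proof (cases "C = {}")
    case False
    define h where "h n x = complex_of_real (max 0 (1 - real n * infdist x C))" for n :: nat and x
    have hc: "continuous_on UNIV (h n)" for n
      unfolding h_def by (intro continuous_intros)
    have hb: "norm (h n x) \<le> 1" for n x
      unfolding h_def by (auto simp: infdist_nonneg)
    have "(\<lambda>n. \<integral>x. f x * h n x \<partial>lborel) \<longlonglongrightarrow> (\<integral>x. f x * indicator C x \<partial>lborel)"
    proof (rule integral_dominated_convergence[where w = "\<lambda>y. norm (f y)"])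
      have hl: "(\<lambda>n. h n x) \<longlonglongrightarrow> indicator C x" for x
      proof (cases "x \<in> C")
        case True
        then show ?thesis by (simp add: h_def)
      next
        case False
        then have d: "0 < infdist x C"
          using C \<open>C \<noteq> {}\<close> by (simp add: infdist_pos_not_in_closed)
        obtain n0 where "1 / infdist x C < real n0" using reals_Archimedean2 by blast
        then have "1 \<le> real n * infdist x C" if "n \<ge> n0" for n
          using that d by (smt (verit, best) divide_less_eq mult_right_mono of_nat_mono)
        then have "\<forall>\<^sub>F n in sequentially. h n x = 0"
          by (auto simp: eventually_sequentially h_def intro!: exI[of _ n0])
        then show ?thesis
          using False by (simp add: tendsto_eventually)
      qed
      show "AE x in lborel. (\<lambda>n. f x * h n x) \<longlonglongrightarrow> f x * indicator C x"
        by (intro AE_I2 tendsto_mult tendsto_const hl)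
      show "AE x in lborel. norm (f x * h n x) \<le> norm (f x)" for n
        by (auto simp: norm_mult intro!: mult_right_le_one_le hb)
      show "(\<lambda>x. f x * indicator C x) \<in> borel_measurable lborel"
        using C by simp
      show "(\<lambda>x. f x * h n x) \<in> borel_measurable lborel" for n
        using borel_measurable_continuous_onI[OF hc] by simp
    qed (use f in auto)
    moreover have "(\<integral>x. f x * h n x \<partial>lborel) = 0" for n
      by (rule test[OF hc hb])
    ultimately have "(\<integral>x. f x * indicator C x \<partial>lborel) = 0"
      by (simp add: LIMSEQ_const_iff)
    also have "(\<integral>x. f x * indicator C x \<partial>lborel) = (\<integral>x. indicator C x *\<^sub>R f x \<partial>lborel)"
      by (intro Bochner_Integration.integral_cong) (auto simp: indicator_def)
    finally show ?thesis .
  qed simp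
  show ?thesis
  proof (rule sigma_finite_measure.density_zero[OF sigma_finite_lborel f])
    fix A :: "'a set" assume "A \<in> sets lborel"
    then have A: "A \<in> sigma_sets UNIV (Collect closed)"
      by (simp add: borel_eq_closed)
    \<comment> \<open>Closed sets generate the Borel sets and are stable under intersection, so
      Dynkin's lemma applies.\<close>
    have "Int_stable (Collect closed :: 'a set set)" "Collect closed \<subseteq> Pow (UNIV :: 'a set)"
      by (auto simp: Int_stable_def)
    from this A have "(\<integral>x. indicator A x *\<^sub>R f x \<partial>lborel) = 0"
    proof (induction rule: sigma_sets_induct_disjoint)
      case (basic A)
      then show ?case using closed0 by simp
    next
      case (compl A)
      then have [measurable]: "A \<in> sets borel" by (simp add: borel_eq_closed)
      have "(\<integral>x. indicator (UNIV - A) x *\<^sub>R f x \<partial>lborel) = (\<integral>x. indicator UNIV x *\<^sub>R f x - indicator A x *\<^sub>R f x \<partial>lborel)"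
        by (intro Bochner_Integration.integral_cong) (auto simp: indicator_def)
      also have "\<dots> = (\<integral>x. indicator UNIV x *\<^sub>R f x \<partial>lborel) - (\<integral>x. indicator A x *\<^sub>R f x \<partial>lborel)"
        by (intro Bochner_Integration.integral_diff integrable_mult_indicator f) auto
      finally show ?case using compl closed0[of UNIV] by simp
    next
      case (union A)
      then have [measurable]: "A i \<in> sets borel" for i by (auto simp: borel_eq_closed)
      have "(LINT x:(\<Union>i. A i)|lborel. f x) = (\<Sum>i. (LINT x:(A i)|lborel. f x))"
      proof (rule lebesgue_integral_countable_add)
        show "A i \<inter> A j = {}" if "i \<noteq> j" for i j
          using union that by (auto simp: disjoint_family_on_def)
        show "set_integrable lborel (\<Union>i. A i) f"
          unfolding set_integrable_def by (intro integrable_mult_indicator f) auto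
      qed simp
      then show ?case using union by (simp add: set_lebesgue_integral_def)
    next
      case empty show ?case by simp
    qed
    then show "set_lebesgue_integral lborel A f = 0"
      by (simp add: set_lebesgue_integral_def)
  qed
qed

section \<open>Inequalities for heat averages\<close>

text \<open>The right-hand side is the tangent at \<open>a powr p\<close> to the concave function
  \<open>y powr (1 / p)\<close>, taken at \<open>y = x powr p\<close>. Young's inequality supplies
  it.\<close>

lemma le_tangent_powr:
  fixes x a p :: real
  assumes "1 < p" "0 < a" "0 \<le> x"
  shows "x \<le> a powr (1 - p) / p * x powr p + a * (1 - 1 / p)"
proof -
  define q where "q = p / (p - 1)"
  have q: "1 < q" "1 / p + 1 / q = 1" "1 / q = 1 - 1 / p"
    using assms(1) by (auto simp: q_def field_simps)
  have qp: "- (1 / q) * p = 1 - p"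
    using assms(1) unfolding q(3) by (simp add: algebra_simps)
  have "x = (x * a powr (- (1 / q))) * a powr (1 / q)"
    using assms(2) by (simp add: mult.assoc powr_add[symmetric])
  also have "\<dots> \<le> (x * a powr (- (1 / q))) powr p / p + (a powr (1 / q)) powr q / q"
    using assms q by (intro Youngs_inequality) auto
  also have "(a powr (1 / q)) powr q = a"
    using assms(2) q(1) by (simp add: powr_powr)
  also have "(x * a powr (- (1 / q))) powr p = x powr p * a powr (1 - p)"
    by (simp only: powr_mult powr_powr qp)
  also have "x powr p * a powr (1 - p) / p + a / q = a powr (1 - p) / p * x powr p + a * (1 - 1 / p)"
    unfolding q(3)[symmetric] by simp
  finally show ?thesis .
qed

text \<open>Jensen's inequality for a weight of mass at most 1: the tangent inequality is averaged
  against \<open>k\<close> and optimised at \<open>a = B powr (1 / p)\<close>. Working with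
  \<open>ennreal\<close> integrals avoids integrability hypotheses.\<close>

lemma nn_integral_jensen:
  fixes k f :: "'b \<Rightarrow> real" and p B :: real
  assumes [measurable]: "k \<in> borel_measurable M" "f \<in> borel_measurable M"
    and k: "\<And>x. 0 \<le> k x" and f: "\<And>x. 0 \<le> f x" and p: "1 < p" and B: "0 \<le> B"
    and k1: "(\<integral>\<^sup>+x. ennreal (k x) \<partial>M) \<le> 1"
    and kf: "(\<integral>\<^sup>+x. ennreal (k x * f x powr p) \<partial>M) \<le> ennreal B"
  shows "(\<integral>\<^sup>+x. ennreal (k x * f x) \<partial>M) \<le> ennreal (B powr (1 / p))"
proof -
  have *: "(\<integral>\<^sup>+x. ennreal (k x * f x) \<partial>M) \<le> ennreal (a powr (1 - p) / p * B + a * (1 - 1 / p))"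
    if a: "0 < a" for a
  proof -
    let ?c = "a powr (1 - p) / p" and ?d = "a * (1 - 1 / p)"
    have c: "0 \<le> ?c" and d: "0 \<le> ?d" using a p by auto
    have "(\<integral>\<^sup>+x. ennreal (k x * f x) \<partial>M)
        \<le> (\<integral>\<^sup>+x. ennreal ?c * ennreal (k x * f x powr p) + ennreal ?d * ennreal (k x) \<partial>M)"
    proof (intro nn_integral_mono)
      fix x
      have "k x * f x \<le> k x * (?c * f x powr p + ?d)"
        by (intro mult_left_mono le_tangent_powr p a f k)
      also have "\<dots> = ?c * (k x * f x powr p) + ?d * k x"
        by (simp add: algebra_simps)
      finally show "ennreal (k x * f x) \<le> ennreal ?c * ennreal (k x * f x powr p) + ennreal ?d * ennreal (k x)"
        using c d k[of x] by (simp only: ennreal_mult'[symmetric] ennreal_plus[symmetric] mult_nonneg_nonneg powr_ge_zero ennreal_leI)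
    qed
    also have "\<dots> = ennreal ?c * (\<integral>\<^sup>+x. ennreal (k x * f x powr p) \<partial>M) + ennreal ?d * (\<integral>\<^sup>+x. ennreal (k x) \<partial>M)"
      by (simp add: nn_integral_add nn_integral_cmult)
    also have "\<dots> \<le> ennreal ?c * ennreal B + ennreal ?d * 1"
      by (intro add_mono mult_left_mono kf k1) auto
    also have "\<dots> = ennreal (?c * B + ?d)"
      using c d B by (simp only: ennreal_mult'[symmetric] ennreal_plus[symmetric] mult_nonneg_nonneg mult_1_right)
    finally show ?thesis .
  qed
  show ?thesis
  \<comment> \<open>For \<open>B = 0\<close> the optimal \<open>a\<close> would be 0, which is not
    an admissible point of tangency, so \<open>a\<close> tends to 0 instead.\<close>
  proof (cases "B = 0")
    case True
    have "(\<integral>\<^sup>+x. ennreal (k x * f x) \<partial>M) \<le> 0"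
    proof (rule ennreal_le_epsilon)
      fix e :: real assume e: "0 < e"
      have "(\<integral>\<^sup>+x. ennreal (k x * f x) \<partial>M) \<le> ennreal (e * (1 - 1 / p))"
        using *[OF e] True by simp
      also have "\<dots> \<le> ennreal e"
        using e p by (intro ennreal_leI) (simp add: mult_left_le)
      finally show "(\<integral>\<^sup>+x. ennreal (k x * f x) \<partial>M) \<le> 0 + ennreal e" by simp
    qed
    then show ?thesis by simp
  next
    case False
    with B have B: "0 < B" by simp
    have "(B powr (1 / p)) powr (1 - p) * B = B powr (1 / p)"
    proof -
      have "(B powr (1 / p)) powr (1 - p) * B = B powr (1 / p * (1 - p)) * B powr 1"
        using B by (simp add: powr_powr)
      also have "\<dots> = B powr (1 / p)"
        unfolding powr_add[symmetric] using p by (simp add: field_simps)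
      finally show ?thesis .
    qed
    then have "(B powr (1 / p)) powr (1 - p) / p * B + B powr (1 / p) * (1 - 1 / p)
        = B powr (1 / p) / p + B powr (1 / p) * (1 - 1 / p)"
      by simp
    also have "\<dots> = B powr (1 / p)"
      using p by (simp add: algebra_simps)
    finally show ?thesis using *[of "B powr (1 / p)"] B by simp
  qed
qed

lemma nn_integral_powr_from_0:
  assumes "0 < a" "0 \<le> (c::real)"
  shows "(\<integral>\<^sup>+s. ennreal (s powr (a - 1)) * indicator {0..c} s \<partial>lborel) = ennreal (c powr a / a)"
  using nn_integral_has_integral_lebesgue'[OF _ has_integral_powr_from_0[of "a - 1" c]] assms by simp

lemma nn_integral_powr_to_inf:
  assumes "0 < a" "0 < (c::real)"
  shows "(\<integral>\<^sup>+s. ennreal (s powr (- a - 1)) * indicator {c..} s \<partial>lborel) = ennreal (c powr (- a) / a)"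
  using nn_integral_has_integral_lebesgue'[OF _ has_integral_powr_to_inf[of "- a - 1" c]] assms by simp

definition heat_conv :: "('a::euclidean_space \<Rightarrow> real) \<Rightarrow> real \<Rightarrow> 'a \<Rightarrow> ennreal" where
  "heat_conv f s x = (\<integral>\<^sup>+y. ennreal (heat s (x - y) * f y) \<partial>lborel)"

lemma measurable_heat_conv [measurable]:
  assumes [measurable]: "f \<in> borel_measurable borel"
  shows "(\<lambda>(s, x). heat_conv f s x) \<in> borel_measurable (borel \<Otimes>\<^sub>M borel)"
  unfolding heat_conv_def by measurable

text \<open>The smoothing rate from \<open>L\<^sup>p\<close> to bounded functions: Jensen for the
  probability density \<open>heat s (x - y)\<close> in \<open>y\<close>, then the kernel is bounded
  by its value at the origin.\<close>

lemma heat_conv_le: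
  fixes f :: "'a::euclidean_space \<Rightarrow> real"
  assumes [measurable]: "f \<in> borel_measurable borel" and f: "\<And>x. 0 \<le> f x"
    and p: "1 < p" and s: "0 < s" and A: "0 \<le> A" "(\<integral>\<^sup>+y. ennreal (f y powr p) \<partial>lborel) \<le> ennreal A"
  shows "heat_conv f s x \<le> ennreal ((4 * pi) powr (- (DIM('a) / (2 * p))) * A powr (1 / p) * s powr (- (DIM('a) / (2 * p))))"
proof -
  let ?H = "(4 * pi * s) powr (- (DIM('a) / 2))"
  have "(\<integral>\<^sup>+y. ennreal (heat s (x - y) * f y powr p) \<partial>lborel)
      \<le> (\<integral>\<^sup>+y. ennreal ?H * ennreal (f y powr p) \<partial>lborel)"
    using s by (intro nn_integral_mono) (simp add: ennreal_mult'[symmetric] heat_le ennreal_leI mult_right_mono)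
  also have "\<dots> = ennreal ?H * (\<integral>\<^sup>+y. ennreal (f y powr p) \<partial>lborel)"
    by (rule nn_integral_cmult) simp
  also have "\<dots> \<le> ennreal ?H * ennreal A"
    by (intro mult_left_mono A) simp
  also have "\<dots> = ennreal (?H * A)"
    using A by (simp add: ennreal_mult')
  finally have "heat_conv f s x \<le> ennreal ((?H * A) powr (1 / p))"
    unfolding heat_conv_def using s A(1) f p
    by (intro nn_integral_jensen) (simp_all add: nn_integral_heat_diff)
  also have "(?H * A) powr (1 / p) = (4 * pi) powr (- (DIM('a) / (2 * p))) * A powr (1 / p) * s powr (- (DIM('a) / (2 * p)))"
    by (simp add: powr_mult powr_powr)
  finally show ?thesis .
qed

lemma nn_integral_heat_conv:
  fixes f :: "'a::euclidean_space \<Rightarrow> real"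
  assumes [measurable]: "f \<in> borel_measurable borel" and f: "\<And>x. 0 \<le> f x" and s: "0 < s"
  shows "(\<integral>\<^sup>+x. heat_conv f s x \<partial>lborel) = (\<integral>\<^sup>+y. ennreal (f y) \<partial>lborel)"
proof -
  have "(\<integral>\<^sup>+x. heat_conv f s x \<partial>lborel) = (\<integral>\<^sup>+y. \<integral>\<^sup>+x. ennreal (heat s (x - y) * f y) \<partial>lborel \<partial>lborel)"
    unfolding heat_conv_def by (rule nn_integral_swap_lborel) measurable
  also have "\<dots> = (\<integral>\<^sup>+y. ennreal (f y) \<partial>lborel)"
  proof (intro nn_integral_cong)
    fix y
    have "(\<integral>\<^sup>+x. ennreal (heat s (x - y) * f y) \<partial>lborel) = (\<integral>\<^sup>+x. ennreal (heat s (y - x)) * ennreal (f y) \<partial>lborel)"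
      using f by (simp add: ennreal_mult heat_diff_commute[of s _ y])
    also have "\<dots> = ennreal (f y)"
      using s by (simp add: nn_integral_multc nn_integral_heat_diff)
    finally show "(\<integral>\<^sup>+x. ennreal (heat s (x - y) * f y) \<partial>lborel) = ennreal (f y)" .
  qed
  finally show ?thesis .
qed

lemma heat_conv_le_const:
  fixes f :: "'a::euclidean_space \<Rightarrow> real"
  assumes "\<And>y. f y \<le> m" and s: "0 < s" and m: "0 \<le> m"
  shows "heat_conv f s x \<le> ennreal m"
proof -
  have "heat_conv f s x \<le> (\<integral>\<^sup>+y. ennreal (heat s (x - y)) * ennreal m \<partial>lborel)"
    unfolding heat_conv_def using assms
    by (intro nn_integral_mono) (simp add: ennreal_mult'[symmetric] ennreal_leI mult_left_mono)
  also have "\<dots> = ennreal m"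
    using s by (simp add: nn_integral_multc nn_integral_heat_diff)
  finally show ?thesis .
qed

lemma heat_conv_split:
  fixes f :: "'a::euclidean_space \<Rightarrow> real"
  assumes [measurable]: "f \<in> borel_measurable borel" "g \<in> borel_measurable borel"
    and "\<And>x. 0 \<le> f x" "\<And>x. 0 \<le> g x"
  shows "heat_conv (\<lambda>x. f x + g x) s x = heat_conv f s x + heat_conv g s x"
  unfolding heat_conv_def using assms
  by (subst nn_integral_add[symmetric]) (simp_all add: ring_distribs)

section \<open>Strong-type bound for the Riesz potential\<close>

text \<open>Since \<open>0 powr a = 0\<close>, it does not matter whether \<open>S\<close> contains \<open>0\<close>, although \<open>heat_conv f 0\<close> is junk.\<close>

definition riesz :: "real set \<Rightarrow> real \<Rightarrow> ('a::euclidean_space \<Rightarrow> real) \<Rightarrow> 'a \<Rightarrow> ennreal" where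
  "riesz S \<alpha> f x = (\<integral>\<^sup>+s. ennreal (s powr (\<alpha> - 1)) * indicator S s * heat_conv f s x \<partial>lborel)"

lemma measurable_riesz [measurable]:
  assumes [measurable]: "f \<in> borel_measurable borel" "S \<in> sets borel"
  shows "riesz S \<alpha> f \<in> borel_measurable borel"
  unfolding riesz_def by measurable

lemma riesz_le_near_far:
  fixes f :: "'a::euclidean_space \<Rightarrow> real"
  assumes [measurable]: "f \<in> borel_measurable borel" and "0 < \<delta>"
  shows "riesz {0..} \<alpha> f x \<le> riesz {0..\<delta>} \<alpha> f x + riesz {\<delta>..} \<alpha> f x"
proof -
  have "riesz {0..} \<alpha> f x \<le> (\<integral>\<^sup>+s. ennreal (s powr (\<alpha> - 1)) * indicator {0..\<delta>} s * heat_conv f s x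
     + ennreal (s powr (\<alpha> - 1)) * indicator {\<delta>..} s * heat_conv f s x \<partial>lborel)"
    unfolding riesz_def by (intro nn_integral_mono) (auto simp: indicator_def)
  also have "\<dots> = riesz {0..\<delta>} \<alpha> f x + riesz {\<delta>..} \<alpha> f x"
    unfolding riesz_def by (rule nn_integral_add) simp_all
  finally show ?thesis .
qed

lemma riesz_add:
  fixes f :: "'a::euclidean_space \<Rightarrow> real"
  assumes [measurable]: "f \<in> borel_measurable borel" "g \<in> borel_measurable borel" "S \<in> sets borel"
    and fg: "\<And>x. 0 \<le> f x" "\<And>x. 0 \<le> g x"
  shows "riesz S \<alpha> (\<lambda>x. f x + g x) x = riesz S \<alpha> f x + riesz S \<alpha> g x"
  unfolding riesz_def
  by (subst nn_integral_add[symmetric]) (simp_all add: heat_conv_split fg ring_distribs)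

lemma riesz_near_le_const:
  fixes f :: "'a::euclidean_space \<Rightarrow> real"
  assumes f: "\<And>y. f y \<le> m" and m: "0 \<le> m" and \<alpha>: "0 < \<alpha>" and \<delta>: "0 < \<delta>"
  shows "riesz {0..\<delta>} \<alpha> f x \<le> ennreal (m * (\<delta> powr \<alpha> / \<alpha>))"
proof -
  have "riesz {0..\<delta>} \<alpha> f x \<le> (\<integral>\<^sup>+s. ennreal (s powr (\<alpha> - 1)) * indicator {0..\<delta>} s * ennreal m \<partial>lborel)"
    unfolding riesz_def
  proof (intro nn_integral_mono)
    fix s :: real
    show "ennreal (s powr (\<alpha> - 1)) * indicator {0..\<delta>} s * heat_conv f s x
        \<le> ennreal (s powr (\<alpha> - 1)) * indicator {0..\<delta>} s * ennreal m"
    proof (cases "0 < s")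
      case True then show ?thesis by (intro mult_left_mono heat_conv_le_const f m) auto
    next
      case False then show ?thesis by (cases "s = 0") auto
    qed
  qed
  also have "\<dots> = ennreal (\<delta> powr \<alpha> / \<alpha>) * ennreal m"
    using \<alpha> \<delta> by (simp add: nn_integral_multc nn_integral_powr_from_0)
  also have "\<dots> = ennreal (m * (\<delta> powr \<alpha> / \<alpha>))"
    using m \<alpha> by (subst ennreal_mult'[symmetric]) (simp_all add: mult.commute)
  finally show ?thesis .
qed

lemma nn_integral_riesz_near:
  fixes f :: "'a::euclidean_space \<Rightarrow> real"
  assumes [measurable]: "f \<in> borel_measurable borel" and f: "\<And>x. 0 \<le> f x" and \<alpha>: "0 < \<alpha>" and \<delta>: "0 < \<delta>"
  shows "(\<integral>\<^sup>+x. riesz {0..\<delta>} \<alpha> f x \<partial>lborel) = ennreal (\<delta> powr \<alpha> / \<alpha>) * (\<integral>\<^sup>+y. ennreal (f y) \<partial>lborel)"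
proof -
  have "(\<integral>\<^sup>+x. riesz {0..\<delta>} \<alpha> f x \<partial>lborel)
     = (\<integral>\<^sup>+s. \<integral>\<^sup>+x. ennreal (s powr (\<alpha> - 1)) * indicator {0..\<delta>} s * heat_conv f s x \<partial>lborel \<partial>lborel)"
    unfolding riesz_def by (rule nn_integral_swap_lborel) measurable
  also have "\<dots> = (\<integral>\<^sup>+s. ennreal (s powr (\<alpha> - 1)) * indicator {0..\<delta>} s * (\<integral>\<^sup>+y. ennreal (f y) \<partial>lborel) \<partial>lborel)"
  proof (intro nn_integral_cong)
    fix s :: real
    show "(\<integral>\<^sup>+x. ennreal (s powr (\<alpha> - 1)) * indicator {0..\<delta>} s * heat_conv f s x \<partial>lborel)
       = ennreal (s powr (\<alpha> - 1)) * indicator {0..\<delta>} s * (\<integral>\<^sup>+y. ennreal (f y) \<partial>lborel)"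
    proof (cases "0 < s")
      case True then show ?thesis by (simp add: nn_integral_cmult nn_integral_heat_conv f)
    next
      case False then show ?thesis by (cases "s = 0") auto
    qed
  qed
  also have "\<dots> = ennreal (\<delta> powr \<alpha> / \<alpha>) * (\<integral>\<^sup>+y. ennreal (f y) \<partial>lborel)"
    using \<alpha> \<delta> by (simp add: nn_integral_multc nn_integral_powr_from_0)
  finally show ?thesis .
qed

text \<open>Against the decay \<open>s powr (- (\<alpha> + \<kappa>))\<close> of
  \<open>heat_conv\<close>, the weight \<open>s powr (\<alpha> - 1)\<close> leaves
  \<open>s powr (- \<kappa> - 1)\<close>, integrable at infinity since
  \<open>\<kappa> > 0\<close>.\<close>

lemma riesz_far_le:
  fixes f :: "'a::euclidean_space \<Rightarrow> real"
  assumes [measurable]: "f \<in> borel_measurable borel" and f: "\<And>x. 0 \<le> f x"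
    and p: "1 < p" and \<delta>: "0 < \<delta>" and A: "0 \<le> A" "(\<integral>\<^sup>+y. ennreal (f y powr p) \<partial>lborel) \<le> ennreal A"
    and \<kappa>: "0 < \<kappa>" "DIM('a) / (2 * p) = \<alpha> + \<kappa>"
  shows "riesz {\<delta>..} \<alpha> f x
    \<le> ennreal ((4 * pi) powr (- (DIM('a) / (2 * p))) * A powr (1 / p) * (\<delta> powr (- \<kappa>) / \<kappa>))"
proof -
  let ?D = "(4 * pi) powr (- (DIM('a) / (2 * p))) * A powr (1 / p)"
  have "riesz {\<delta>..} \<alpha> f x \<le> (\<integral>\<^sup>+s. ennreal ?D * (ennreal (s powr (- \<kappa> - 1)) * indicator {\<delta>..} s) \<partial>lborel)"
    unfolding riesz_def
  proof (intro nn_integral_mono)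
    fix s :: real
    show "ennreal (s powr (\<alpha> - 1)) * indicator {\<delta>..} s * heat_conv f s x
        \<le> ennreal ?D * (ennreal (s powr (- \<kappa> - 1)) * indicator {\<delta>..} s)"
    proof (cases "\<delta> \<le> s")
      case True
      with \<delta> have s: "0 < s" by simp
      have "ennreal (s powr (\<alpha> - 1)) * heat_conv f s x
         \<le> ennreal (s powr (\<alpha> - 1)) * ennreal (?D * s powr (- (DIM('a) / (2 * p))))"
        by (intro mult_left_mono heat_conv_le f p s A) auto
      also have "\<dots> = ennreal (?D * (s powr (\<alpha> - 1) * s powr (- (DIM('a) / (2 * p)))))"
        by (subst ennreal_mult'[symmetric]) (simp_all add: mult_ac)
      also have "s powr (\<alpha> - 1) * s powr (- (DIM('a) / (2 * p))) = s powr (- \<kappa> - 1)"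
        unfolding powr_add[symmetric] \<kappa>(2) by (rule arg_cong[where f = "(powr) s"]) simp
      finally show ?thesis using True by (simp add: ennreal_mult')
    qed simp
  qed
  also have "\<dots> = ennreal ?D * ennreal (\<delta> powr (- \<kappa>) / \<kappa>)"
    using \<kappa> \<delta> by (simp add: nn_integral_cmult nn_integral_powr_to_inf)
  also have "\<dots> = ennreal (?D * (\<delta> powr (- \<kappa>) / \<kappa>))"
    by (rule ennreal_mult'[symmetric]) simp
  finally show ?thesis .
qed

text \<open>The conclusion says that \<open>b\<close> is at least half of \<open>\<tau>\<close>, in
  the form of the level set in Markov's inequality; \<open>b\<close> may be infinite.\<close>

lemma ennreal_half_le_of_le_quarters:
  fixes \<tau> :: real
  assumes "0 < \<tau>" "ennreal \<tau> \<le> a + (b + c)" "a \<le> ennreal (\<tau> / 4)" "c \<le> ennreal (\<tau> / 4)"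
  shows "1 \<le> ennreal (2 / \<tau>) * b"
proof (rule ccontr)
  assume "\<not> ?thesis"
  then have *: "ennreal (2 / \<tau>) * b < 1" by simp
  then have "b \<noteq> top"
    using assms(1) by (auto simp: ennreal_mult_top)
  then obtain r where r: "0 \<le> r" "b = ennreal r" by (cases b) auto
  have "ennreal (2 / \<tau> * r) = ennreal (2 / \<tau>) * ennreal r"
    using assms(1) by (intro ennreal_mult') simp
  with * have "ennreal (2 / \<tau> * r) < ennreal 1"
    by (simp only: r(2) ennreal_1)
  then have "2 / \<tau> * r < 1" by (subst (asm) ennreal_less_iff) (use r assms(1) in auto)
  then have "r < \<tau> / 2" using assms(1) by (simp add: field_simps)
  have "ennreal \<tau> \<le> ennreal (\<tau> / 4) + (ennreal r + ennreal (\<tau> / 4))"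
    using assms(2) unfolding r(2) by (rule order_trans) (intro add_mono assms order_refl)
  also have "\<dots> = ennreal (\<tau> / 4 + (r + \<tau> / 4))"
    using r(1) assms(1) by (simp add: ennreal_plus[symmetric] del: ennreal_plus)
  finally have "\<tau> \<le> \<tau> / 4 + (r + \<tau> / 4)"
    using r(1) assms(1) by (subst (asm) ennreal_le_iff) auto
  with \<open>r < \<tau> / 2\<close> show False by simp
qed

text \<open>At level \<open>\<tau>\<close> only the part of \<open>f\<close> above a fixed multiple
  of a power of \<open>\<tau>\<close> counts. The constant \<open>c\<close> does not depend on
  \<open>\<tau>\<close>, so the bound can be integrated over all levels. \<open>w\<close> is a
  real-valued minorant because the potential itself may be infinite at some points.\<close>

lemma riesz_distribution_le:
  fixes f w :: "'a::euclidean_space \<Rightarrow> real"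
  assumes [measurable]: "f \<in> borel_measurable borel" "w \<in> borel_measurable borel"
    and f: "\<And>x. 0 \<le> f x"
    and p: "1 < p" and A: "0 \<le> A" "(\<integral>\<^sup>+y. ennreal (f y powr p) \<partial>lborel) \<le> ennreal A"
    and \<kappa>: "0 < \<kappa>" "DIM('a) / (2 * p) = \<alpha> + \<kappa>" and \<alpha>: "0 < \<alpha>"
    and w: "\<And>x. ennreal (w x) \<le> riesz {0..} \<alpha> f x"
  shows "\<exists>c>0. \<forall>\<tau>>0. emeasure lborel {x. \<tau> \<le> w x}
    \<le> (\<integral>\<^sup>+y. ennreal (1 / (2 * c * \<tau> powr (1 + \<alpha> / \<kappa>)) * f y * indicator {c * \<tau> powr (1 + \<alpha> / \<kappa>)<..} (f y)) \<partial>lborel)"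
proof -
  \<comment> \<open>\<open>A + 1\<close> instead of \<open>A\<close> keeps \<open>D\<close> positive
    when \<open>f\<close> vanishes almost everywhere, so that dividing by \<open>D\<close> below is
    legitimate.\<close>
  define D where "D = (4 * pi) powr (- (DIM('a) / (2 * p))) * (A + 1) powr (1 / p)"
  have D: "0 < D" using A by (simp add: D_def)
  have A': "0 \<le> A + 1" "(\<integral>\<^sup>+y. ennreal (f y powr p) \<partial>lborel) \<le> ennreal (A + 1)"
    using A by (auto intro: order_trans ennreal_leI)
  \<comment> \<open>If \<open>\<delta>\<close> solves
    \<open>D * (\<delta> powr (- \<kappa>) / \<kappa>) = \<tau> / 4\<close> and \<open>\<mu>\<close>
    solves \<open>\<mu> * (\<delta> powr \<alpha> / \<alpha>) = \<tau> / 4\<close>, then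
    \<open>c\<close> is the coefficient of \<open>\<tau> powr (1 + \<alpha> / \<kappa>)\<close> in
    \<open>\<mu>\<close>.\<close>
  define c where "c = \<alpha> / 4 * (\<kappa> / (4 * D)) powr (\<alpha> / \<kappa>)"
  have c: "0 < c" using \<alpha> \<kappa> D by (simp add: c_def)
  show ?thesis
  proof (intro exI[of _ c] conjI allI impI c)
    fix \<tau> :: real assume \<tau>: "0 < \<tau>"
    \<comment> \<open>\<open>\<delta>\<close> and \<open>\<mu>\<close> are chosen so that the times after \<open>\<delta>\<close>, and the part of \<open>f\<close> below \<open>\<mu>\<close> at the times
      before \<open>\<delta>\<close>, each contribute at most a quarter of \<open>\<tau>\<close>; Markov's inequality in \<open>L\<^sup>1\<close> handles the rest.\<close>
    define \<delta> where "\<delta> = (\<kappa> * \<tau> / (4 * D)) powr (- 1 / \<kappa>)"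
    define \<mu> where "\<mu> = c * \<tau> powr (1 + \<alpha> / \<kappa>)"
    have \<delta>: "0 < \<delta>" using \<kappa> \<tau> D by (simp add: \<delta>_def)
    have \<mu>: "0 < \<mu>" using c \<tau> by (simp add: \<mu>_def)
    have far: "D * (\<delta> powr (- \<kappa>) / \<kappa>) = \<tau> / 4"
      using \<kappa>(1) \<tau> D by (simp add: \<delta>_def powr_powr)
    have near: "\<mu> * (\<delta> powr \<alpha> / \<alpha>) = \<tau> / 4"
    proof -
      have "\<delta> powr \<alpha> = (\<kappa> / (4 * D) * \<tau>) powr (- (\<alpha> / \<kappa>))"
        by (simp add: \<delta>_def powr_powr)
      also have "\<dots> = 1 / ((\<kappa> / (4 * D)) powr (\<alpha> / \<kappa>) * \<tau> powr (\<alpha> / \<kappa>))"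
        by (simp only: powr_minus_divide powr_mult)
      finally show ?thesis
        using \<alpha> \<kappa> \<tau> D by (simp add: \<mu>_def c_def powr_add)
    qed
    define g where "g y = f y * indicator {\<mu><..} (f y)" for y
    define h where "h y = f y * indicator {..\<mu>} (f y)" for y
    have [measurable]: "g \<in> borel_measurable borel" "h \<in> borel_measurable borel"
      unfolding g_def h_def by measurable
    have g: "0 \<le> g y" and h: "0 \<le> h y" "h y \<le> \<mu>" and gh: "f y = g y + h y" for y
      using f[of y] \<mu> by (auto simp: g_def h_def indicator_def)
    have sub: "{x. \<tau> \<le> w x} \<subseteq> {x \<in> UNIV. 1 \<le> ennreal (2 / \<tau>) * riesz {0..\<delta>} \<alpha> g x}"
    proof (rule subsetI)
      fix x assume "x \<in> {x. \<tau> \<le> w x}"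
      then have "\<tau> \<le> w x" by simp
      then have "ennreal \<tau> \<le> riesz {0..} \<alpha> f x"
        using w[of x] by (meson ennreal_leI order_trans)
      also have "\<dots> \<le> riesz {\<delta>..} \<alpha> f x + riesz {0..\<delta>} \<alpha> f x"
        using riesz_le_near_far[of f \<delta> \<alpha> x] \<delta> by (simp add: add.commute)
      also have "riesz {0..\<delta>} \<alpha> f x = riesz {0..\<delta>} \<alpha> g x + riesz {0..\<delta>} \<alpha> h x"
        using riesz_add[of g h "{0..\<delta>}" \<alpha> x] g h by (simp add: gh[abs_def])
      finally have "ennreal \<tau> \<le> riesz {\<delta>..} \<alpha> f x + (riesz {0..\<delta>} \<alpha> g x + riesz {0..\<delta>} \<alpha> h x)" .
      moreover have "riesz {\<delta>..} \<alpha> f x \<le> ennreal (\<tau> / 4)"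
        unfolding far[symmetric] D_def by (intro riesz_far_le f p \<delta> A' \<kappa>) simp
      moreover have "riesz {0..\<delta>} \<alpha> h x \<le> ennreal (\<tau> / 4)"
        unfolding near[symmetric] using \<mu> by (intro riesz_near_le_const h \<alpha> \<delta>) auto
      ultimately have "1 \<le> ennreal (2 / \<tau>) * riesz {0..\<delta>} \<alpha> g x"
        using \<tau> by (intro ennreal_half_le_of_le_quarters)
      then show "x \<in> {x \<in> UNIV. 1 \<le> ennreal (2 / \<tau>) * riesz {0..\<delta>} \<alpha> g x}" by simp
    qed
    have "emeasure lborel {x. \<tau> \<le> w x} \<le> emeasure lborel {x \<in> UNIV. 1 \<le> ennreal (2 / \<tau>) * riesz {0..\<delta>} \<alpha> g x}"
      by (intro emeasure_mono sub) measurable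
    also have "\<dots> \<le> ennreal (2 / \<tau>) * (\<integral>\<^sup>+x. riesz {0..\<delta>} \<alpha> g x * indicator UNIV x \<partial>lborel)"
      by (rule nn_integral_Markov_inequality) simp_all
    also have "\<dots> = ennreal (2 / \<tau>) * (ennreal (\<delta> powr \<alpha> / \<alpha>) * (\<integral>\<^sup>+y. ennreal (g y) \<partial>lborel))"
      using g \<alpha> \<delta> by (simp add: nn_integral_riesz_near)
    also have "\<dots> = (\<integral>\<^sup>+y. ennreal (2 / \<tau> * (\<delta> powr \<alpha> / \<alpha>) * g y) \<partial>lborel)"
      using \<tau> \<alpha> by (simp add: nn_integral_cmult[symmetric] ennreal_mult'[symmetric] mult.assoc)
    \<comment> \<open>The equation \<open>near\<close> eliminates \<open>\<delta>\<close>, so the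
      factor from Markov's inequality depends on \<open>\<tau>\<close> only through
      \<open>\<mu>\<close>.\<close>
    also have "2 / \<tau> * (\<delta> powr \<alpha> / \<alpha>) = 1 / (2 * \<mu>)"
      using near \<mu> \<tau> \<alpha> by (simp add: field_simps)
    finally show "emeasure lborel {x. \<tau> \<le> w x}
       \<le> (\<integral>\<^sup>+y. ennreal (1 / (2 * c * \<tau> powr (1 + \<alpha> / \<kappa>)) * f y * indicator {c * \<tau> powr (1 + \<alpha> / \<kappa>)<..} (f y)) \<partial>lborel)"
      by (simp add: \<mu>_def g_def mult.assoc)
  qed
qed

text \<open>The level-set bound is multiplied by \<open>q * \<tau> powr (q - 1)\<close> and
  integrated over \<open>\<tau>\<close>. After exchanging the integrals, for fixed \<open>y\<close>
  the truncation confines \<open>\<tau>\<close> to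
  \<open>\<tau> \<le> (f y / c) powr (p / q)\<close>, and the integral over \<open>\<tau>\<close>
  turns the factor \<open>f y\<close> into a multiple of \<open>f y powr p\<close>. Truncating
  \<open>f\<close> at a level that moves with \<open>\<tau>\<close> is what gives the strong type
  directly instead of only a weak type.\<close>

theorem riesz_strong_type:
  fixes f w :: "'a::euclidean_space \<Rightarrow> real"
  assumes [measurable]: "f \<in> borel_measurable borel" "w \<in> borel_measurable borel"
    and f: "\<And>x. 0 \<le> f x" and w0: "\<And>x. 0 \<le> w x"
    and p: "1 < p" and q: "p < q" and fin: "(\<integral>\<^sup>+y. ennreal (f y powr p) \<partial>lborel) < \<infinity>"
    and \<alpha>: "\<alpha> = DIM('a) / 2 * (1 / p - 1 / q)"
    and w: "\<And>x. ennreal (w x) \<le> riesz {0..} \<alpha> f x"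
  shows "(\<integral>\<^sup>+x. ennreal (w x powr q) \<partial>lborel) < \<infinity>"
proof -
  obtain A where A: "0 \<le> A" "(\<integral>\<^sup>+y. ennreal (f y powr p) \<partial>lborel) = ennreal A"
    using fin by (cases "\<integral>\<^sup>+y. ennreal (f y powr p) \<partial>lborel") auto
  \<comment> \<open>The surplus decay \<open>DIM('a) / (2 * p) - \<alpha>\<close> at large times;
    for this \<open>\<alpha>\<close> the exponent \<open>1 + \<alpha> / \<kappa>\<close> becomes
    \<open>q / p\<close>.\<close>
  define \<kappa> where "\<kappa> = DIM('a) / (2 * q)"
  have \<kappa>: "0 < \<kappa>" "DIM('a) / (2 * p) = \<alpha> + \<kappa>"
    using p q by (auto simp: \<kappa>_def \<alpha> field_simps)
  have \<alpha>0: "0 < \<alpha>" using p q by (simp add: \<alpha> field_simps)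
  have e: "1 + \<alpha> / \<kappa> = q / p"
    using p q by (simp add: \<alpha> \<kappa>_def field_simps)
  obtain c where c: "0 < c" and dist: "\<And>\<tau>. 0 < \<tau> \<Longrightarrow> emeasure lborel {x. \<tau> \<le> w x}
    \<le> (\<integral>\<^sup>+y. ennreal (1 / (2 * c * \<tau> powr (q / p)) * f y * indicator {c * \<tau> powr (q / p)<..} (f y)) \<partial>lborel)"
    using riesz_distribution_le[OF assms(1,2) f p A(1) eq_refl[OF A(2)] \<kappa> \<alpha>0 w] unfolding e by blast
  \<comment> \<open>\<open>r - 1\<close> is the exponent of \<open>\<tau>\<close> left from
    \<open>q - 1\<close> after division by \<open>\<tau> powr (q / p)\<close>. Positivity of
    \<open>r\<close>, needed for convergence at 0, is the hypothesis \<open>p > 1\<close>.\<close>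
  define r where "r = q - q / p"
  have r: "0 < r" using p q by (simp add: r_def field_simps)
  have q0: "0 < q" using p q by simp
  have [measurable]: "Measurable.pred (borel \<Otimes>\<^sub>M borel) (\<lambda>z. snd z \<in> {0..w (fst z)})"
    "Measurable.pred (borel \<Otimes>\<^sub>M borel) (\<lambda>z. fst z \<in> {0..(f (snd z) / c) powr (p / q)})"
    unfolding atLeastAtMost_iff by measurable
  have cake: "ennreal (w x powr q) = (\<integral>\<^sup>+\<tau>. ennreal (q * \<tau> powr (q - 1)) * indicator {0..w x} \<tau> \<partial>lborel)" for x
  proof -
    have "(\<integral>\<^sup>+\<tau>. ennreal (q * \<tau> powr (q - 1)) * indicator {0..w x} \<tau> \<partial>lborel)
      = (\<integral>\<^sup>+\<tau>. ennreal q * (ennreal (\<tau> powr (q - 1)) * indicator {0..w x} \<tau>) \<partial>lborel)"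
      using q0 by (simp add: ennreal_mult mult.assoc)
    also have "\<dots> = ennreal q * ennreal (w x powr q / q)"
      using q0 w0 by (simp add: nn_integral_cmult nn_integral_powr_from_0)
    also have "\<dots> = ennreal (w x powr q)"
      using q0 by (subst ennreal_mult'[symmetric]) auto
    finally show ?thesis by simp
  qed
  have "(\<integral>\<^sup>+x. ennreal (w x powr q) \<partial>lborel)
     = (\<integral>\<^sup>+\<tau>. \<integral>\<^sup>+x. ennreal (q * \<tau> powr (q - 1)) * indicator {0..w x} \<tau> \<partial>lborel \<partial>lborel)"
    unfolding cake by (rule nn_integral_swap_lborel) measurable
  also have "\<dots> \<le> (\<integral>\<^sup>+\<tau>. \<integral>\<^sup>+y. ennreal (q / (2 * c) * f y) * (ennreal (\<tau> powr (r - 1)) * indicator {0..(f y / c) powr (p / q)} \<tau>) \<partial>lborel \<partial>lborel)"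
  proof (rule nn_integral_mono)
    fix \<tau> :: real
    show "(\<integral>\<^sup>+x. ennreal (q * \<tau> powr (q - 1)) * indicator {0..w x} \<tau> \<partial>lborel)
      \<le> (\<integral>\<^sup>+y. ennreal (q / (2 * c) * f y) * (ennreal (\<tau> powr (r - 1)) * indicator {0..(f y / c) powr (p / q)} \<tau>) \<partial>lborel)"
    proof (cases "0 < \<tau>")
      case True
      have "(\<integral>\<^sup>+x. ennreal (q * \<tau> powr (q - 1)) * indicator {0..w x} \<tau> \<partial>lborel)
        = (\<integral>\<^sup>+x. ennreal (q * \<tau> powr (q - 1)) * indicator {x. \<tau> \<le> w x} x \<partial>lborel)"
        using True by (intro nn_integral_cong) (auto simp: indicator_def)
      also have "\<dots> = ennreal (q * \<tau> powr (q - 1)) * emeasure lborel {x. \<tau> \<le> w x}"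
        by (rule nn_integral_cmult_indicator) measurable
      also have "\<dots> \<le> ennreal (q * \<tau> powr (q - 1)) * (\<integral>\<^sup>+y. ennreal (1 / (2 * c * \<tau> powr (q / p)) * f y * indicator {c * \<tau> powr (q / p)<..} (f y)) \<partial>lborel)"
        by (intro mult_left_mono dist True) simp
      also have "\<dots> = (\<integral>\<^sup>+y. ennreal (q * \<tau> powr (q - 1)) * ennreal (1 / (2 * c * \<tau> powr (q / p)) * f y * indicator {c * \<tau> powr (q / p)<..} (f y)) \<partial>lborel)"
        by (rule nn_integral_cmult[symmetric]) measurable
      also have "\<dots> \<le> (\<integral>\<^sup>+y. ennreal (q / (2 * c) * f y) * (ennreal (\<tau> powr (r - 1)) * indicator {0..(f y / c) powr (p / q)} \<tau>) \<partial>lborel)"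
      proof (intro nn_integral_mono)
        fix y
        show "ennreal (q * \<tau> powr (q - 1)) * ennreal (1 / (2 * c * \<tau> powr (q / p)) * f y * indicator {c * \<tau> powr (q / p)<..} (f y))
          \<le> ennreal (q / (2 * c) * f y) * (ennreal (\<tau> powr (r - 1)) * indicator {0..(f y / c) powr (p / q)} \<tau>)"
        proof (cases "c * \<tau> powr (q / p) < f y")
          case lt: True
          then have "\<tau> powr (q / p) \<le> f y / c" using c by (simp add: field_simps)
          then have "(\<tau> powr (q / p)) powr (p / q) \<le> (f y / c) powr (p / q)"
            using p q by (intro powr_mono2) auto
          then have "\<tau> \<le> (f y / c) powr (p / q)"
            using p q True by (simp add: powr_powr)
          moreover have "\<tau> powr (q - 1) = \<tau> powr (r - 1) * \<tau> powr (q / p)"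
            unfolding powr_add[symmetric] by (simp add: r_def)
          then have "q * \<tau> powr (q - 1) * (1 / (2 * c * \<tau> powr (q / p)) * f y) = q / (2 * c) * f y * \<tau> powr (r - 1)"
            using True by simp
          ultimately show ?thesis
            using lt True q0 c f[of y] by (simp add: ennreal_mult'[symmetric])
        qed simp
      qed
      finally show ?thesis .
    next
      case False
      then have "ennreal (q * \<tau> powr (q - 1)) * indicator {0..w x} \<tau> = 0" for x
        by (cases "\<tau> = 0") auto
      then show ?thesis by (simp only: nn_integral_const mult_zero_left zero_le)
    qed
  qed
  also have "\<dots> = (\<integral>\<^sup>+y. \<integral>\<^sup>+\<tau>. ennreal (q / (2 * c) * f y) * (ennreal (\<tau> powr (r - 1)) * indicator {0..(f y / c) powr (p / q)} \<tau>) \<partial>lborel \<partial>lborel)"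
    by (rule nn_integral_swap_lborel) measurable
  also have "\<dots> = (\<integral>\<^sup>+y. ennreal (q / (2 * c * r) * c powr (1 - p)) * ennreal (f y powr p) \<partial>lborel)"
  proof (intro nn_integral_cong)
    fix y
    have "(\<integral>\<^sup>+\<tau>. ennreal (q / (2 * c) * f y) * (ennreal (\<tau> powr (r - 1)) * indicator {0..(f y / c) powr (p / q)} \<tau>) \<partial>lborel)
       = ennreal (q / (2 * c) * f y) * ennreal (((f y / c) powr (p / q)) powr r / r)"
      using r by (simp add: nn_integral_cmult nn_integral_powr_from_0)
    also have "((f y / c) powr (p / q)) powr r = f y powr (p - 1) * c powr (1 - p)"
    proof -
      \<comment> \<open>The choice of exponents pays off here: the integral over
        \<open>\<tau>\<close> yields the power \<open>p - 1\<close>, and the remaining factor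
        \<open>f y\<close> completes it to \<open>p\<close>.\<close>
      have "p / q * r = p - 1" using p q by (simp add: r_def field_simps)
      then show ?thesis
        using c f[of y] by (simp add: powr_powr powr_divide powr_minus_divide[of c "p - 1", simplified])
    qed
    also have "ennreal (q / (2 * c) * f y) * ennreal (f y powr (p - 1) * c powr (1 - p) / r)
       = ennreal (q / (2 * c) * f y * (f y powr (p - 1) * c powr (1 - p) / r))"
      using q0 c f[of y] by (intro ennreal_mult'[symmetric]) auto
    also have "q / (2 * c) * f y * (f y powr (p - 1) * c powr (1 - p) / r)
       = q / (2 * c * r) * c powr (1 - p) * (f y * f y powr (p - 1))"
      by simp
    also have "f y * f y powr (p - 1) = f y powr p"
      using f[of y] p by (cases "f y = 0") (auto simp: powr_diff)
    also have "ennreal (q / (2 * c * r) * c powr (1 - p) * f y powr p) = ennreal (q / (2 * c * r) * c powr (1 - p)) * ennreal (f y powr p)"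
      using q0 c r by (intro ennreal_mult') auto
    finally show "(\<integral>\<^sup>+\<tau>. ennreal (q / (2 * c) * f y) * (ennreal (\<tau> powr (r - 1)) * indicator {0..(f y / c) powr (p / q)} \<tau>) \<partial>lborel)
       = ennreal (q / (2 * c * r) * c powr (1 - p)) * ennreal (f y powr p)" .
  qed
  also have "\<dots> = ennreal (q / (2 * c * r) * c powr (1 - p)) * ennreal A"
    unfolding A(2)[symmetric] by (rule nn_integral_cmult) simp
  also have "\<dots> < \<infinity>" by (simp add: ennreal_mult_less_top)
  finally show ?thesis .
qed

section \<open>Mapping properties of the Bessel kernel\<close>

definition bessel_conv :: "real \<Rightarrow> ('a::euclidean_space \<Rightarrow> complex) \<Rightarrow> 'a \<Rightarrow> complex" where
  "bessel_conv t v x = (\<integral>y. complex_of_real (bessel_kernel t (x - y)) * v y \<partial>lborel)"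

lemma measurable_bessel_conv [measurable]:
  assumes [measurable]: "v \<in> borel_measurable borel"
  shows "bessel_conv t v \<in> borel_measurable borel"
  unfolding bessel_conv_def by measurable

lemma nn_integral_bessel_kernel_diff:
  "0 < t \<Longrightarrow> (\<integral>\<^sup>+y. ennreal (bessel_kernel t (x - y :: 'a::euclidean_space)) \<partial>lborel) = 1"
  by (subst nn_integral_lborel_reflect[of "\<lambda>y. ennreal (bessel_kernel t y)"])
     (simp_all add: nn_integral_bessel_kernel)

lemma bessel_kernel_diff_commute: "bessel_kernel t (x - y) = bessel_kernel t (y - x)"
  using bessel_kernel_minus[of t "y - x"] by simp

text \<open>No integrability is assumed: where the Bochner integral does not exist its value is 0
  and the bound is trivial.\<close>

lemma norm_bessel_conv_le:
  assumes t: "0 < t"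
  shows "ennreal (norm (bessel_conv t v x)) \<le> (\<integral>\<^sup>+y. ennreal (bessel_kernel t (x - y) * norm (v y)) \<partial>lborel)"
proof (cases "integrable lborel (\<lambda>y. complex_of_real (bessel_kernel t (x - y)) * v y)")
  case True
  have "ennreal (norm (bessel_conv t v x))
      \<le> (\<integral>\<^sup>+y. ennreal (norm (complex_of_real (bessel_kernel t (x - y)) * v y)) \<partial>lborel)"
    unfolding bessel_conv_def by (rule integral_norm_bound_ennreal[OF True])
  then show ?thesis using t by (simp add: norm_mult bessel_kernel_nonneg)
next
  case False
  then show ?thesis by (simp add: bessel_conv_def not_integrable_integral_eq)
qed

text \<open>Tonelli carries subordination over from kernels to averages, so estimates for the heat
  semigroup transfer to the Bessel kernel. The formula for the kernel is available only almost
  everywhere, which is enough under the integral.\<close>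

lemma nn_integral_bessel_kernel_mult:
  fixes f :: "'a::euclidean_space \<Rightarrow> real"
  assumes t: "0 < t" and [measurable]: "f \<in> borel_measurable borel" and f: "\<And>y. 0 \<le> f y"
  shows "(\<integral>\<^sup>+y. ennreal (bessel_kernel t (x - y) * f y) \<partial>lborel)
    = (\<integral>\<^sup>+s. ennreal (gamma_weight t s) * heat_conv f s x \<partial>lborel)"
proof -
  have "(\<integral>\<^sup>+y. ennreal (bessel_kernel t (x - y) * f y) \<partial>lborel)
    = (\<integral>\<^sup>+y. \<integral>\<^sup>+s. ennreal (gamma_weight t s * (heat s (x - y) * f y)) \<partial>lborel \<partial>lborel)"
  proof (rule nn_integral_cong_AE)
    show "AE y in lborel. ennreal (bessel_kernel t (x - y) * f y)
        = (\<integral>\<^sup>+s. ennreal (gamma_weight t s * (heat s (x - y) * f y)) \<partial>lborel)"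
      using AE_lborel_reflect[OF AE_bessel_kernel[OF t], of x]
    proof eventually_elim
      case (elim y)
      have "ennreal (bessel_kernel t (x - y) * f y) = ennreal (bessel_kernel t (x - y)) * ennreal (f y)"
        using f by (intro ennreal_mult'') auto
      also have "\<dots> = (\<integral>\<^sup>+s. ennreal (gamma_weight t s * heat s (x - y)) * ennreal (f y) \<partial>lborel)"
        unfolding elim by (simp add: nn_integral_multc)
      also have "\<dots> = (\<integral>\<^sup>+s. ennreal (gamma_weight t s * (heat s (x - y) * f y)) \<partial>lborel)"
        using f by (intro nn_integral_cong) (simp add: ennreal_mult''[symmetric] mult.assoc)
      finally show ?case .
    qed
  qed
  also have "\<dots> = (\<integral>\<^sup>+s. \<integral>\<^sup>+y. ennreal (gamma_weight t s * (heat s (x - y) * f y)) \<partial>lborel \<partial>lborel)"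
    by (rule nn_integral_swap_lborel) measurable
  also have "\<dots> = (\<integral>\<^sup>+s. ennreal (gamma_weight t s) * heat_conv f s x \<partial>lborel)"
    unfolding heat_conv_def using t
    by (intro nn_integral_cong) (simp add: ennreal_mult' gamma_weight_nonneg nn_integral_cmult)
  finally show ?thesis .
qed

theorem bessel_conv_Lp_le:
  fixes v :: "'a::euclidean_space \<Rightarrow> complex"
  assumes t: "0 < t" and [measurable]: "v \<in> borel_measurable borel" and p: "1 < p"
  shows "(\<integral>\<^sup>+x. ennreal (norm (bessel_conv t v x) powr p) \<partial>lborel) \<le> (\<integral>\<^sup>+x. ennreal (norm (v x) powr p) \<partial>lborel)"
proof -
  have "(\<integral>\<^sup>+x. ennreal (norm (bessel_conv t v x) powr p) \<partial>lborel)
     \<le> (\<integral>\<^sup>+x. \<integral>\<^sup>+y. ennreal (bessel_kernel t (x - y) * norm (v y) powr p) \<partial>lborel \<partial>lborel)"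
  proof (rule nn_integral_mono)
    fix x
    show "ennreal (norm (bessel_conv t v x) powr p) \<le> (\<integral>\<^sup>+y. ennreal (bessel_kernel t (x - y) * norm (v y) powr p) \<partial>lborel)"
      (is "_ \<le> ?B")
    proof (cases ?B)
      case (real B)
      have "ennreal (norm (bessel_conv t v x)) \<le> (\<integral>\<^sup>+y. ennreal (bessel_kernel t (x - y) * norm (v y)) \<partial>lborel)"
        by (rule norm_bessel_conv_le[OF t])
      also have "\<dots> \<le> ennreal (B powr (1 / p))"
        using real t p by (intro nn_integral_jensen) (simp_all add: bessel_kernel_nonneg nn_integral_bessel_kernel_diff)
      finally have "norm (bessel_conv t v x) powr p \<le> (B powr (1 / p)) powr p"
        using p by (intro powr_mono2) auto
      also have "\<dots> = B" using p real by (simp add: powr_powr)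
      finally show ?thesis using real by (simp add: ennreal_leI)
    qed simp
  qed
  also have "\<dots> = (\<integral>\<^sup>+y. \<integral>\<^sup>+x. ennreal (bessel_kernel t (x - y) * norm (v y) powr p) \<partial>lborel \<partial>lborel)"
    by (rule nn_integral_swap_lborel) measurable
  also have "\<dots> = (\<integral>\<^sup>+y. ennreal (norm (v y) powr p) \<partial>lborel)"
  proof (rule nn_integral_cong)
    fix y
    have "(\<integral>\<^sup>+x. ennreal (bessel_kernel t (x - y) * norm (v y) powr p) \<partial>lborel)
      = (\<integral>\<^sup>+x. ennreal (bessel_kernel t (y - x)) * ennreal (norm (v y) powr p) \<partial>lborel)"
      by (simp add: ennreal_mult'' bessel_kernel_diff_commute[of t _ y])
    also have "\<dots> = ennreal (norm (v y) powr p)"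
      using t by (simp add: nn_integral_multc nn_integral_bessel_kernel_diff)
    finally show "(\<integral>\<^sup>+x. ennreal (bessel_kernel t (x - y) * norm (v y) powr p) \<partial>lborel) = ennreal (norm (v y) powr p)" .
  qed
  finally show ?thesis .
qed

text \<open>The witness is the maximum, attained at \<open>s = \<beta>\<close> for positive
  \<open>\<beta>\<close>; it comes from \<open>ln y \<le> y - 1\<close> at
  \<open>y = s / \<beta>\<close>. For \<open>\<beta> = 0\<close> it equals 1.\<close>

lemma powr_mult_exp_bounded:
  assumes "0 \<le> \<beta>"
  shows "\<exists>C\<ge>0. \<forall>s>0. s powr \<beta> * exp (- s) \<le> (C::real)"
proof (intro exI[of _ "exp (\<beta> * ln \<beta> - \<beta>)"] conjI allI impI)
  fix s :: real assume s: "0 < s"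
  have "\<beta> * ln s \<le> s - \<beta> + \<beta> * ln \<beta>"
  proof (cases "\<beta> = 0")
    case False
    with assms have \<beta>: "0 < \<beta>" by simp
    have "ln s = ln \<beta> + ln (s / \<beta>)"
      using s \<beta> by (simp add: ln_div)
    moreover have "ln (s / \<beta>) \<le> s / \<beta> - 1"
      using s \<beta> by (intro ln_le_minus_one) simp
    ultimately have "\<beta> * ln s \<le> \<beta> * (ln \<beta> + (s / \<beta> - 1))"
      using \<beta> by (intro mult_left_mono) auto
    also have "\<dots> = s - \<beta> + \<beta> * ln \<beta>"
      using \<beta> by (simp add: algebra_simps)
    finally show ?thesis .
  qed (use s in simp)
  then show "s powr \<beta> * exp (- s) \<le> exp (\<beta> * ln \<beta> - \<beta>)"
    using s by (simp add: powr_def exp_add[symmetric])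
qed simp

text \<open>With \<open>\<alpha> \<le> t\<close>, the factor
  \<open>s powr (t - \<alpha>) * exp (- s)\<close> is bounded, so the Gamma density is at most a
  constant times \<open>s powr (\<alpha> - 1)\<close> and the convolution is dominated by a Riesz
  potential of order exactly \<open>\<alpha>\<close>. The constant is absorbed into
  \<open>f\<close>.\<close>

theorem bessel_conv_Lq:
  fixes v :: "'a::euclidean_space \<Rightarrow> complex"
  assumes [measurable]: "v \<in> borel_measurable borel" and p: "1 < p" and q: "p < q"
    and fin: "(\<integral>\<^sup>+x. ennreal (norm (v x) powr p) \<partial>lborel) < \<infinity>"
    and t: "DIM('a) / 2 * (1 / p - 1 / q) \<le> t"
  shows "(\<integral>\<^sup>+x. ennreal (norm (bessel_conv t v x) powr q) \<partial>lborel) < \<infinity>"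
proof -
  define \<alpha> where "\<alpha> = DIM('a) / 2 * (1 / p - 1 / q)"
  have \<alpha>: "0 < \<alpha>" "\<alpha> \<le> t" using p q t by (auto simp: \<alpha>_def field_simps)
  then have t0: "0 < t" by simp
  obtain C where C: "0 \<le> C" "\<And>s. 0 < s \<Longrightarrow> s powr (t - \<alpha>) * exp (- s) \<le> C"
    using powr_mult_exp_bounded[of "t - \<alpha>"] \<alpha> by auto
  define f where "f x = C / Gamma t * norm (v x)" for x
  have [measurable]: "f \<in> borel_measurable borel" unfolding f_def by measurable
  have G: "0 < Gamma t" using t0 by (rule Gamma_real_pos)
  have f: "0 \<le> f x" for x using C(1) G by (simp add: f_def)
  show ?thesis
  proof (rule riesz_strong_type[where f = f and p = p and \<alpha> = \<alpha>])
    have "(\<integral>\<^sup>+x. ennreal (f x powr p) \<partial>lborel) = (\<integral>\<^sup>+x. ennreal ((C / Gamma t) powr p) * ennreal (norm (v x) powr p) \<partial>lborel)"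
      unfolding f_def powr_mult by (simp add: ennreal_mult')
    also have "\<dots> = ennreal ((C / Gamma t) powr p) * (\<integral>\<^sup>+x. ennreal (norm (v x) powr p) \<partial>lborel)"
      by (rule nn_integral_cmult) simp
    also have "\<dots> < \<infinity>" using fin by (simp add: ennreal_mult_less_top)
    finally show "(\<integral>\<^sup>+x. ennreal (f x powr p) \<partial>lborel) < \<infinity>" .
  next
    fix x
    have "ennreal (norm (bessel_conv t v x)) \<le> (\<integral>\<^sup>+y. ennreal (bessel_kernel t (x - y) * norm (v y)) \<partial>lborel)"
      by (rule norm_bessel_conv_le[OF t0])
    also have "\<dots> = (\<integral>\<^sup>+s. ennreal (gamma_weight t s) * heat_conv (\<lambda>y. norm (v y)) s x \<partial>lborel)"
      by (rule nn_integral_bessel_kernel_mult[OF t0]) simp_all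
    also have "\<dots> \<le> (\<integral>\<^sup>+s. ennreal (s powr (\<alpha> - 1)) * indicator {0..} s * heat_conv f s x \<partial>lborel)"
    proof (rule nn_integral_mono)
      fix s :: real
      have hc: "heat_conv f s x = ennreal (C / Gamma t) * heat_conv (\<lambda>y. norm (v y)) s x"
        unfolding heat_conv_def using C(1) G
        by (subst nn_integral_cmult[symmetric]) (simp_all add: f_def ennreal_mult'[symmetric] mult_ac)
      show "ennreal (gamma_weight t s) * heat_conv (\<lambda>y. norm (v y)) s x
          \<le> ennreal (s powr (\<alpha> - 1)) * indicator {0..} s * heat_conv f s x"
      proof (cases "0 < s")
        case True
        have "s powr (t - 1) = s powr (\<alpha> - 1) * s powr (t - \<alpha>)"
          unfolding powr_add[symmetric] by simp
        then have "gamma_weight t s = s powr (\<alpha> - 1) * (s powr (t - \<alpha>) * exp (- s)) / Gamma t"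
          using True by (simp add: gamma_weight_def)
        also have "\<dots> \<le> s powr (\<alpha> - 1) * C / Gamma t"
          using G True by (intro divide_right_mono mult_left_mono C) auto
        finally have "ennreal (gamma_weight t s) * heat_conv (\<lambda>y. norm (v y)) s x
            \<le> ennreal (s powr (\<alpha> - 1) * (C / Gamma t)) * heat_conv (\<lambda>y. norm (v y)) s x"
          by (intro mult_right_mono ennreal_leI) auto
        also have "\<dots> = ennreal (s powr (\<alpha> - 1)) * heat_conv f s x"
          using C(1) G by (subst ennreal_mult') (simp_all add: hc mult.assoc)
        finally show ?thesis using True by simp
      qed simp
    qed
    finally show "ennreal (norm (bessel_conv t v x)) \<le> riesz {0..} \<alpha> f x"
      unfolding riesz_def .
  qed (use p q f in \<open>auto simp: \<alpha>_def\<close>)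
qed

section \<open>Continuity and decay at infinity for large times\<close>

lemma tendsto_at_infinity_sequentiallyI:
  fixes f :: "'a::real_normed_vector \<Rightarrow> 'b::real_normed_vector"
  assumes "\<And>X. filterlim (\<lambda>n. norm (X n)) at_top sequentially \<Longrightarrow> (\<lambda>n. f (X n)) \<longlonglongrightarrow> 0"
  shows "(f \<longlongrightarrow> 0) at_infinity"
proof (rule ccontr)
  assume "\<not> ?thesis"
  then obtain e where e: "0 < e" "\<And>b. \<exists>x. b \<le> norm x \<and> e \<le> norm (f x)"
    unfolding tendsto_iff eventually_at_infinity by (auto simp: not_less)
  then have "\<forall>n. \<exists>x. real n \<le> norm x \<and> e \<le> norm (f x)" by blast
  then obtain X where X: "\<And>n. real n \<le> norm (X n)" "\<And>n. e \<le> norm (f (X n))" by metis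
  have "filterlim (\<lambda>n. norm (X n)) at_top sequentially"
    by (rule filterlim_at_top_mono[OF filterlim_real_sequentially]) (simp add: X)
  from assms[OF this] have "\<forall>\<^sub>F n in sequentially. norm (f (X n)) < e"
    using e(1) by (auto simp: tendsto_iff)
  with X(2) show False
    by (auto simp: not_less[symmetric] eventually_sequentially)
qed

text \<open>The complex-valued average, whose limits are needed; the extended nonnegative
  \<open>heat_conv\<close> serves only to bound it.\<close>

definition heat_convC :: "('a::euclidean_space \<Rightarrow> complex) \<Rightarrow> real \<Rightarrow> 'a \<Rightarrow> complex" where
  "heat_convC v s x = (\<integral>y. complex_of_real (heat s (x - y)) * v y \<partial>lborel)"

lemma measurable_heat_convC [measurable]:
  assumes [measurable]: "v \<in> borel_measurable borel"
  shows "(\<lambda>(s, x). heat_convC v s x) \<in> borel_measurable (borel \<Otimes>\<^sub>M borel)"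
  unfolding heat_convC_def by measurable

lemma norm_heat_convC_le:
  "ennreal (norm (heat_convC v s x)) \<le> heat_conv (\<lambda>y. norm (v y)) s x"
proof (cases "integrable lborel (\<lambda>y. complex_of_real (heat s (x - y)) * v y)")
  case True
  have "ennreal (norm (heat_convC v s x))
      \<le> (\<integral>\<^sup>+y. ennreal (norm (complex_of_real (heat s (x - y)) * v y)) \<partial>lborel)"
    unfolding heat_convC_def by (rule integral_norm_bound_ennreal[OF True])
  then show ?thesis by (simp add: norm_mult heat_conv_def)
next
  case False
  then show ?thesis by (simp add: heat_convC_def not_integrable_integral_eq)
qed

text \<open>Supplies the dominating function for moving the centre of the kernel in a ball.\<close>

lemma heat_le_shifted:
  fixes z w :: "'a::euclidean_space"
  assumes s: "0 < s" and R: "norm (z - w) \<le> R"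
  shows "heat s z \<le> exp (R\<^sup>2 / (4 * s)) * 2 powr (DIM('a) / 2) * heat (2 * s) w"
proof -
  have "norm w \<le> norm z + R"
    using norm_triangle_ineq4[of z "z - w"] R by simp
  then have "(norm w)\<^sup>2 \<le> (norm z + R)\<^sup>2"
    by (intro power_mono) auto
  also have "\<dots> \<le> 2 * (norm z)\<^sup>2 + 2 * R\<^sup>2"
    using zero_le_power2[of "norm z - R"] by (simp add: power2_eq_square algebra_simps)
  finally have "- (norm z)\<^sup>2 / (4 * s) \<le> R\<^sup>2 / (4 * s) + (- (norm w)\<^sup>2 / (4 * (2 * s)))"
    using s by (simp add: field_simps)
  then have "exp (- (norm z)\<^sup>2 / (4 * s)) \<le> exp (R\<^sup>2 / (4 * s)) * exp (- (norm w)\<^sup>2 / (4 * (2 * s)))"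
    by (simp add: exp_add[symmetric])
  then have "(4 * pi * s) powr (- (DIM('a) / 2)) * exp (- (norm z)\<^sup>2 / (4 * s))
     \<le> (4 * pi * s) powr (- (DIM('a) / 2)) * (exp (R\<^sup>2 / (4 * s)) * exp (- (norm w)\<^sup>2 / (4 * (2 * s))))"
    by (intro mult_left_mono) auto
  also have "\<dots> = exp (R\<^sup>2 / (4 * s)) * 2 powr (DIM('a) / 2)
      * ((4 * pi * (2 * s)) powr (- (DIM('a) / 2)) * exp (- (norm w)\<^sup>2 / (4 * (2 * s))))"
  proof -
    have "(4 * pi * (2 * s)) powr (- (DIM('a) / 2)) = 2 powr (- (DIM('a) / 2)) * (4 * pi * s) powr (- (DIM('a) / 2))"
      by (subst powr_mult[symmetric]) (simp add: mult_ac)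
    then have "(4 * pi * s) powr (- (DIM('a) / 2)) = 2 powr (DIM('a) / 2) * (4 * pi * (2 * s)) powr (- (DIM('a) / 2))"
      by (simp add: powr_minus)
    then show ?thesis by (simp only: mult_ac)
  qed
  finally show ?thesis unfolding heat_def .
qed

text \<open>A convergent sequence stays within one radius \<open>R\<close> of its limit, so all
  moved kernels lie below a multiple of the kernel of doubled time at the limit point. That multiple
  is integrable against \<open>norm (v y)\<close> by the \<open>L\<^sup>p\<close> smoothing
  bound.\<close>

lemma heat_convC_tendsto:
  fixes v :: "'a::euclidean_space \<Rightarrow> complex"
  assumes [measurable]: "v \<in> borel_measurable borel" and p: "1 < p" and s: "0 < s"
    and fin: "(\<integral>\<^sup>+x. ennreal (norm (v x) powr p) \<partial>lborel) < \<infinity>" and X: "X \<longlonglongrightarrow> x"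
  shows "(\<lambda>n. heat_convC v s (X n)) \<longlonglongrightarrow> heat_convC v s x"
proof -
  obtain A where A: "0 \<le> A" "(\<integral>\<^sup>+x. ennreal (norm (v x) powr p) \<partial>lborel) \<le> ennreal A"
    using fin by (cases "\<integral>\<^sup>+x. ennreal (norm (v x) powr p) \<partial>lborel") auto
  have "(\<lambda>n. X n - x) \<longlonglongrightarrow> 0" using X by (simp add: LIM_zero)
  then have "Bseq (\<lambda>n. X n - x)" by (rule convergent_imp_Bseq[OF convergentI])
  then obtain R where R: "\<And>n. norm (X n - x) \<le> R" by (auto simp: Bseq_def)
  let ?K = "exp (R\<^sup>2 / (4 * s)) * 2 powr (DIM('a) / 2)"
  show ?thesis
    unfolding heat_convC_def
  proof (rule integral_dominated_convergence[where w = "\<lambda>y. ?K * (heat (2 * s) (x - y) * norm (v y))"])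
    show "integrable lborel (\<lambda>y. ?K * (heat (2 * s) (x - y) * norm (v y)))"
    proof (intro integrable_mult_right integrableI_nonneg)
      have "heat_conv (\<lambda>y. norm (v y)) (2 * s) x < \<infinity>"
        using heat_conv_le[of "\<lambda>y. norm (v y)" p "2 * s" A x] s p A by (auto simp: le_less_trans)
      then show "(\<integral>\<^sup>+y. ennreal (heat (2 * s) (x - y) * norm (v y)) \<partial>lborel) < \<infinity>"
        by (simp add: heat_conv_def)
    qed auto
    show "AE y in lborel. (\<lambda>n. complex_of_real (heat s (X n - y)) * v y) \<longlonglongrightarrow> complex_of_real (heat s (x - y)) * v y"
      unfolding heat_def using s by (intro AE_I2 tendsto_intros X) auto
    show "AE y in lborel. norm (complex_of_real (heat s (X n - y)) * v y) \<le> ?K * (heat (2 * s) (x - y) * norm (v y))" for n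
    proof (rule AE_I2)
      fix y
      have "heat s (X n - y) \<le> ?K * heat (2 * s) (x - y)"
        using R[of n] by (intro heat_le_shifted s) simp
      from mult_right_mono[OF this norm_ge_zero[of "v y"]]
      show "norm (complex_of_real (heat s (X n - y)) * v y) \<le> ?K * (heat (2 * s) (x - y) * norm (v y))"
        by (simp add: norm_mult mult.assoc)
    qed
  qed measurable
qed

text \<open>\<open>v\<close> itself need not be integrable, so Jensen first passes to the average
  \<open>B n\<close> of \<open>norm (v y) powr p\<close>. There the kernel is bounded uniformly and
  tends to 0 pointwise, so dominated convergence applies.\<close>

lemma heat_convC_tendsto_0:
  fixes v :: "'a::euclidean_space \<Rightarrow> complex"
  assumes [measurable]: "v \<in> borel_measurable borel" and p: "1 < p" and s: "0 < s"
    and fin: "(\<integral>\<^sup>+x. ennreal (norm (v x) powr p) \<partial>lborel) < \<infinity>"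
    and X: "filterlim (\<lambda>n. norm (X n)) at_top sequentially"
  shows "(\<lambda>n. heat_convC v s (X n)) \<longlonglongrightarrow> 0"
proof -
  define B where "B n = (\<integral>y. heat s (X n - y) * norm (v y) powr p \<partial>lborel)" for n
  let ?H = "(4 * pi * s) powr (- (DIM('a) / 2))"
  have iv: "integrable lborel (\<lambda>x. norm (v x) powr p)"
    using fin by (intro integrableI_nonneg) auto
  then have iH: "integrable lborel (\<lambda>y. ?H * norm (v y) powr p)" by simp
  have hb: "heat s (X n - y) * norm (v y) powr p \<le> ?H * norm (v y) powr p" for n y
    by (intro mult_right_mono heat_le s) auto
  have ih: "integrable lborel (\<lambda>y. heat s (X n - y) * norm (v y) powr p)" for n
    by (rule Bochner_Integration.integrable_bound[OF iH]) (use hb in auto)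
  have "B \<longlonglongrightarrow> (\<integral>y. 0 \<partial>(lborel :: 'a measure))"
    unfolding B_def
  proof (rule integral_dominated_convergence[OF _ _ iH])
    show "AE y in lborel. (\<lambda>n. heat s (X n - y) * norm (v y) powr p) \<longlonglongrightarrow> 0"
    proof (intro AE_I2 tendsto_mult_left_zero)
      fix y
      have "filterlim (\<lambda>n. norm (X n - y)) at_top sequentially"
      proof (rule filterlim_at_top_mono)
        show "filterlim (\<lambda>n. - norm y + norm (X n)) at_top sequentially"
          by (intro filterlim_tendsto_add_at_top[OF tendsto_const] X)
        show "\<forall>\<^sub>F n in sequentially. - norm y + norm (X n) \<le> norm (X n - y)"
          by (intro always_eventually allI) (use norm_triangle_ineq2 in \<open>force simp: algebra_simps\<close>)
      qed
      then have "filterlim (\<lambda>n. (norm (X n - y))\<^sup>2) at_top sequentially"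
        by (intro filterlim_pow_at_top) auto
      then have "filterlim (\<lambda>n. 1 / (4 * s) * (norm (X n - y))\<^sup>2) at_top sequentially"
        using s by (intro filterlim_tendsto_pos_mult_at_top[OF tendsto_const]) auto
      then have "filterlim (\<lambda>n. - (1 / (4 * s) * (norm (X n - y))\<^sup>2)) at_bot sequentially"
        by (simp add: filterlim_uminus_at_top)
      then have "(\<lambda>n. exp (- (1 / (4 * s) * (norm (X n - y))\<^sup>2))) \<longlonglongrightarrow> 0"
        by (rule filterlim_compose[OF exp_at_bot])
      then show "(\<lambda>n. heat s (X n - y)) \<longlonglongrightarrow> 0"
        unfolding heat_def by (intro tendsto_mult_right_zero) simp
    qed
    show "AE y in lborel. norm (heat s (X n - y) * norm (v y) powr p) \<le> ?H * norm (v y) powr p" for n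
      using hb by auto
  qed measurable
  then have B0: "B \<longlonglongrightarrow> 0" by simp
  have Bn: "0 \<le> B n" for n by (simp add: B_def)
  have bd: "norm (heat_convC v s (X n)) \<le> B n powr (1 / p)" for n
  proof -
    have "ennreal (norm (heat_convC v s (X n))) \<le> heat_conv (\<lambda>y. norm (v y)) s (X n)"
      by (rule norm_heat_convC_le)
    also have "\<dots> \<le> ennreal (B n powr (1 / p))"
      unfolding heat_conv_def using p s Bn
      by (intro nn_integral_jensen) (simp_all add: nn_integral_heat_diff nn_integral_eq_integral[OF ih] B_def)
    finally show ?thesis by simp
  qed
  have "(\<lambda>n. B n powr (1 / p)) \<longlonglongrightarrow> 0"
    using p by (intro tendsto_zero_powrI[OF B0]) (auto intro!: always_eventually Bn)
  then show ?thesis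
    by (rule Lim_null_comparison[rotated]) (simp add: bd)
qed

text \<open>The dominating function \<open>W\<close> in the time variable is independent of
  \<open>x\<close>. Hence the representation by heat averages holds at every point, not just almost
  everywhere, and the same domination serves both limits.\<close>

theorem bessel_conv_C0:
  fixes v :: "'a::euclidean_space \<Rightarrow> complex"
  assumes [measurable]: "v \<in> borel_measurable borel" and p: "1 < p"
    and fin: "(\<integral>\<^sup>+x. ennreal (norm (v x) powr p) \<partial>lborel) < \<infinity>" and t: "DIM('a) / (2 * p) < t"
  shows "bessel_conv t v \<in> C0"
proof -
  obtain A where A: "0 \<le> A" "(\<integral>\<^sup>+x. ennreal (norm (v x) powr p) \<partial>lborel) \<le> ennreal A"
    using fin by (cases "\<integral>\<^sup>+x. ennreal (norm (v x) powr p) \<partial>lborel") auto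
  have t0: "0 < t" using t p by (auto intro: order_le_less_trans[rotated])
  define D where "D = (4 * pi) powr (- (DIM('a) / (2 * p))) * A powr (1 / p)"
  \<comment> \<open>Near 0 this behaves like \<open>s powr (t - DIM('a) / (2 * p) - 1)\<close>,
    which is integrable there because \<open>t > DIM('a) / (2 * p)\<close>.\<close>
  define W where "W s = gamma_weight t s * (D * s powr (- (DIM('a) / (2 * p))))" for s
  have D: "0 \<le> D" by (simp add: D_def)
  have W0: "0 \<le> W s" for s using t0 D by (simp add: W_def gamma_weight_nonneg)
  have [measurable]: "W \<in> borel_measurable borel" unfolding W_def by measurable
  have Wint: "integrable lborel W"
  proof (intro integrableI_nonneg)
    have "(\<integral>\<^sup>+s. ennreal (W s) \<partial>lborel)
       = (\<integral>\<^sup>+s. ennreal (D / Gamma t) * ennreal (indicator {0<..} s * (s powr (t - DIM('a) / (2 * p) - 1) * exp (- (1 * s)))) \<partial>lborel)"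
    proof (rule nn_integral_cong)
      fix s :: real
      have "s powr (t - DIM('a) / (2 * p) - 1) = s powr (t - 1) * s powr (- (DIM('a) / (2 * p)))"
        unfolding powr_add[symmetric] by (rule arg_cong[where f = "(powr) s"]) simp
      then have "W s = (D / Gamma t) * (indicator {0<..} s * (s powr (t - DIM('a) / (2 * p) - 1) * exp (- (1 * s))))"
        by (simp add: W_def gamma_weight_def)
      then show "ennreal (W s) = ennreal (D / Gamma t) * ennreal (indicator {0<..} s * (s powr (t - DIM('a) / (2 * p) - 1) * exp (- (1 * s))))"
        using D t0 Gamma_real_pos[OF t0] by (simp only:) (intro ennreal_mult', simp)
    qed
    also have "\<dots> = ennreal (D / Gamma t) * ennreal (Gamma (t - DIM('a) / (2 * p)) / 1 powr (t - DIM('a) / (2 * p)))"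
      using t nn_integral_powr_exp[of "t - DIM('a) / (2 * p)" 1] by (subst nn_integral_cmult) simp_all
    also have "\<dots> < \<infinity>" by (simp add: ennreal_mult_less_top)
    finally show "(\<integral>\<^sup>+s. ennreal (W s) \<partial>lborel) < \<infinity>" .
  qed (auto simp: W0)
  have hcW: "ennreal (gamma_weight t s) * heat_conv (\<lambda>y. norm (v y)) s x \<le> ennreal (W s)" for s x
  proof (cases "0 < s")
    case True
    have "ennreal (gamma_weight t s) * heat_conv (\<lambda>y. norm (v y)) s x
      \<le> ennreal (gamma_weight t s) * ennreal (D * s powr (- (DIM('a) / (2 * p))))"
      unfolding D_def using p A True by (intro mult_left_mono heat_conv_le) auto
    then show ?thesis using t0 by (simp add: W_def ennreal_mult' gamma_weight_nonneg)
  qed simp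
  have bd: "norm (complex_of_real (gamma_weight t s) * heat_convC v s x) \<le> W s" for s x
  proof -
    have "ennreal (norm (complex_of_real (gamma_weight t s) * heat_convC v s x))
       = ennreal (gamma_weight t s) * ennreal (norm (heat_convC v s x))"
      using t0 by (simp add: norm_mult ennreal_mult' gamma_weight_nonneg)
    also have "\<dots> \<le> ennreal (gamma_weight t s) * heat_conv (\<lambda>y. norm (v y)) s x"
      by (intro mult_left_mono norm_heat_convC_le) simp
    also have "\<dots> \<le> ennreal (W s)" by (rule hcW)
    finally show ?thesis using W0 by simp
  qed
  have rep: "bessel_conv t v x = (\<integral>s. complex_of_real (gamma_weight t s) * heat_convC v s x \<partial>lborel)" for x
  proof -
    have "bessel_conv t v x
      = (\<integral>y. \<integral>s. complex_of_real (gamma_weight t s) * (complex_of_real (heat s (x - y)) * v y) \<partial>lborel \<partial>lborel)"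
      by (simp add: bessel_conv_def bessel_kernel_def mult.assoc[symmetric] of_real_mult[symmetric] del: of_real_mult)
    also have "\<dots> = (\<integral>s. \<integral>y. complex_of_real (gamma_weight t s) * (complex_of_real (heat s (x - y)) * v y) \<partial>lborel \<partial>lborel)"
    proof (rule integral_swap_lborel)
      have "(\<integral>\<^sup>+y. \<integral>\<^sup>+s. ennreal (norm (complex_of_real (gamma_weight t s) * (complex_of_real (heat s (x - y)) * v y))) \<partial>lborel \<partial>lborel)
        = (\<integral>\<^sup>+s. \<integral>\<^sup>+y. ennreal (norm (complex_of_real (gamma_weight t s) * (complex_of_real (heat s (x - y)) * v y))) \<partial>lborel \<partial>lborel)"
        by (rule nn_integral_swap_lborel) measurable
      also have "\<dots> = (\<integral>\<^sup>+s. ennreal (gamma_weight t s) * heat_conv (\<lambda>y. norm (v y)) s x \<partial>lborel)"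
        unfolding heat_conv_def using t0
        by (intro nn_integral_cong) (simp add: norm_mult ennreal_mult' gamma_weight_nonneg nn_integral_cmult)
      also have "\<dots> \<le> (\<integral>\<^sup>+s. ennreal (W s) \<partial>lborel)"
        by (intro nn_integral_mono hcW)
      also have "\<dots> < \<infinity>" using Wint W0 by (simp add: integrable_iff_bounded)
      finally show "(\<integral>\<^sup>+y. \<integral>\<^sup>+s. ennreal (norm (complex_of_real (gamma_weight t s) * (complex_of_real (heat s (x - y)) * v y))) \<partial>lborel \<partial>lborel) < \<infinity>" .
    qed measurable
    also have "\<dots> = (\<integral>s. complex_of_real (gamma_weight t s) * heat_convC v s x \<partial>lborel)"
      by (simp add: heat_convC_def)
    finally show ?thesis .
  qed
  \<comment> \<open>The limit function \<open>l\<close> is kept general: it is the heat average at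
    the limit point for continuity, and 0 for decay at infinity.\<close>
  have lim: "(\<lambda>n. bessel_conv t v (X n)) \<longlonglongrightarrow> (\<integral>s. complex_of_real (gamma_weight t s) * l s \<partial>lborel)"
    if "\<And>s. 0 < s \<Longrightarrow> (\<lambda>n. heat_convC v s (X n)) \<longlonglongrightarrow> l s" and [measurable]: "l \<in> borel_measurable borel" for X l
    unfolding rep
  proof (rule integral_dominated_convergence[OF _ _ Wint])
    show "AE s in lborel. (\<lambda>n. complex_of_real (gamma_weight t s) * heat_convC v s (X n)) \<longlonglongrightarrow> complex_of_real (gamma_weight t s) * l s"
    proof (rule AE_I2)
      fix s :: real
      show "(\<lambda>n. complex_of_real (gamma_weight t s) * heat_convC v s (X n)) \<longlonglongrightarrow> complex_of_real (gamma_weight t s) * l s"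
        by (cases "0 < s") (auto intro!: tendsto_intros that)
    qed
  qed (use bd in \<open>auto\<close>)
  have "continuous_on UNIV (bessel_conv t v)"
  proof (rule continuous_on_sequentiallyI)
    fix X :: "nat \<Rightarrow> 'a" and x assume "X \<longlonglongrightarrow> x"
    then show "(\<lambda>n. bessel_conv t v (X n)) \<longlonglongrightarrow> bessel_conv t v x"
      unfolding rep[of x] by (intro lim heat_convC_tendsto[OF _ p _ fin]) auto
  qed
  moreover have "(bessel_conv t v \<longlongrightarrow> 0) at_infinity"
  proof (rule tendsto_at_infinity_sequentiallyI)
    fix X :: "nat \<Rightarrow> 'a" assume "filterlim (\<lambda>n. norm (X n)) at_top sequentially"
    then have "(\<lambda>n. bessel_conv t v (X n)) \<longlonglongrightarrow> (\<integral>s. complex_of_real (gamma_weight t s) * 0 \<partial>lborel)"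
      by (intro lim heat_convC_tendsto_0[OF _ p _ fin]) auto
    then show "(\<lambda>n. bessel_conv t v (X n)) \<longlonglongrightarrow> 0" by simp
  qed
  ultimately show ?thesis by (simp add: C0_def)
qed

section \<open>Schwartz functions\<close>

lemma iter_deriv_append: "iter_deriv (vs @ ws) f = iter_deriv vs (iter_deriv ws f)"
  by (induction vs) auto

lemma schwartz_iter_deriv:
  assumes "\<phi> \<in> schwartz" "set ws \<subseteq> Basis"
  shows "iter_deriv ws \<phi> \<in> schwartz"
  using assms by (auto simp: schwartz_def iter_deriv_append[symmetric])

lemma schwartz_frechet_derivative:
  assumes "\<phi> \<in> schwartz" "b \<in> Basis"
  shows "(\<lambda>x. frechet_derivative \<phi> (at x) b) \<in> schwartz"
  using schwartz_iter_deriv[of \<phi> "[b]"] assms by simp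

lemma schwartz_differentiable:
  assumes "\<phi> \<in> schwartz"
  shows "\<phi> differentiable (at x)"
  using assms by (auto simp: schwartz_def dest: spec[of _ "[]"])

lemma schwartz_has_derivative:
  "\<phi> \<in> schwartz \<Longrightarrow> (\<phi> has_derivative frechet_derivative \<phi> (at x)) (at x)"
  using schwartz_differentiable frechet_derivative_works by blast

lemma schwartz_continuous:
  "\<phi> \<in> schwartz \<Longrightarrow> continuous_on UNIV \<phi>"
  by (simp add: continuous_on_eq_continuous_at differentiable_imp_continuous_within schwartz_differentiable)

lemma schwartz_measurable [measurable]: "\<phi> \<in> schwartz \<Longrightarrow> \<phi> \<in> borel_measurable borel"
  by (intro borel_measurable_continuous_onI schwartz_continuous)

lemma frechet_derivative_linear_comb:
  fixes f g :: "'a::euclidean_space \<Rightarrow> complex"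
  assumes "f differentiable (at x)" "g differentiable (at x)"
  shows "frechet_derivative (\<lambda>x. c * f x + g x) (at x) v = c * frechet_derivative f (at x) v + frechet_derivative g (at x) v"
    and "(\<lambda>x. c * f x + g x) differentiable (at x)"
proof -
  have "((\<lambda>x. c * f x + g x) has_derivative (\<lambda>v. c * frechet_derivative f (at x) v + frechet_derivative g (at x) v)) (at x)"
    using assms unfolding frechet_derivative_works
    by (intro has_derivative_add has_derivative_mult_right)
  then show "frechet_derivative (\<lambda>x. c * f x + g x) (at x) v = c * frechet_derivative f (at x) v + frechet_derivative g (at x) v"
    and "(\<lambda>x. c * f x + g x) differentiable (at x)"
    by (auto simp: frechet_derivative_at[symmetric] differentiable_def)
qed

lemma schwartz_linear_comb:
  fixes \<phi> \<psi> :: "'a::euclidean_space \<Rightarrow> complex"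
  assumes \<phi>: "\<phi> \<in> schwartz" and \<psi>: "\<psi> \<in> schwartz"
  shows "(\<lambda>x. c * \<phi> x + \<psi> x) \<in> schwartz"
proof -
  have it: "iter_deriv vs (\<lambda>x. c * \<phi> x + \<psi> x) = (\<lambda>x. c * iter_deriv vs \<phi> x + iter_deriv vs \<psi> x)"
    if "set vs \<subseteq> Basis" for vs
    using that
  proof (induction vs)
    case (Cons v vs)
    have d: "iter_deriv vs \<phi> differentiable (at x)" "iter_deriv vs \<psi> differentiable (at x)" for x
      using Cons.prems \<phi> \<psi> by (auto simp: schwartz_def)
    show ?case
      using Cons by (auto simp: frechet_derivative_linear_comb(1)[OF d])
  qed simp
  show ?thesis
    unfolding schwartz_def mem_Collect_eq
  proof (intro allI impI conjI)
    fix vs :: "'a list" assume vs: "set vs \<subseteq> Basis"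
    show "iter_deriv vs (\<lambda>x. c * \<phi> x + \<psi> x) differentiable (at x)" for x
      unfolding it[OF vs] using vs \<phi> \<psi> by (intro frechet_derivative_linear_comb(2)) (auto simp: schwartz_def)
    fix k :: nat
    have "bounded (range (\<lambda>x. norm x ^ k *\<^sub>R iter_deriv vs \<phi> x))" "bounded (range (\<lambda>x. norm x ^ k *\<^sub>R iter_deriv vs \<psi> x))"
      using vs \<phi> \<psi> by (auto simp: schwartz_def)
    then obtain A B where A: "\<And>x. norm (norm x ^ k *\<^sub>R iter_deriv vs \<phi> x) \<le> A" and B: "\<And>x. norm (norm x ^ k *\<^sub>R iter_deriv vs \<psi> x) \<le> B"
      by (fastforce simp: bounded_iff)
    show "bounded (range (\<lambda>x. norm x ^ k *\<^sub>R iter_deriv vs (\<lambda>x. c * \<phi> x + \<psi> x) x))"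
      unfolding bounded_iff it[OF vs]
    proof (intro exI[of _ "norm c * A + B"] ballI)
      fix z assume "z \<in> range (\<lambda>x. norm x ^ k *\<^sub>R (c * iter_deriv vs \<phi> x + iter_deriv vs \<psi> x))"
      then obtain x where "z = norm x ^ k *\<^sub>R (c * iter_deriv vs \<phi> x + iter_deriv vs \<psi> x)" by blast
      then have z: "z = c * (norm x ^ k *\<^sub>R iter_deriv vs \<phi> x) + norm x ^ k *\<^sub>R iter_deriv vs \<psi> x"
        by (simp add: scaleR_add_right)
      show "norm z \<le> norm c * A + B"
        unfolding z by (intro order_trans[OF norm_triangle_ineq] add_mono B) (simp only: norm_mult mult_left_mono[OF A] norm_ge_zero)
    qed
  qed
qed

definition one_minus_laplacian :: "('a::euclidean_space \<Rightarrow> complex) \<Rightarrow> 'a \<Rightarrow> complex" where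
  "one_minus_laplacian \<phi> = (\<lambda>x. \<phi> x - (\<Sum>b\<in>Basis. iter_deriv [b, b] \<phi> x))"

lemma schwartz_sum:
  assumes "finite I" "\<And>i. i \<in> I \<Longrightarrow> f i \<in> schwartz" "\<phi> \<in> schwartz"
  shows "(\<lambda>x. \<phi> x - (\<Sum>i\<in>I. f i x)) \<in> schwartz"
  using assms
proof (induction I rule: finite_induct)
  case (insert i I)
  then have "(\<lambda>x. (- 1) * f i x + (\<phi> x - (\<Sum>i\<in>I. f i x))) \<in> schwartz"
    by (intro schwartz_linear_comb) auto
  moreover have "(\<lambda>x. (- 1) * f i x + (\<phi> x - (\<Sum>i\<in>I. f i x))) = (\<lambda>x. \<phi> x - (\<Sum>i\<in>insert i I. f i x))"
    using insert by (simp add: fun_eq_iff)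
  ultimately show ?case by metis
qed simp

lemma schwartz_one_minus_laplacian: "\<phi> \<in> schwartz \<Longrightarrow> one_minus_laplacian \<phi> \<in> schwartz"
  unfolding one_minus_laplacian_def by (intro schwartz_sum schwartz_iter_deriv) auto

lemma schwartz_one_minus_laplacian_funpow: "\<phi> \<in> schwartz \<Longrightarrow> (one_minus_laplacian ^^ k) \<phi> \<in> schwartz"
  by (induction k) (auto intro: schwartz_one_minus_laplacian)

lemma one_plus_power_le:
  fixes r :: real
  assumes "0 \<le> r"
  shows "(1 + r) ^ n \<le> 2 ^ n * (1 + r ^ n)"
proof -
  have "(1 + r) ^ n \<le> (2 * max 1 r) ^ n"
    using assms by (intro power_mono) auto
  also have "\<dots> = 2 ^ n * max 1 r ^ n" by (rule power_mult_distrib)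
  also have "max 1 r ^ n \<le> 1 + r ^ n"
    using assms by (cases "1 \<le> r") (auto simp: max_def)
  finally show ?thesis by simp
qed

text \<open>Only the bounds of orders 0 and \<open>2 * k\<close> enter, since
  \<open>(1 + (norm x)\<^sup>2) ^ k\<close> is at most
  \<open>2 ^ k * (1 + norm x ^ (2 * k))\<close>.\<close>

lemma schwartz_decay:
  fixes \<phi> :: "'a::euclidean_space \<Rightarrow> complex"
  assumes \<phi>: "\<phi> \<in> schwartz"
  shows "\<exists>C\<ge>0. \<forall>x. norm (\<phi> x) \<le> C * (1 + (norm x)\<^sup>2) powr (- real k)"
proof -
  have "bounded (range (\<lambda>x. norm x ^ n *\<^sub>R \<phi> x))" for n
    using \<phi> by (auto simp: schwartz_def dest: spec[of _ "[]"])
  then have "\<exists>A. \<forall>x. norm x ^ n * norm (\<phi> x) \<le> A" for n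
    by (fastforce simp: bounded_iff)
  then obtain A where A: "\<And>n x. norm x ^ n * norm (\<phi> x) \<le> A n" by metis
  have A0: "0 \<le> A n" for n using A[of 0 n] by (rule order_trans[rotated]) simp
  show ?thesis
  proof (intro exI[of _ "2 ^ k * (A 0 + A (2 * k))"] conjI allI)
    fix x
    have "(1 + (norm x)\<^sup>2) ^ k * norm (\<phi> x) \<le> 2 ^ k * (1 + ((norm x)\<^sup>2) ^ k) * norm (\<phi> x)"
      by (intro mult_right_mono one_plus_power_le) auto
    also have "\<dots> = 2 ^ k * (norm x ^ 0 * norm (\<phi> x) + norm x ^ (2 * k) * norm (\<phi> x))"
      by (simp only: power_mult power_0 mult_1_left mult_1_right ring_distribs mult.assoc)
    also have "\<dots> \<le> 2 ^ k * (A 0 + A (2 * k))"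
      by (intro mult_left_mono add_mono A) auto
    finally show "norm (\<phi> x) \<le> 2 ^ k * (A 0 + A (2 * k)) * (1 + (norm x)\<^sup>2) powr (- real k)"
      by (simp add: powr_minus_divide powr_realpow add_pos_nonneg field_simps)
  qed (simp add: A0)
qed

lemma schwartz_bounded:
  fixes \<phi> :: "'a::euclidean_space \<Rightarrow> complex"
  assumes "\<phi> \<in> schwartz"
  obtains B where "0 \<le> B" "\<And>x. norm (\<phi> x) \<le> B"
proof -
  obtain C where C: "0 \<le> C" "\<And>x. norm (\<phi> x) \<le> C * (1 + (norm x)\<^sup>2) powr (- real 0)"
    using schwartz_decay[OF assms, of 0] by auto
  have "1 + (norm x)\<^sup>2 \<noteq> 0" for x :: 'a
    by (simp add: add_nonneg_eq_0_iff)
  with C show thesis by (intro that[of C]) (auto simp del: powr_eq_0_iff)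
qed

lemma integrable_of_decay:
  fixes f :: "'a::euclidean_space \<Rightarrow> complex"
  assumes [measurable]: "f \<in> borel_measurable borel" and k: "DIM('a) / 2 < k"
    and bd: "\<And>x. norm (f x) \<le> C * (1 + (norm x)\<^sup>2) powr (- k)"
  shows "integrable lborel f"
proof (rule Bochner_Integration.integrable_bound)
  show "integrable lborel (\<lambda>x::'a. C * (1 + (norm x)\<^sup>2) powr (- k))"
    by (intro integrable_mult_right integrable_bessel_symbol k)
  show "AE x in lborel. norm (f x) \<le> norm (C * (1 + (norm x)\<^sup>2) powr (- k))"
    using bd by (intro AE_I2) (metis abs_ge_self order_trans real_norm_def)
qed simp

lemma schwartz_integrable:
  fixes \<phi> :: "'a::euclidean_space \<Rightarrow> complex"
  assumes "\<phi> \<in> schwartz"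
  shows "integrable lborel \<phi>"
proof -
  obtain C where "\<And>x. norm (\<phi> x) \<le> C * (1 + (norm x)\<^sup>2) powr (- real DIM('a))"
    using schwartz_decay[OF assms, of "DIM('a)"] by auto
  then show ?thesis
    using assms by (intro integrable_of_decay[where k = "real DIM('a)"]) auto
qed

text \<open>By translation invariance, integrating \<open>h (b + x) - h x\<close> over \<open>x\<close> gives \<open>0\<close>; by the fundamental theorem
  of calculus along \<open>b\<close> and Fubini it gives the integral of the derivative.\<close>

lemma integral_frechet_derivative_eq_0:
  fixes h :: "'a::euclidean_space \<Rightarrow> complex"
  assumes d: "\<And>x. h differentiable (at x)" and h: "integrable lborel h"
    and cont: "continuous_on UNIV (\<lambda>x. frechet_derivative h (at x) b)"
    and h': "integrable lborel (\<lambda>x. frechet_derivative h (at x) b)"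
  shows "(\<integral>x. frechet_derivative h (at x) b \<partial>lborel) = 0"
proof -
  define h' where "h' x = frechet_derivative h (at x) b" for x
  have [measurable]: "h' \<in> borel_measurable borel"
    unfolding h'_def using cont by (rule borel_measurable_continuous_onI)
  have hi: "integrable lborel h'" using h' by (simp add: h'_def[abs_def])
  have [measurable]: "h \<in> borel_measurable borel" using h by (simp add: integrable_iff_bounded)
  have ftc: "(\<integral>s. indicator {0..1::real} s *\<^sub>R h' (s *\<^sub>R b + x) \<partial>lborel) = h (b + x) - h x" for x
  proof -
    have "(\<integral>s. indicator {0..1::real} s *\<^sub>R h' (s *\<^sub>R b + x) \<partial>lborel) = h (1 *\<^sub>R b + x) - h (0 *\<^sub>R b + x)"
    proof (rule integral_FTC_Icc)
      fix s :: real
      have "((\<lambda>s. s *\<^sub>R b + x) has_derivative (\<lambda>e. e *\<^sub>R b)) (at s within {0..1})"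
        by (auto intro!: derivative_eq_intros)
      moreover have "(h has_derivative frechet_derivative h (at (s *\<^sub>R b + x))) (at (s *\<^sub>R b + x))"
        using d frechet_derivative_works by blast
      ultimately have D: "((\<lambda>s. h (s *\<^sub>R b + x)) has_derivative (\<lambda>e. frechet_derivative h (at (s *\<^sub>R b + x)) (e *\<^sub>R b))) (at s within {0..1})"
        by (rule has_derivative_compose)
      have "linear (frechet_derivative h (at (s *\<^sub>R b + x)))"
        using d by (rule linear_frechet_derivative)
      then show "((\<lambda>s. h (s *\<^sub>R b + x)) has_vector_derivative h' (s *\<^sub>R b + x)) (at s within {0..1})"
        using D by (simp add: has_vector_derivative_def h'_def linear_cmul)
    next
      show "continuous_on {0..1} (\<lambda>s. h' (s *\<^sub>R b + x))"
        unfolding h'_def by (intro continuous_on_compose2[OF cont] continuous_intros) auto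
    qed simp
    then show ?thesis by simp
  qed
  have "(\<integral>x. \<integral>s. indicator {0..1::real} s *\<^sub>R h' (s *\<^sub>R b + x) \<partial>lborel \<partial>lborel)
      = (\<integral>s. \<integral>x. indicator {0..1::real} s *\<^sub>R h' (s *\<^sub>R b + x) \<partial>lborel \<partial>lborel)"
  proof (rule integral_swap_lborel)
    have "(\<integral>\<^sup>+x. \<integral>\<^sup>+s. ennreal (norm (indicator {0..1::real} s *\<^sub>R h' (s *\<^sub>R b + x))) \<partial>lborel \<partial>lborel)
      = (\<integral>\<^sup>+s. \<integral>\<^sup>+x. ennreal (norm (indicator {0..1::real} s *\<^sub>R h' (s *\<^sub>R b + x))) \<partial>lborel \<partial>lborel)"
      by (rule nn_integral_swap_lborel) measurable
    also have "\<dots> = (\<integral>\<^sup>+s. indicator {0..1::real} s * (\<integral>\<^sup>+x. ennreal (norm (h' x)) \<partial>lborel) \<partial>lborel)"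
    proof (rule nn_integral_cong)
      fix s :: real
      have "(\<integral>\<^sup>+x. ennreal (norm (indicator {0..1::real} s *\<^sub>R h' (s *\<^sub>R b + x))) \<partial>lborel)
         = (\<integral>\<^sup>+x. indicator {0..1::real} s * ennreal (norm (h' (s *\<^sub>R b + x))) \<partial>lborel)"
        by (intro nn_integral_cong) (auto simp: indicator_def)
      also have "\<dots> = indicator {0..1::real} s * (\<integral>\<^sup>+x. ennreal (norm (h' x)) \<partial>lborel)"
        by (simp add: nn_integral_cmult nn_integral_lborel_translate[of "\<lambda>x. ennreal (norm (h' x))"])
      finally show "(\<integral>\<^sup>+x. ennreal (norm (indicator {0..1::real} s *\<^sub>R h' (s *\<^sub>R b + x))) \<partial>lborel)
         = indicator {0..1::real} s * (\<integral>\<^sup>+x. ennreal (norm (h' x)) \<partial>lborel)" .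
    qed
    also have "\<dots> = (\<integral>\<^sup>+x. ennreal (norm (h' x)) \<partial>lborel)"
      by (simp add: nn_integral_multc)
    also have "\<dots> < \<infinity>" using hi by (simp add: integrable_iff_bounded)
    finally show "(\<integral>\<^sup>+x. \<integral>\<^sup>+s. ennreal (norm (indicator {0..1::real} s *\<^sub>R h' (s *\<^sub>R b + x))) \<partial>lborel \<partial>lborel) < \<infinity>" .
  qed measurable
  also have "\<dots> = (\<integral>s. indicator {0..1::real} s *\<^sub>R (\<integral>x. h' x \<partial>lborel) \<partial>lborel)"
    by (simp add: integral_lborel_translate[of h'])
  also have "\<dots> = (\<integral>x. h' x \<partial>lborel)"
    by simp
  finally have "(\<integral>x. h' x \<partial>lborel) = (\<integral>x. h (b + x) - h x \<partial>lborel)"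
    by (simp add: ftc)
  also have "\<dots> = 0"
    using h by (simp add: Bochner_Integration.integral_diff integrable_lborel_translate integral_lborel_translate[of h])
  finally show ?thesis by (simp add: h'_def)
qed

text \<open>The sign in the exponent is that of \<open>inv_fourier\<close>, without its constant;
  \<open>fourier\<close> is the reflection of this transform. Bessel symbols are even, so they are
  unaffected by the reflection.\<close>

definition ft :: "('a::euclidean_space \<Rightarrow> complex) \<Rightarrow> 'a \<Rightarrow> complex" where
  "ft f \<xi> = (\<integral>y. f y * iexp (y \<bullet> \<xi>) \<partial>lborel)"

lemma measurable_ft [measurable]:
  assumes [measurable]: "f \<in> borel_measurable borel"
  shows "ft f \<in> borel_measurable borel"
  unfolding ft_def by measurable

lemma integrable_mult_iexp:
  fixes f :: "'a::euclidean_space \<Rightarrow> complex"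
  assumes "integrable lborel f"
  shows "integrable lborel (\<lambda>y. f y * iexp (y \<bullet> \<xi>))"
proof (rule Bochner_Integration.integrable_bound[OF assms])
  show "(\<lambda>y. f y * iexp (y \<bullet> \<xi>)) \<in> borel_measurable lborel"
    using borel_measurable_integrable[OF assms] by measurable
qed (simp add: norm_mult)

lemma norm_ft_le: "integrable lborel f \<Longrightarrow> norm (ft f \<xi>) \<le> (\<integral>y. norm (f y) \<partial>lborel)"
  unfolding ft_def by (rule order_trans[OF integral_norm_bound]) (simp add: norm_mult)

lemma has_derivative_iexp_inner:
  "((\<lambda>x. iexp (x \<bullet> \<xi>)) has_derivative (\<lambda>v. iexp (x \<bullet> \<xi>) * (\<i> * complex_of_real (v \<bullet> \<xi>)))) (at x)"
proof -
  have "((\<lambda>x. \<i> * complex_of_real (x \<bullet> \<xi>)) has_derivative (\<lambda>v. \<i> * complex_of_real (v \<bullet> \<xi>))) (at x)"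
    by (intro has_derivative_mult_right has_derivative_of_real has_derivative_inner_left has_derivative_ident)
  moreover have "(exp has_derivative (*) (iexp (x \<bullet> \<xi>))) (at (\<i> * complex_of_real (x \<bullet> \<xi>)))"
    using DERIV_exp unfolding has_field_derivative_def .
  ultimately show ?thesis
    by (rule has_derivative_compose)
qed

text \<open>Integration by parts: the derivative of
  \<open>\<phi> x * iexp (x \<bullet> \<xi>)\<close> along \<open>b\<close> has integral 0. The
  minus sign reflects the positive exponent in \<open>ft\<close>.\<close>

lemma ft_frechet_derivative:
  fixes \<phi> :: "'a::euclidean_space \<Rightarrow> complex"
  assumes \<phi>: "\<phi> \<in> schwartz" and b: "b \<in> Basis"
  shows "ft (\<lambda>x. frechet_derivative \<phi> (at x) b) \<xi> = - (\<i> * complex_of_real (\<xi> \<bullet> b)) * ft \<phi> \<xi>"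
proof -
  define h where "h x = \<phi> x * iexp (x \<bullet> \<xi>)" for x
  let ?d = "\<lambda>x. frechet_derivative \<phi> (at x) b"
  have \<phi>': "?d \<in> schwartz" by (rule schwartz_frechet_derivative[OF \<phi> b])
  have D: "(h has_derivative (\<lambda>v. \<phi> x * (iexp (x \<bullet> \<xi>) * (\<i> * complex_of_real (v \<bullet> \<xi>))) + frechet_derivative \<phi> (at x) v * iexp (x \<bullet> \<xi>))) (at x)" for x
    unfolding h_def
    by (rule has_derivative_mult[OF schwartz_has_derivative[OF \<phi>] has_derivative_iexp_inner])
  then have fd: "frechet_derivative h (at x) b = ?d x * iexp (x \<bullet> \<xi>) + \<i> * complex_of_real (\<xi> \<bullet> b) * (\<phi> x * iexp (x \<bullet> \<xi>))" for x
    by (simp add: frechet_derivative_at[OF D, symmetric] inner_commute algebra_simps)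
  have i1: "integrable lborel (\<lambda>x. ?d x * iexp (x \<bullet> \<xi>))" and i2: "integrable lborel (\<lambda>x. \<i> * complex_of_real (\<xi> \<bullet> b) * (\<phi> x * iexp (x \<bullet> \<xi>)))"
    by (intro integrable_mult_iexp integrable_mult_right schwartz_integrable \<phi> \<phi>')+
  have "(\<integral>x. frechet_derivative h (at x) b \<partial>lborel) = 0"
  proof (rule integral_frechet_derivative_eq_0)
    show "h differentiable (at x)" for x using D by (auto simp: differentiable_def)
    show "integrable lborel h" unfolding h_def by (intro integrable_mult_iexp schwartz_integrable \<phi>)
    show "integrable lborel (\<lambda>x. frechet_derivative h (at x) b)"
      unfolding fd by (intro Bochner_Integration.integrable_add i1 i2)
    show "continuous_on UNIV (\<lambda>x. frechet_derivative h (at x) b)"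
      unfolding fd by (intro continuous_intros schwartz_continuous \<phi> \<phi>')
  qed
  then have "ft ?d \<xi> + \<i> * complex_of_real (\<xi> \<bullet> b) * ft \<phi> \<xi> = 0"
    unfolding fd ft_def by (simp add: Bochner_Integration.integral_add[OF i1 i2])
  then show ?thesis by (simp add: eq_neg_iff_add_eq_0)
qed

lemma ft_one_minus_laplacian:
  fixes \<phi> :: "'a::euclidean_space \<Rightarrow> complex"
  assumes \<phi>: "\<phi> \<in> schwartz"
  shows "ft (one_minus_laplacian \<phi>) \<xi> = complex_of_real (1 + (norm \<xi>)\<^sup>2) * ft \<phi> \<xi>"
proof -
  have dd: "ft (iter_deriv [b, b] \<phi>) \<xi> = - complex_of_real ((\<xi> \<bullet> b)\<^sup>2) * ft \<phi> \<xi>" if b: "b \<in> Basis" for b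
    using ft_frechet_derivative[OF schwartz_frechet_derivative[OF \<phi> b] b, of \<xi>] ft_frechet_derivative[OF \<phi> b, of \<xi>]
    by (simp add: power2_eq_square mult.assoc[symmetric]) (simp add: mult_ac)
  have i: "integrable lborel (\<lambda>y. iter_deriv [b, b] \<phi> y * iexp (y \<bullet> \<xi>))" if "b \<in> Basis" for b
    using that by (intro integrable_mult_iexp schwartz_integrable schwartz_iter_deriv \<phi>) auto
  have "ft (one_minus_laplacian \<phi>) \<xi> = (\<integral>y. \<phi> y * iexp (y \<bullet> \<xi>) - (\<Sum>b\<in>Basis. iter_deriv [b, b] \<phi> y * iexp (y \<bullet> \<xi>)) \<partial>lborel)"
    unfolding ft_def one_minus_laplacian_def by (simp only: left_diff_distrib sum_distrib_right)
  also have "\<dots> = ft \<phi> \<xi> - (\<Sum>b\<in>Basis. ft (iter_deriv [b, b] \<phi>) \<xi>)"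
    unfolding ft_def
    by (subst Bochner_Integration.integral_diff)
       (intro integrable_mult_iexp schwartz_integrable \<phi> Bochner_Integration.integrable_sum i | simp only: Bochner_Integration.integral_sum[OF i])+
  also have "\<dots> = ft \<phi> \<xi> + (\<Sum>b\<in>Basis. complex_of_real ((\<xi> \<bullet> b)\<^sup>2) * ft \<phi> \<xi>)"
    by (simp only: dd sum_negf mult_minus_left diff_minus_eq_add cong: sum.cong)
  also have "\<dots> = complex_of_real (1 + (\<Sum>b\<in>Basis. (\<xi> \<bullet> b)\<^sup>2)) * ft \<phi> \<xi>"
    by (simp add: sum_distrib_right ring_distribs)
  also have "(\<Sum>b\<in>Basis. (\<xi> \<bullet> b)\<^sup>2) = (norm \<xi>)\<^sup>2"
    unfolding power2_norm_eq_inner by (subst (2) euclidean_inner) (simp add: power2_eq_square)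
  finally show ?thesis .
qed

lemma ft_one_minus_laplacian_funpow:
  assumes "\<phi> \<in> schwartz"
  shows "ft ((one_minus_laplacian ^^ k) \<phi>) \<xi> = bessel_symbol (real k) \<xi> * ft \<phi> \<xi>"
proof (induction k)
  case 0
  have "0 < 1 + (norm \<xi>)\<^sup>2" by (simp add: add_pos_nonneg)
  then show ?case by (simp add: bessel_symbol_def)
next
  case (Suc k)
  have "0 < 1 + (norm \<xi>)\<^sup>2" by (simp add: add_pos_nonneg)
  then have "(1 + (norm \<xi>)\<^sup>2) powr real (Suc k) = (1 + (norm \<xi>)\<^sup>2) * (1 + (norm \<xi>)\<^sup>2) powr real k"
    by (simp add: powr_add)
  then show ?case
    using Suc by (simp add: ft_one_minus_laplacian schwartz_one_minus_laplacian_funpow assms bessel_symbol_def)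
qed

lemma bessel_symbol_add: "bessel_symbol (s + t) \<xi> = bessel_symbol s \<xi> * bessel_symbol t \<xi>"
  by (simp add: bessel_symbol_def powr_add)

lemma bessel_symbol_0 [simp]: "bessel_symbol 0 \<xi> = 1"
  using add_pos_nonneg[of 1 "(norm \<xi>)\<^sup>2"] by (simp add: bessel_symbol_def)

lemma measurable_bessel_symbol [measurable]: "bessel_symbol s \<in> borel_measurable borel"
  unfolding bessel_symbol_def by measurable

text \<open>The growth of the symbol is absorbed by powers of \<open>I - \<Delta>\<close>: the
  function equals the symbol of order \<open>s - k\<close> times the transform of the
  \<open>k\<close>-th power applied to \<open>\<phi>\<close>. That transform is bounded, and the
  symbol is integrable once \<open>k - s\<close> exceeds half the dimension.\<close>

lemma integrable_bessel_symbol_ft: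
  fixes \<phi> :: "'a::euclidean_space \<Rightarrow> complex"
  assumes \<phi>: "\<phi> \<in> schwartz"
  shows "integrable lborel (\<lambda>\<xi>. bessel_symbol s \<xi> * ft \<phi> \<xi>)"
proof -
  obtain k :: nat where k: "s + DIM('a) / 2 < real k" using reals_Archimedean2 by blast
  define \<psi> where "\<psi> = (one_minus_laplacian ^^ k) \<phi>"
  have \<psi>: "\<psi> \<in> schwartz" unfolding \<psi>_def by (rule schwartz_one_minus_laplacian_funpow[OF \<phi>])
  have eq: "bessel_symbol s \<xi> * ft \<phi> \<xi> = bessel_symbol (- (real k - s)) \<xi> * ft \<psi> \<xi>" for \<xi>
  proof -
    have "bessel_symbol (- (real k - s)) \<xi> * ft \<psi> \<xi> = bessel_symbol (- (real k - s) + real k) \<xi> * ft \<phi> \<xi>"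
      unfolding bessel_symbol_add \<psi>_def ft_one_minus_laplacian_funpow[OF \<phi>] by simp
    then show ?thesis by simp
  qed
  show ?thesis
  proof (rule integrable_of_decay)
    show "DIM('a) / 2 < real k - s" using k by simp
    fix \<xi>
    show "norm (bessel_symbol s \<xi> * ft \<phi> \<xi>) \<le> (\<integral>y. norm (\<psi> y) \<partial>lborel) * (1 + (norm \<xi>)\<^sup>2) powr (- (real k - s))"
      unfolding eq using norm_ft_le[OF schwartz_integrable[OF \<psi>], of \<xi>]
      by (simp add: norm_mult bessel_symbol_def mult_right_mono mult.commute)
  qed (use \<phi> in measurable)
qed

section \<open>Distributions\<close>

text \<open>The bridge from \<open>lebesgue\<close> to \<open>lborel\<close>. Because
  \<open>lebesgue\<close> is complete, agreement almost everywhere with a Borel function already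
  gives measurability, although \<open>f\<close> itself need not be Borel.\<close>

lemma
  fixes f g :: "'a::euclidean_space \<Rightarrow> 'b::{banach, second_countable_topology}"
  assumes g[measurable]: "g \<in> borel_measurable borel" and ae: "AE x in lborel. f x = g x"
  shows borel_measurable_lebesgue_AE_eq: "f \<in> borel_measurable lebesgue"
    and integral_lebesgue_AE_eq: "(LINT x|lebesgue. f x) = (\<integral>x. g x \<partial>lborel)"
    and integrable_lebesgue_AE_eq: "integrable lebesgue f \<longleftrightarrow> integrable lborel g"
proof -
  have gm: "g \<in> borel_measurable lebesgue" by (intro measurable_completion) simp
  have ae': "AE x in lebesgue. f x = g x" using ae by (rule AE_completion)
  show m: "f \<in> borel_measurable lebesgue"
  proof (rule measurableI)
    fix S :: "'b set" assume S: "S \<in> sets borel"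
    show "f -` S \<inter> space lebesgue \<in> sets lebesgue"
    proof (rule completion.in_sets_AE[where A = "g -` S \<inter> space lebesgue"])
      show "AE x in lebesgue. x \<in> g -` S \<inter> space lebesgue \<longleftrightarrow> x \<in> f -` S \<inter> space lebesgue"
        using ae' by eventually_elim simp
      show "g -` S \<inter> space lebesgue \<in> sets lebesgue"
        using gm S by (rule measurable_sets)
    qed simp
  qed simp
  show "(LINT x|lebesgue. f x) = (\<integral>x. g x \<partial>lborel)"
    using integral_cong_AE[OF m gm ae'] by (simp add: integral_completion)
  show "integrable lebesgue f \<longleftrightarrow> integrable lborel g"
    using integrable_cong_AE[OF m gm ae'] by (simp add: integrable_completion)
qed

lemma lebesgue_borel_representative:
  fixes f :: "'a::euclidean_space \<Rightarrow> complex"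
  assumes f: "f \<in> borel_measurable lebesgue"
  obtains g where "g \<in> borel_measurable borel" "AE x in lborel. f x = g x"
proof -
  obtain a where a: "a \<in> borel_measurable lborel" "AE x in lborel. Re (f x) = a x"
    using completion_ex_borel_measurable_real[of "\<lambda>x. Re (f x)" lborel] f by auto
  obtain b where b: "b \<in> borel_measurable lborel" "AE x in lborel. Im (f x) = b x"
    using completion_ex_borel_measurable_real[of "\<lambda>x. Im (f x)" lborel] f by auto
  show thesis
  proof (rule that[of "\<lambda>x. complex_of_real (a x) + \<i> * complex_of_real (b x)"])
    show "(\<lambda>x. complex_of_real (a x) + \<i> * complex_of_real (b x)) \<in> borel_measurable borel"
      using a(1) b(1) by simp
    show "AE x in lborel. f x = complex_of_real (a x) + \<i> * complex_of_real (b x)"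
      using a(2) b(2) by eventually_elim (simp add: complex_eq_iff)
  qed
qed

lemma Lp_iff_representative:
  fixes f :: "'a::euclidean_space \<Rightarrow> complex"
  assumes [measurable]: "v \<in> borel_measurable borel" and ae: "AE x in lborel. f x = v x"
  shows "f \<in> Lp p \<longleftrightarrow> (\<integral>\<^sup>+x. ennreal (norm (v x) powr p) \<partial>lborel) < \<infinity>"
proof -
  have ae': "AE x in lborel. norm (f x) powr p = norm (v x) powr p"
    using ae by eventually_elim simp
  have "f \<in> Lp p \<longleftrightarrow> integrable lborel (\<lambda>x. norm (v x) powr p)"
    using borel_measurable_lebesgue_AE_eq[OF assms] integrable_lebesgue_AE_eq[OF _ ae']
    by (simp add: Lp_def)
  then show ?thesis by (simp add: integrable_iff_bounded)
qed

lemma Lp_norm_representative: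
  fixes f :: "'a::euclidean_space \<Rightarrow> complex"
  assumes [measurable]: "v \<in> borel_measurable borel" and ae: "AE x in lborel. f x = v x"
  shows "Lp_norm p f = (\<integral>x. norm (v x) powr p \<partial>lborel) powr (1 / p)"
proof -
  have ae': "AE x in lborel. norm (f x) powr p = norm (v x) powr p"
    using ae by eventually_elim simp
  show ?thesis
    unfolding Lp_norm_def by (subst integral_lebesgue_AE_eq[OF _ ae']) simp_all
qed

lemma Lp_borel_representative:
  fixes f :: "'a::euclidean_space \<Rightarrow> complex"
  assumes "f \<in> Lp p"
  obtains v where "v \<in> borel_measurable borel" "AE x in lborel. f x = v x"
    "(\<integral>\<^sup>+x. ennreal (norm (v x) powr p) \<partial>lborel) < \<infinity>"
proof -
  obtain v where v: "v \<in> borel_measurable borel" "AE x in lborel. f x = v x"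
    using assms lebesgue_borel_representative[of f] by (auto simp: Lp_def)
  with assms Lp_iff_representative[OF v] show thesis by (intro that[OF v]) auto
qed

lemma dist_of_representative:
  fixes f :: "'a::euclidean_space \<Rightarrow> complex"
  assumes [measurable]: "v \<in> borel_measurable borel" and ae: "AE x in lborel. f x = v x"
    and [measurable]: "\<phi> \<in> borel_measurable borel"
  shows "dist_of f \<phi> = (\<integral>x. v x * \<phi> x \<partial>lborel)"
proof -
  have ae': "AE x in lborel. f x * \<phi> x = v x * \<phi> x"
    using ae by eventually_elim simp
  show ?thesis
    unfolding dist_of_def by (rule integral_lebesgue_AE_eq[OF _ ae']) simp
qed

lemma fourier_eq_ft:
  fixes f :: "'a::euclidean_space \<Rightarrow> complex"
  assumes [measurable]: "g \<in> borel_measurable borel" and ae: "AE x in lborel. f x = g x"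
  shows "fourier f \<xi> = ft g (- \<xi>)"
proof -
  have ae': "AE x in lborel. f x * exp (- (\<i> * complex_of_real (x \<bullet> \<xi>))) = g x * exp (- (\<i> * complex_of_real (x \<bullet> \<xi>)))"
    using ae by eventually_elim simp
  show ?thesis
    unfolding fourier_def ft_def by (subst integral_lebesgue_AE_eq[OF _ ae']) simp_all
qed

lemma inv_fourier_eq_ft:
  fixes f :: "'a::euclidean_space \<Rightarrow> complex"
  assumes [measurable]: "f \<in> borel_measurable borel"
  shows "inv_fourier f = (\<lambda>x. complex_of_real (1 / (2 * pi) ^ DIM('a)) * ft f x)"
proof
  fix x
  have "(LINT \<xi>|lebesgue. f \<xi> * exp (\<i> * complex_of_real (x \<bullet> \<xi>))) = ft f x"
    unfolding ft_def inner_commute[of x] by (rule integral_lebesgue_AE_eq) simp_all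
  then show "inv_fourier f x = complex_of_real (1 / (2 * pi) ^ DIM('a)) * ft f x"
    by (simp only: inv_fourier_def)
qed

section \<open>Fourier inversion and Bessel operators on test functions\<close>

lemma integrable_bessel_symbol_inv_fourier:
  "\<phi> \<in> schwartz \<Longrightarrow> integrable lborel (\<lambda>\<xi>. bessel_symbol s \<xi> * inv_fourier \<phi> \<xi>)"
  using integrable_mult_right[OF integrable_bessel_symbol_ft[of \<phi> s], of "complex_of_real (1 / (2 * pi) ^ DIM('a))"]
  by (simp add: inv_fourier_eq_ft mult_ac)

lemma fourier_inv_fourier:
  fixes \<phi> :: "'a::euclidean_space \<Rightarrow> complex"
  assumes \<phi>: "\<phi> \<in> schwartz"
  shows "fourier (inv_fourier \<phi>) = \<phi>"
proof
  fix x
  have [measurable]: "\<phi> \<in> borel_measurable borel" using \<phi> by simp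
  obtain B where B: "\<And>x. norm (\<phi> x) \<le> B" using schwartz_bounded[OF \<phi>] by blast
  \<comment> \<open>Integrability of the transform, which the inversion theorem requires, is the
    case of order 0.\<close>
  have i: "integrable lborel (\<lambda>\<xi>. \<integral>y. \<phi> y * iexp (y \<bullet> \<xi>) \<partial>lborel)"
    using integrable_bessel_symbol_ft[OF \<phi>, of 0] by (simp add: ft_def[abs_def])
  have "fourier (inv_fourier \<phi>) x = ft (\<lambda>\<xi>. complex_of_real (1 / (2 * pi) ^ DIM('a)) * ft \<phi> \<xi>) (- x)"
    unfolding inv_fourier_eq_ft[OF \<open>\<phi> \<in> borel_measurable borel\<close>] by (rule fourier_eq_ft) simp_all
  also have "\<dots> = complex_of_real (1 / (2 * pi) ^ DIM('a)) * (\<integral>\<xi>. (\<integral>y. \<phi> y * iexp (y \<bullet> \<xi>) \<partial>lborel) * iexp (- (x \<bullet> \<xi>)) \<partial>lborel)"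
    unfolding ft_def mult.assoc by (subst integral_mult_right_zero) (simp add: inner_commute)
  also have "\<dots> = complex_of_real (1 / (2 * pi) ^ DIM('a)) * (complex_of_real ((2 * pi) ^ DIM('a)) * \<phi> x)"
    by (subst fourier_inversion_lborel[OF schwartz_integrable[OF \<phi>] schwartz_continuous[OF \<phi>] B i]) simp
  also have "\<dots> = \<phi> x"
    unfolding mult.assoc[symmetric] of_real_mult[symmetric] by simp
  finally show "fourier (inv_fourier \<phi>) x = \<phi> x" .
qed

lemma ft_bessel_kernel: "0 < t \<Longrightarrow> ft (\<lambda>x. complex_of_real (bessel_kernel t x)) \<xi> = bessel_symbol (- t) \<xi>"
  by (simp add: ft_def integral_bessel_kernel_iexp)

text \<open>The convolution theorem read from the frequency side: the symbol is replaced by its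
  expression as the transform of the kernel. As the kernel has mass 1, the double integral converges
  absolutely as soon as \<open>a\<close> is integrable; no inversion is used.\<close>

lemma fourier_bessel_symbol_mult:
  fixes a :: "'a::euclidean_space \<Rightarrow> complex"
  assumes a: "integrable lborel a" and t: "0 < t"
  shows "fourier (\<lambda>\<xi>. bessel_symbol (- t) \<xi> * a \<xi>) = bessel_conv t (fourier a)"
proof
  fix x
  have am[measurable]: "a \<in> borel_measurable borel" using borel_measurable_integrable[OF a] by simp
  have fa: "fourier a y = (\<integral>\<xi>. a \<xi> * iexp (- (\<xi> \<bullet> y)) \<partial>lborel)" for y
    by (subst fourier_eq_ft[OF am]) (simp_all add: ft_def)
  have inner: "(\<integral>y. complex_of_real (bessel_kernel t (x - y)) * (a \<xi> * iexp (- (\<xi> \<bullet> y))) \<partial>lborel)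
      = bessel_symbol (- t) \<xi> * a \<xi> * iexp (- (\<xi> \<bullet> x))" for \<xi>
  proof -
    have "(\<integral>y. complex_of_real (bessel_kernel t (x - y)) * (a \<xi> * iexp (- (\<xi> \<bullet> y))) \<partial>lborel)
      = (\<integral>y. (\<lambda>z. a \<xi> * iexp (- (\<xi> \<bullet> x)) * (complex_of_real (bessel_kernel t z) * iexp (z \<bullet> \<xi>))) (x - y) \<partial>lborel)"
    proof (rule Bochner_Integration.integral_cong[OF refl])
      fix y
      have "iexp (- (\<xi> \<bullet> y)) = iexp (- (\<xi> \<bullet> x)) * iexp ((x - y) \<bullet> \<xi>)"
        unfolding exp_add[symmetric]
        by (rule arg_cong[where f = exp]) (simp add: inner_diff_left inner_commute[of \<xi>] algebra_simps)
      then show "complex_of_real (bessel_kernel t (x - y)) * (a \<xi> * iexp (- (\<xi> \<bullet> y)))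
         = (\<lambda>z. a \<xi> * iexp (- (\<xi> \<bullet> x)) * (complex_of_real (bessel_kernel t z) * iexp (z \<bullet> \<xi>))) (x - y)"
        by (simp only: mult_ac)
    qed
    also have "\<dots> = (\<integral>z. a \<xi> * iexp (- (\<xi> \<bullet> x)) * (complex_of_real (bessel_kernel t z) * iexp (z \<bullet> \<xi>)) \<partial>lborel)"
      by (rule integral_lborel_reflect) measurable
    also have "\<dots> = a \<xi> * iexp (- (\<xi> \<bullet> x)) * bessel_symbol (- t) \<xi>"
      by (subst integral_mult_right_zero) (simp only: integral_bessel_kernel_iexp[OF t])
    finally show ?thesis by (simp only: mult_ac)
  qed
  have "fourier (\<lambda>\<xi>. bessel_symbol (- t) \<xi> * a \<xi>) x = (\<integral>\<xi>. bessel_symbol (- t) \<xi> * a \<xi> * iexp (- (\<xi> \<bullet> x)) \<partial>lborel)"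
    by (subst fourier_eq_ft[where g = "\<lambda>\<xi>. bessel_symbol (- t) \<xi> * a \<xi>"]) (simp_all add: ft_def)
  also have "\<dots> = (\<integral>\<xi>. \<integral>y. complex_of_real (bessel_kernel t (x - y)) * (a \<xi> * iexp (- (\<xi> \<bullet> y))) \<partial>lborel \<partial>lborel)"
    unfolding inner ..
  also have "\<dots> = (\<integral>y. \<integral>\<xi>. complex_of_real (bessel_kernel t (x - y)) * (a \<xi> * iexp (- (\<xi> \<bullet> y))) \<partial>lborel \<partial>lborel)"
  proof (rule integral_swap_lborel)
    have "(\<integral>\<^sup>+\<xi>. \<integral>\<^sup>+y. ennreal (norm (complex_of_real (bessel_kernel t (x - y)) * (a \<xi> * iexp (- (\<xi> \<bullet> y))))) \<partial>lborel \<partial>lborel)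
      = (\<integral>\<^sup>+\<xi>. \<integral>\<^sup>+y. ennreal (bessel_kernel t (x - y)) * ennreal (norm (a \<xi>)) \<partial>lborel \<partial>lborel)"
      using t by (simp add: norm_mult ennreal_mult bessel_kernel_nonneg)
    also have "\<dots> = (\<integral>\<^sup>+\<xi>. ennreal (norm (a \<xi>)) \<partial>lborel)"
      using t by (simp add: nn_integral_multc nn_integral_bessel_kernel_diff)
    also have "\<dots> < \<infinity>" using a by (simp add: integrable_iff_bounded)
    finally show "(\<integral>\<^sup>+\<xi>. \<integral>\<^sup>+y. ennreal (norm (complex_of_real (bessel_kernel t (x - y)) * (a \<xi> * iexp (- (\<xi> \<bullet> y))))) \<partial>lborel \<partial>lborel) < \<infinity>" .
  qed measurable
  also have "\<dots> = bessel_conv t (fourier a) x"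
    unfolding bessel_conv_def fa by (simp only: integral_mult_right_zero)
  finally show "fourier (\<lambda>\<xi>. bessel_symbol (- t) \<xi> * a \<xi>) x = bessel_conv t (fourier a) x" .
qed

text \<open>The transpose of \<open>(I - \<Delta>)\<^sup>s\<close>, acting on test functions.\<close>

definition bessel_test :: "real \<Rightarrow> ('a::euclidean_space \<Rightarrow> complex) \<Rightarrow> 'a \<Rightarrow> complex" where
  "bessel_test s \<phi> = fourier (\<lambda>\<xi>. bessel_symbol s \<xi> * inv_fourier \<phi> \<xi>)"

lemma bessel_op_eq: "bessel_op s T \<phi> = T (bessel_test s \<phi>)"
  by (simp add: bessel_op_def inv_fourier_dist_def mult_dist_def fourier_dist_def bessel_test_def)

text \<open>Lowering the order by \<open>t\<close> is convolution with the Bessel kernel. The case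
  \<open>s = 0\<close> describes the solution as a distribution, \<open>s = t\<close> undoes the
  operator, and integer \<open>s\<close> shows that images of test functions are bounded and
  integrable.\<close>

lemma bessel_test_add:
  fixes \<phi> :: "'a::euclidean_space \<Rightarrow> complex"
  assumes "\<phi> \<in> schwartz" "0 < t"
  shows "bessel_test (s - t) \<phi> = bessel_conv t (bessel_test s \<phi>)"
proof -
  have "bessel_test (s - t) \<phi> = fourier (\<lambda>\<xi>. bessel_symbol (- t) \<xi> * (bessel_symbol s \<xi> * inv_fourier \<phi> \<xi>))"
  proof -
    have "bessel_symbol (s - t) \<xi> = bessel_symbol (- t) \<xi> * bessel_symbol s \<xi>" for \<xi> :: 'a
      using bessel_symbol_add[of "- t" s \<xi>] by simp
    then show ?thesis by (simp only: bessel_test_def mult.assoc)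
  qed
  also have "\<dots> = bessel_conv t (bessel_test s \<phi>)"
    unfolding bessel_test_def
    by (rule fourier_bessel_symbol_mult[OF integrable_bessel_symbol_inv_fourier[OF assms(1)] assms(2)])
  finally show ?thesis .
qed

lemma bessel_test_0: "\<phi> \<in> schwartz \<Longrightarrow> bessel_test 0 \<phi> = \<phi>"
  by (simp add: bessel_test_def fourier_inv_fourier)

lemma bessel_test_nat:
  assumes "\<phi> \<in> schwartz"
  shows "bessel_test (real k) \<phi> = (one_minus_laplacian ^^ k) \<phi>"
proof -
  let ?\<psi> = "(one_minus_laplacian ^^ k) \<phi>"
  have \<psi>: "?\<psi> \<in> schwartz" by (rule schwartz_one_minus_laplacian_funpow[OF assms])
  have "bessel_test (real k) \<phi> = fourier (inv_fourier ?\<psi>)"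
    unfolding bessel_test_def inv_fourier_eq_ft[OF schwartz_measurable[OF \<psi>]] inv_fourier_eq_ft[OF schwartz_measurable[OF assms]]
      ft_one_minus_laplacian_funpow[OF assms]
    by (simp only: mult_ac)
  then show ?thesis by (simp add: fourier_inv_fourier \<psi>)
qed

lemma bessel_conv_bounded_integrable:
  fixes h :: "'a::euclidean_space \<Rightarrow> complex"
  assumes h: "integrable lborel h" and B: "0 \<le> B" "\<And>x. norm (h x) \<le> B" and t: "0 < t"
  shows "integrable lborel (bessel_conv t h)" "\<And>x. norm (bessel_conv t h x) \<le> B"
proof -
  have [measurable]: "h \<in> borel_measurable borel" using borel_measurable_integrable[OF h] by simp
  show "integrable lborel (bessel_conv t h)"
  proof (rule integrableI_bounded)
    have "(\<integral>\<^sup>+x. ennreal (norm (bessel_conv t h x)) \<partial>lborel)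
      \<le> (\<integral>\<^sup>+x. \<integral>\<^sup>+y. ennreal (bessel_kernel t (x - y) * norm (h y)) \<partial>lborel \<partial>lborel)"
      by (intro nn_integral_mono norm_bessel_conv_le t)
    also have "\<dots> = (\<integral>\<^sup>+y. \<integral>\<^sup>+x. ennreal (bessel_kernel t (x - y) * norm (h y)) \<partial>lborel \<partial>lborel)"
      by (rule nn_integral_swap_lborel) measurable
    also have "\<dots> = (\<integral>\<^sup>+y. \<integral>\<^sup>+x. ennreal (bessel_kernel t (y - x)) * ennreal (norm (h y)) \<partial>lborel \<partial>lborel)"
      by (intro nn_integral_cong) (subst bessel_kernel_diff_commute, simp add: ennreal_mult'')
    also have "\<dots> = (\<integral>\<^sup>+y. ennreal (norm (h y)) \<partial>lborel)"
      using t by (simp add: nn_integral_multc nn_integral_bessel_kernel_diff)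
    also have "\<dots> < \<infinity>" using h by (simp add: integrable_iff_bounded)
    finally show "(\<integral>\<^sup>+x. ennreal (norm (bessel_conv t h x)) \<partial>lborel) < \<infinity>" .
  qed simp
  fix x
  have "ennreal (norm (bessel_conv t h x)) \<le> (\<integral>\<^sup>+y. ennreal (bessel_kernel t (x - y) * norm (h y)) \<partial>lborel)"
    by (rule norm_bessel_conv_le[OF t])
  also have "\<dots> \<le> (\<integral>\<^sup>+y. ennreal (bessel_kernel t (x - y)) * ennreal B \<partial>lborel)"
    using t B by (intro nn_integral_mono) (simp add: ennreal_mult''[symmetric] ennreal_leI mult_left_mono bessel_kernel_nonneg)
  also have "\<dots> = ennreal B"
    using t by (simp add: nn_integral_multc nn_integral_bessel_kernel_diff)
  finally show "norm (bessel_conv t h x) \<le> B" using B(1) by simp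
qed

lemma bessel_test_bounded_integrable:
  assumes \<phi>: "\<phi> \<in> schwartz"
  obtains B where "integrable lborel (bessel_test s \<phi>)" "0 \<le> B" "\<And>x. norm (bessel_test s \<phi> x) \<le> B"
proof -
  obtain k :: nat where k: "s < real k" using reals_Archimedean2 by blast
  let ?\<psi> = "(one_minus_laplacian ^^ k) \<phi>"
  have \<psi>: "?\<psi> \<in> schwartz" by (rule schwartz_one_minus_laplacian_funpow[OF \<phi>])
  obtain B where B: "0 \<le> B" "\<And>x. norm (?\<psi> x) \<le> B" using schwartz_bounded[OF \<psi>] by blast
  have "bessel_test s \<phi> = bessel_conv (real k - s) ?\<psi>"
    using bessel_test_add[OF \<phi>, of "real k - s" "real k"] k by (simp add: bessel_test_nat[OF \<phi>])
  with bessel_conv_bounded_integrable[OF schwartz_integrable[OF \<psi>] B, of "real k - s"] B(1) k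
  show thesis by (intro that[of B]) auto
qed

lemma le_one_plus_powr: "1 < p \<Longrightarrow> 0 \<le> x \<Longrightarrow> x \<le> 1 + x powr p" for x p :: real
proof (cases "x \<le> 1")
  case False
  assume "1 < p"
  with False have "x powr 1 \<le> x powr p" by (intro powr_mono) auto
  with False show ?thesis by simp
qed (use powr_ge_zero[of x p] in linarith)

text \<open>Fubini and evenness of the kernel. Bounded integrable \<open>h\<close> is the natural
  class here because images of test functions under \<open>bessel_test\<close> are only known to lie
  in it.\<close>

lemma bessel_conv_duality:
  fixes v h :: "'a::euclidean_space \<Rightarrow> complex"
  assumes [measurable]: "v \<in> borel_measurable borel" and p: "1 < p"
    and fin: "(\<integral>\<^sup>+x. ennreal (norm (v x) powr p) \<partial>lborel) < \<infinity>"
    and h: "integrable lborel h" and B: "0 \<le> B" "\<And>x. norm (h x) \<le> B" and t: "0 < t"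
  shows "(\<integral>x. bessel_conv t v x * h x \<partial>lborel) = (\<integral>x. v x * bessel_conv t h x \<partial>lborel)"
proof -
  have [measurable]: "h \<in> borel_measurable borel" using borel_measurable_integrable[OF h] by simp
  have "(\<integral>x. bessel_conv t v x * h x \<partial>lborel)
     = (\<integral>x. \<integral>y. complex_of_real (bessel_kernel t (x - y)) * v y * h x \<partial>lborel \<partial>lborel)"
    by (simp add: bessel_conv_def)
  also have "\<dots> = (\<integral>y. \<integral>x. complex_of_real (bessel_kernel t (x - y)) * v y * h x \<partial>lborel \<partial>lborel)"
  proof (rule integral_swap_lborel)
    let ?G = "\<lambda>x y. ennreal (bessel_kernel t (y - x))"
    have "(\<integral>\<^sup>+x. \<integral>\<^sup>+y. ennreal (norm (complex_of_real (bessel_kernel t (x - y)) * v y * h x)) \<partial>lborel \<partial>lborel)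
      \<le> (\<integral>\<^sup>+x. \<integral>\<^sup>+y. ennreal (bessel_kernel t (x - y)) * ennreal (norm (h x)) + ?G x y * (ennreal (norm (v y) powr p) * ennreal B) \<partial>lborel \<partial>lborel)"
    proof (intro nn_integral_mono)
      fix x y
      \<comment> \<open>\<open>norm (v y) \<le> 1 + norm (v y) powr p\<close> replaces Hoelder's
        inequality: the term 1 is paired with the integrability of \<open>h\<close>, the power with
        its boundedness.\<close>
      have "norm (v y) * norm (h x) \<le> (1 + norm (v y) powr p) * norm (h x)"
        by (intro mult_right_mono le_one_plus_powr p) auto
      also have "\<dots> \<le> norm (h x) + norm (v y) powr p * B"
        using B(2)[of x] by (simp add: ring_distribs mult_left_mono)
      finally have "bessel_kernel t (x - y) * (norm (v y) * norm (h x)) \<le> bessel_kernel t (x - y) * (norm (h x) + norm (v y) powr p * B)"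
        using t by (intro mult_left_mono) (auto simp: bessel_kernel_nonneg)
      then show "ennreal (norm (complex_of_real (bessel_kernel t (x - y)) * v y * h x))
         \<le> ennreal (bessel_kernel t (x - y)) * ennreal (norm (h x)) + ?G x y * (ennreal (norm (v y) powr p) * ennreal B)"
        using t B(1)
        by (simp add: norm_mult bessel_kernel_nonneg bessel_kernel_diff_commute[of t y x] ennreal_mult'[symmetric]
          ennreal_plus[symmetric] ring_distribs mult.assoc del: ennreal_plus)
    qed
    also have "\<dots> = (\<integral>\<^sup>+x. \<integral>\<^sup>+y. ennreal (bessel_kernel t (x - y)) * ennreal (norm (h x)) \<partial>lborel \<partial>lborel)
        + (\<integral>\<^sup>+x. \<integral>\<^sup>+y. ?G x y * (ennreal (norm (v y) powr p) * ennreal B) \<partial>lborel \<partial>lborel)"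
      by (simp add: nn_integral_add)
    also have "(\<integral>\<^sup>+x. \<integral>\<^sup>+y. ennreal (bessel_kernel t (x - y)) * ennreal (norm (h x)) \<partial>lborel \<partial>lborel) = (\<integral>\<^sup>+x. ennreal (norm (h x)) \<partial>lborel)"
      using t by (simp add: nn_integral_multc nn_integral_bessel_kernel_diff)
    also have "(\<integral>\<^sup>+x. \<integral>\<^sup>+y. ?G x y * (ennreal (norm (v y) powr p) * ennreal B) \<partial>lborel \<partial>lborel)
       = (\<integral>\<^sup>+y. \<integral>\<^sup>+x. ?G x y * (ennreal (norm (v y) powr p) * ennreal B) \<partial>lborel \<partial>lborel)"
      by (rule nn_integral_swap_lborel) measurable
    also have "\<dots> = (\<integral>\<^sup>+y. ennreal (norm (v y) powr p) \<partial>lborel) * ennreal B"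
      using t by (simp add: nn_integral_multc nn_integral_bessel_kernel_diff)
    also have "(\<integral>\<^sup>+x. ennreal (norm (h x)) \<partial>lborel) + (\<integral>\<^sup>+y. ennreal (norm (v y) powr p) \<partial>lborel) * ennreal B < \<infinity>"
      using h fin by (simp add: integrable_iff_bounded ennreal_mult_less_top)
    finally show "(\<integral>\<^sup>+x. \<integral>\<^sup>+y. ennreal (norm (complex_of_real (bessel_kernel t (x - y)) * v y * h x)) \<partial>lborel \<partial>lborel) < \<infinity>" .
  qed measurable
  also have "\<dots> = (\<integral>y. \<integral>x. v y * (complex_of_real (bessel_kernel t (y - x)) * h x) \<partial>lborel \<partial>lborel)"
    by (intro Bochner_Integration.integral_cong refl) (subst bessel_kernel_diff_commute, simp)
  also have "\<dots> = (\<integral>x. v x * bessel_conv t h x \<partial>lborel)"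
    by (simp add: bessel_conv_def)
  finally show ?thesis .
qed

section \<open>Identification of the fundamental solution\<close>

lemma AE_log_kernel:
  assumes t: "0 < t"
  shows "AE x in lborel. log_kernel t (x::'a::euclidean_space) = complex_of_real (bessel_kernel t x)"
proof -
  let ?G = "\<lambda>x::'a. complex_of_real (bessel_kernel t x)"
  let ?P = "\<lambda>H::'a \<Rightarrow> complex. integrable lebesgue H \<and> (\<forall>\<xi>. fourier H \<xi> = bessel_symbol (- t) \<xi>)"
  have sym: "bessel_symbol (- t) (- \<xi>) = bessel_symbol (- t) \<xi>" for \<xi> :: 'a
    by (simp add: bessel_symbol_def)
  have GI: "integrable lborel ?G"
    by (intro integrable_bounded_linear[OF bounded_linear_of_real] integrable_bessel_kernel t)
  have "integrable lebesgue ?G"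
    using GI by (subst integrable_lebesgue_AE_eq[where g = ?G]) simp_all
  moreover have "fourier ?G \<xi> = bessel_symbol (- t) \<xi>" for \<xi>
    by (subst fourier_eq_ft[where g = ?G]) (simp_all add: ft_bessel_kernel t sym)
  ultimately have "?P ?G" by blast
  \<comment> \<open>The Bessel kernel witnesses that the description defining
    \<open>log_kernel\<close> is satisfiable; only then does the choice have the described
    properties.\<close>
  then have P: "?P (log_kernel t)" unfolding log_kernel_def by (rule someI[of ?P])
  then have "integrable lebesgue (log_kernel t :: 'a \<Rightarrow> complex)" ..
  then have "(log_kernel t :: 'a \<Rightarrow> complex) \<in> borel_measurable lebesgue"
    by (rule borel_measurable_integrable)
  then obtain g where g[measurable]: "g \<in> borel_measurable borel" and ae: "AE x::'a in lborel. log_kernel t x = g x"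
    by (rule lebesgue_borel_representative)
  have gi: "integrable lborel g" using P integrable_lebesgue_AE_eq[OF g ae] by simp
  have "ft g \<xi> = bessel_symbol (- t) \<xi>" for \<xi>
    using P fourier_eq_ft[OF g ae, of "- \<xi>"] sym by simp
  then have "(\<integral>y. (g y - ?G y) * iexp (y \<bullet> \<xi>) \<partial>lborel) = 0" for \<xi>
    using ft_bessel_kernel[OF t, of \<xi>] integrable_mult_iexp[OF gi, of \<xi>] integrable_mult_iexp[OF GI, of \<xi>]
    by (simp add: ft_def left_diff_distrib)
  then have "AE x in lborel. g x - ?G x = 0"
    using gi GI by (intro fourier_unique_lborel) auto
  with ae show ?thesis by eventually_elim simp
qed

text \<open>The kernels and the data agree only almost everywhere, yet the two sides agree at every
  point: each value is an integral over \<open>y\<close>, where null sets are invisible. This is why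
  the \<open>C0\<close> claim holds for the solution itself and not merely for a
  representative.\<close>

lemma log_solution_eq:
  assumes t: "0 < t" and v[measurable]: "v \<in> borel_measurable borel" and ae: "AE x in lborel. u0 x = v x"
  shows "log_solution u0 t = bessel_conv t v"
proof
  fix x
  have "AE y in lborel. log_kernel t (x - y) * u0 y = complex_of_real (bessel_kernel t (x - y)) * v y"
    using AE_lborel_reflect[OF AE_log_kernel[OF t], of x] ae by eventually_elim simp
  then have "convolve (log_kernel t) u0 x = bessel_conv t v x"
    unfolding convolve_def bessel_conv_def by (intro integral_lebesgue_AE_eq) measurable
  then show "log_solution u0 t x = bessel_conv t v x"
    using t by (simp add: log_solution_def)
qed

section \<open>Modulated Gaussians as separating test functions\<close>

inductive_set polynomial_functions :: "('a::euclidean_space \<Rightarrow> complex) set" where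
  const: "(\<lambda>x. c) \<in> polynomial_functions"
| inner: "(\<lambda>x. complex_of_real (x \<bullet> b)) \<in> polynomial_functions"
| add: "q \<in> polynomial_functions \<Longrightarrow> r \<in> polynomial_functions \<Longrightarrow> (\<lambda>x. q x + r x) \<in> polynomial_functions"
| mult: "q \<in> polynomial_functions \<Longrightarrow> r \<in> polynomial_functions \<Longrightarrow> (\<lambda>x. q x * r x) \<in> polynomial_functions"

text \<open>Closure under directional derivatives keeps all iterated derivatives of a Gaussian in
  the form polynomial times Gaussian.\<close>

lemma polynomial_functions_derivative:
  assumes "q \<in> polynomial_functions"
  shows "\<exists>q'. (\<forall>x. (q has_derivative q' x) (at x)) \<and> (\<forall>v. (\<lambda>x. q' x v) \<in> polynomial_functions)"
  using assms
proof induction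
  case (const c)
  show ?case
    by (intro exI[of _ "\<lambda>x v. 0"]) (auto intro: polynomial_functions.const)
next
  case (inner b)
  show ?case
    by (intro exI[of _ "\<lambda>x v. complex_of_real (v \<bullet> b)"])
       (auto intro!: polynomial_functions.const has_derivative_of_real has_derivative_inner_left)
next
  case (add q r)
  then obtain q' r' where
    "\<And>x. (q has_derivative q' x) (at x)" "\<And>v. (\<lambda>x. q' x v) \<in> polynomial_functions"
    "\<And>x. (r has_derivative r' x) (at x)" "\<And>v. (\<lambda>x. r' x v) \<in> polynomial_functions" by blast
  then show ?case
    by (intro exI[of _ "\<lambda>x v. q' x v + r' x v"]) (auto intro!: polynomial_functions.add has_derivative_add)
next
  case (mult q r)
  then obtain q' r' where
    "\<And>x. (q has_derivative q' x) (at x)" "\<And>v. (\<lambda>x. q' x v) \<in> polynomial_functions"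
    "\<And>x. (r has_derivative r' x) (at x)" "\<And>v. (\<lambda>x. r' x v) \<in> polynomial_functions" by blast
  with mult show ?case
    by (intro exI[of _ "\<lambda>x v. q x * r' x v + q' x v * r x"])
       (auto intro!: polynomial_functions.add polynomial_functions.mult has_derivative_mult)
qed

lemma polynomial_functions_growth:
  assumes "q \<in> polynomial_functions"
  shows "\<exists>C n. 0 \<le> C \<and> (\<forall>x. norm (q x) \<le> C * (1 + norm x) ^ n)"
  using assms
proof induction
  case (const c)
  show ?case by (intro exI[of _ "norm c"] exI[of _ 0]) simp
next
  case (inner b)
  show ?case
  proof (intro exI[of _ "norm b"] exI[of _ 1] conjI allI)
    fix x
    have "\<bar>x \<bullet> b\<bar> \<le> norm x * norm b" by (rule Cauchy_Schwarz_ineq2)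
    also have "\<dots> \<le> norm b * (1 + norm x) ^ 1" by (simp add: algebra_simps)
    finally show "norm (complex_of_real (x \<bullet> b)) \<le> norm b * (1 + norm x) ^ 1" by simp
  qed simp
next
  case (add q r)
  then obtain C n D m where C: "0 \<le> C" "\<And>x. norm (q x) \<le> C * (1 + norm x) ^ n"
    and D: "0 \<le> D" "\<And>x. norm (r x) \<le> D * (1 + norm x) ^ m" by blast
  show ?case
  proof (intro exI[of _ "C + D"] exI[of _ "n + m"] conjI allI)
    fix x
    have "norm (q x + r x) \<le> C * (1 + norm x) ^ n + D * (1 + norm x) ^ m"
      by (intro order_trans[OF norm_triangle_ineq] add_mono C D)
    also have "\<dots> \<le> C * (1 + norm x) ^ (n + m) + D * (1 + norm x) ^ (n + m)"
      using C(1) D(1) by (intro add_mono mult_left_mono power_increasing) auto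
    finally show "norm (q x + r x) \<le> (C + D) * (1 + norm x) ^ (n + m)" by (simp add: algebra_simps)
  qed (use C(1) D(1) in simp)
next
  case (mult q r)
  then obtain C n D m where C: "0 \<le> C" "\<And>x. norm (q x) \<le> C * (1 + norm x) ^ n"
    and D: "0 \<le> D" "\<And>x. norm (r x) \<le> D * (1 + norm x) ^ m" by blast
  show ?case
  proof (intro exI[of _ "C * D"] exI[of _ "n + m"] conjI allI)
    fix x
    have "norm (q x * r x) \<le> (C * (1 + norm x) ^ n) * (D * (1 + norm x) ^ m)"
      unfolding norm_mult using C(1) by (intro mult_mono C D) auto
    then show "norm (q x * r x) \<le> C * D * (1 + norm x) ^ (n + m)" by (simp add: power_add mult_ac)
  qed (use C(1) D(1) in simp)
qed

text \<open>Pairing a function with this is evaluating at \<open>\<xi>\<close> the transform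
  \<open>ft\<close> of that function times a Gaussian.\<close>

definition modulated_gaussian :: "'a::euclidean_space \<Rightarrow> 'a \<Rightarrow> complex" where
  "modulated_gaussian \<xi> x = complex_of_real (exp (- (x \<bullet> x))) * iexp (x \<bullet> \<xi>)"

lemma modulated_gaussian_has_derivative:
  "(modulated_gaussian \<xi> has_derivative
    (\<lambda>v. modulated_gaussian \<xi> x * (complex_of_real (- 2 * (x \<bullet> v)) + \<i> * complex_of_real (v \<bullet> \<xi>)))) (at x)"
proof -
  have "((\<lambda>x. complex_of_real (exp (- (x \<bullet> x)))) has_derivative (\<lambda>v. complex_of_real (exp (- (x \<bullet> x)) * (- (x \<bullet> v + v \<bullet> x))))) (at x)"
    by (auto intro!: derivative_eq_intros)
  from has_derivative_mult[OF this has_derivative_iexp_inner[of \<xi> x]]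
  show ?thesis
    unfolding modulated_gaussian_def
    by (rule has_derivative_eq_rhs) (simp add: fun_eq_iff inner_commute algebra_simps)
qed

lemma iter_deriv_modulated_gaussian:
  "\<exists>q\<in>polynomial_functions. iter_deriv vs (modulated_gaussian \<xi>) = (\<lambda>x. q x * modulated_gaussian \<xi> x)"
proof (induction vs)
  case Nil
  show ?case by (rule bexI[of _ "\<lambda>x. 1"]) (auto intro: polynomial_functions.const)
next
  case (Cons v vs)
  then obtain q where q: "q \<in> polynomial_functions"
    "iter_deriv vs (modulated_gaussian \<xi>) = (\<lambda>x. q x * modulated_gaussian \<xi> x)" by blast
  obtain q' where q': "\<And>x. (q has_derivative q' x) (at x)" "\<And>v. (\<lambda>x. q' x v) \<in> polynomial_functions"
    using polynomial_functions_derivative[OF q(1)] by blast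
  let ?r = "\<lambda>x. q x * (complex_of_real (x \<bullet> (- 2 *\<^sub>R v)) + \<i> * complex_of_real (v \<bullet> \<xi>)) + q' x v"
  show ?case
  proof (rule bexI[of _ ?r])
    show "?r \<in> polynomial_functions"
      by (intro polynomial_functions.intros q q')
    show "iter_deriv (v # vs) (modulated_gaussian \<xi>) = (\<lambda>x. ?r x * modulated_gaussian \<xi> x)"
    proof
      fix x
      note D = has_derivative_mult[OF q'(1)[of x] modulated_gaussian_has_derivative[of \<xi> x]]
      show "iter_deriv (v # vs) (modulated_gaussian \<xi>) x = ?r x * modulated_gaussian \<xi> x"
        using fun_cong[OF frechet_derivative_at[OF D], of v, symmetric]
        by (simp add: q(2) algebra_simps)
    qed
  qed
qed

text \<open>From \<open>1 + r \<le> exp r\<close>, after which the exponent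
  \<open>real n * r - r\<^sup>2\<close> is maximised by completing the square.\<close>

lemma one_plus_power_gaussian_bounded:
  fixes r :: real
  assumes "0 \<le> r"
  shows "(1 + r) ^ n * exp (- r\<^sup>2) \<le> exp ((real n)\<^sup>2 / 4)"
proof -
  have "(1 + r) ^ n \<le> exp r ^ n"
    using assms by (intro power_mono exp_ge_add_one_self) auto
  also have "\<dots> = exp (real n * r)"
    by (rule exp_of_nat_mult[symmetric])
  finally have "(1 + r) ^ n * exp (- r\<^sup>2) \<le> exp (real n * r) * exp (- r\<^sup>2)"
    by (intro mult_right_mono) auto
  also have "\<dots> = exp (real n * r - r\<^sup>2)"
    by (simp add: exp_add[symmetric])
  also have "real n * r - r\<^sup>2 = (real n)\<^sup>2 / 4 - (r - real n / 2)\<^sup>2"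
    by (simp add: power2_eq_square algebra_simps)
  also have "exp ((real n)\<^sup>2 / 4 - (r - real n / 2)\<^sup>2) \<le> exp ((real n)\<^sup>2 / 4)"
    by simp
  finally show ?thesis .
qed

lemma modulated_gaussian_schwartz: "modulated_gaussian \<xi> \<in> schwartz"
  unfolding schwartz_def mem_Collect_eq
proof (intro allI impI conjI)
  fix vs :: "'a list"
  obtain q where q: "q \<in> polynomial_functions"
    and it: "iter_deriv vs (modulated_gaussian \<xi>) = (\<lambda>x. q x * modulated_gaussian \<xi> x)"
    using iter_deriv_modulated_gaussian by blast
  obtain q' where q': "\<And>x. (q has_derivative q' x) (at x)"
    using polynomial_functions_derivative[OF q] by blast
  show "iter_deriv vs (modulated_gaussian \<xi>) differentiable (at x)" for x
    unfolding it using has_derivative_mult[OF q'[of x] modulated_gaussian_has_derivative[of \<xi> x]]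
    by (auto simp: differentiable_def)
  fix k :: nat
  obtain C n where C: "0 \<le> C" "\<And>x. norm (q x) \<le> C * (1 + norm x) ^ n"
    using polynomial_functions_growth[OF q] by blast
  show "bounded (range (\<lambda>x. norm x ^ k *\<^sub>R iter_deriv vs (modulated_gaussian \<xi>) x))"
    unfolding bounded_iff it
  proof (intro exI[of _ "C * exp ((real (k + n))\<^sup>2 / 4)"] ballI, elim rangeE, hypsubst)
    fix x
    have "norm (norm x ^ k *\<^sub>R (q x * modulated_gaussian \<xi> x)) = norm x ^ k * norm (q x) * exp (- (norm x)\<^sup>2)"
      by (simp add: norm_mult modulated_gaussian_def power2_norm_eq_inner)
    also have "\<dots> \<le> (1 + norm x) ^ k * (C * (1 + norm x) ^ n) * exp (- (norm x)\<^sup>2)"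
      by (intro mult_right_mono mult_mono C power_mono) auto
    also have "\<dots> = C * ((1 + norm x) ^ (k + n) * exp (- (norm x)\<^sup>2))"
      by (simp add: power_add mult_ac)
    also have "\<dots> \<le> C * exp ((real (k + n))\<^sup>2 / 4)"
      by (intro mult_left_mono one_plus_power_gaussian_bounded C) simp
    finally show "norm (norm x ^ k *\<^sub>R (q x * modulated_gaussian \<xi> x)) \<le> C * exp ((real (k + n))\<^sup>2 / 4)" .
  qed
qed

text \<open>Multiplication by a Gaussian makes both functions integrable, and equality on modulated
  Gaussians says that the difference has vanishing Fourier transform. Uniqueness for integrable
  functions then applies, and the Gaussian, having no zeros, can be divided out.\<close>

theorem Lp_dist_unique:
  fixes f g :: "'a::euclidean_space \<Rightarrow> complex"
  assumes p: "1 < p" and f: "f \<in> Lp p" and g: "g \<in> Lp p" and eq: "dist_eq (dist_of f) (dist_of g)"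
  shows "AE x in lborel. f x = g x"
proof -
  obtain v where v[measurable]: "v \<in> borel_measurable borel" and fv: "AE x in lborel. f x = v x"
    and vf: "(\<integral>\<^sup>+x. ennreal (norm (v x) powr p) \<partial>lborel) < \<infinity>"
    using Lp_borel_representative[OF f] by blast
  obtain w where w[measurable]: "w \<in> borel_measurable borel" and gw: "AE x in lborel. g x = w x"
    and wf: "(\<integral>\<^sup>+x. ennreal (norm (w x) powr p) \<partial>lborel) < \<infinity>"
    using Lp_borel_representative[OF g] by blast
  let ?e = "modulated_gaussian (0::'a)"
  have em[measurable]: "modulated_gaussian \<xi> \<in> borel_measurable borel" for \<xi> :: 'a
    by (rule schwartz_measurable[OF modulated_gaussian_schwartz])
  have int: "integrable lborel (\<lambda>x. z x * ?e x)"
    if [measurable]: "z \<in> borel_measurable borel" and zf: "(\<integral>\<^sup>+x. ennreal (norm (z x) powr p) \<partial>lborel) < \<infinity>" for z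
  proof (rule Bochner_Integration.integrable_bound)
    have "integrable lborel (\<lambda>x. norm (z x) powr p)" using zf by (intro integrableI_nonneg) auto
    then show "integrable lborel (\<lambda>x. norm (?e x) + norm (z x) powr p)"
      by (intro Bochner_Integration.integrable_add integrable_norm schwartz_integrable modulated_gaussian_schwartz)
    show "AE x in lborel. norm (z x * ?e x) \<le> norm (norm (?e x) + norm (z x) powr p)"
    proof (rule AE_I2)
      fix x
      have e1: "norm (?e x) \<le> 1" by (simp add: modulated_gaussian_def norm_mult)
      have "norm (z x * ?e x) \<le> (1 + norm (z x) powr p) * norm (?e x)"
        unfolding norm_mult by (intro mult_right_mono le_one_plus_powr p) auto
      also have "\<dots> \<le> norm (?e x) + norm (z x) powr p"
        using e1 by (simp add: ring_distribs mult_left_le)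
      finally show "norm (z x * ?e x) \<le> norm (norm (?e x) + norm (z x) powr p)" by simp
    qed
  qed measurable
  have "AE x in lborel. v x * ?e x - w x * ?e x = 0"
  proof (rule fourier_unique_lborel)
    show "integrable lborel (\<lambda>x. v x * ?e x - w x * ?e x)"
      by (intro Bochner_Integration.integrable_diff int v w vf wf)
    fix \<xi> :: 'a
    have e: "?e x * iexp (x \<bullet> \<xi>) = modulated_gaussian \<xi> x" for x by (simp add: modulated_gaussian_def)
    have "dist_of f (modulated_gaussian \<xi>) = dist_of g (modulated_gaussian \<xi>)"
      using eq modulated_gaussian_schwartz by (auto simp: dist_eq_def)
    then have "(\<integral>x. v x * modulated_gaussian \<xi> x \<partial>lborel) = (\<integral>x. w x * modulated_gaussian \<xi> x \<partial>lborel)"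
      using dist_of_representative[OF v fv em] dist_of_representative[OF w gw em] by simp
    then show "(\<integral>x. (v x * ?e x - w x * ?e x) * iexp (x \<bullet> \<xi>) \<partial>lborel) = 0"
      using integrable_mult_iexp[OF int[OF v vf], of \<xi>] integrable_mult_iexp[OF int[OF w wf], of \<xi>]
      by (simp add: left_diff_distrib mult.assoc e)
  qed
  with fv gw show ?thesis
    by eventually_elim (simp add: left_diff_distrib[symmetric] modulated_gaussian_def)
qed

section \<open>Properties of the solution\<close>

lemma log_solution_distribution:
  fixes u0 :: "'a::euclidean_space \<Rightarrow> complex"
  assumes p: "1 < p" and u0: "u0 \<in> Lp p" and t: "0 < t"
  shows "dist_eq (dist_of (log_solution u0 t)) (bessel_op (- t) (dist_of u0))"
    and "dist_eq (dist_of u0) (bessel_op t (dist_of (log_solution u0 t)))"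
proof -
  obtain v where v[measurable]: "v \<in> borel_measurable borel" and ae: "AE x in lborel. u0 x = v x"
    and fin: "(\<integral>\<^sup>+x. ennreal (norm (v x) powr p) \<partial>lborel) < \<infinity>"
    using Lp_borel_representative[OF u0] by blast
  have sol: "log_solution u0 t = bessel_conv t v" by (rule log_solution_eq[OF t v ae])
  have d0: "dist_of u0 h = (\<integral>x. v x * h x \<partial>lborel)" if "h \<in> borel_measurable borel" for h
    by (rule dist_of_representative[OF v ae that])
  \<comment> \<open>Formulated for bounded integrable \<open>h\<close> rather than Schwartz
    functions, since it is also applied to \<open>bessel_test t \<phi>\<close>.\<close>
  have dt: "dist_of (log_solution u0 t) h = dist_of u0 (bessel_conv t h)"
    if h: "integrable lborel h" and B: "0 \<le> B" "\<And>x. norm (h x) \<le> B" for h B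
  proof -
    have [measurable]: "h \<in> borel_measurable borel" using borel_measurable_integrable[OF h] by simp
    have "dist_of (log_solution u0 t) h = (\<integral>x. bessel_conv t v x * h x \<partial>lborel)"
      unfolding sol by (rule dist_of_representative) simp_all
    then show ?thesis
      by (simp add: bessel_conv_duality[OF v p fin h B t] d0)
  qed
  show "dist_eq (dist_of (log_solution u0 t)) (bessel_op (- t) (dist_of u0))"
    unfolding dist_eq_def
  proof
    fix \<phi> :: "'a \<Rightarrow> complex" assume \<phi>: "\<phi> \<in> schwartz"
    obtain B where B: "0 \<le> B" "\<And>x. norm (\<phi> x) \<le> B" using schwartz_bounded[OF \<phi>] by blast
    have "bessel_test (- t) \<phi> = bessel_conv t \<phi>"
      using bessel_test_add[OF \<phi> t, of 0] by (simp add: bessel_test_0[OF \<phi>])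
    then show "dist_of (log_solution u0 t) \<phi> = bessel_op (- t) (dist_of u0) \<phi>"
      using dt[OF schwartz_integrable[OF \<phi>] B] by (simp add: bessel_op_eq)
  qed
  show "dist_eq (dist_of u0) (bessel_op t (dist_of (log_solution u0 t)))"
    unfolding dist_eq_def
  proof
    fix \<phi> :: "'a \<Rightarrow> complex" assume \<phi>: "\<phi> \<in> schwartz"
    obtain B where B: "integrable lborel (bessel_test t \<phi>)" "0 \<le> B" "\<And>x. norm (bessel_test t \<phi> x) \<le> B"
      using bessel_test_bounded_integrable[OF \<phi>] by blast
    \<comment> \<open>The kernel and the operator cancel on the test function: orders
      \<open>t\<close> and \<open>- t\<close> add up to 0, and order 0 is Fourier inversion.\<close>
    have "bessel_conv t (bessel_test t \<phi>) = \<phi>"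
      using bessel_test_add[OF \<phi> t, of t] by (simp add: bessel_test_0[OF \<phi>])
    then show "dist_of u0 \<phi> = bessel_op t (dist_of (log_solution u0 t)) \<phi>"
      using dt[OF B] by (simp add: bessel_op_eq)
  qed
qed

lemma log_solution_Lp:
  fixes u0 :: "'a::euclidean_space \<Rightarrow> complex"
  assumes p: "1 < p" and u0: "u0 \<in> Lp p" and t: "0 < t"
  shows "log_solution u0 t \<in> Lp p" and "Lp_norm p (log_solution u0 t) \<le> Lp_norm p u0"
proof -
  obtain v where v[measurable]: "v \<in> borel_measurable borel" and ae: "AE x in lborel. u0 x = v x"
    and fin: "(\<integral>\<^sup>+x. ennreal (norm (v x) powr p) \<partial>lborel) < \<infinity>"
    using Lp_borel_representative[OF u0] by blast
  have sol: "log_solution u0 t = bessel_conv t v" by (rule log_solution_eq[OF t v ae])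
  note le = bessel_conv_Lp_le[OF t v p]
  have fin': "(\<integral>\<^sup>+x. ennreal (norm (bessel_conv t v x) powr p) \<partial>lborel) < \<infinity>"
    using le fin by (rule le_less_trans)
  then show "log_solution u0 t \<in> Lp p"
    unfolding sol by (subst Lp_iff_representative[where v = "bessel_conv t v"]) simp_all
  have "(\<integral>x. norm (bessel_conv t v x) powr p \<partial>lborel) \<le> (\<integral>x. norm (v x) powr p \<partial>lborel)"
    using enn2real_mono[OF le] fin by (simp add: integral_eq_nn_integral less_top)
  then have "(\<integral>x. norm (bessel_conv t v x) powr p \<partial>lborel) powr (1 / p) \<le> (\<integral>x. norm (v x) powr p \<partial>lborel) powr (1 / p)"
    using p by (intro powr_mono2) auto
  then show "Lp_norm p (log_solution u0 t) \<le> Lp_norm p u0"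
    unfolding sol Lp_norm_representative[OF v ae]
    by (subst Lp_norm_representative[where v = "bessel_conv t v"]) simp_all
qed

lemma log_solution_Lq:
  fixes u0 :: "'a::euclidean_space \<Rightarrow> complex"
  assumes p: "1 < p" and u0: "u0 \<in> Lp p" and t: "0 < t"
    and q: "p \<le> q" "DIM('a) / 2 * (1 / p - 1 / q) \<le> t"
  shows "log_solution u0 t \<in> Lp q"
\<comment> \<open>The potential estimate needs \<open>\<alpha> > 0\<close>, hence
  \<open>p < q\<close>; the remaining case is the contraction on \<open>L\<^sup>p\<close>.\<close>
proof (cases "q = p")
  case True
  then show ?thesis using log_solution_Lp(1)[OF p u0 t] by simp
next
  case False
  obtain v where v[measurable]: "v \<in> borel_measurable borel" and ae: "AE x in lborel. u0 x = v x"
    and fin: "(\<integral>\<^sup>+x. ennreal (norm (v x) powr p) \<partial>lborel) < \<infinity>"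
    using Lp_borel_representative[OF u0] by blast
  have "(\<integral>\<^sup>+x. ennreal (norm (bessel_conv t v x) powr q) \<partial>lborel) < \<infinity>"
    using False q by (intro bessel_conv_Lq[OF v p _ fin]) auto
  then show ?thesis
    unfolding log_solution_eq[OF t v ae]
    by (subst Lp_iff_representative[where v = "bessel_conv t v"]) simp_all
qed

lemma log_solution_C0:
  fixes u0 :: "'a::euclidean_space \<Rightarrow> complex"
  assumes p: "1 < p" and u0: "u0 \<in> Lp p" and t: "DIM('a) / (2 * p) < t"
  shows "log_solution u0 t \<in> C0"
proof -
  obtain v where v[measurable]: "v \<in> borel_measurable borel" and ae: "AE x in lborel. u0 x = v x"
    and fin: "(\<integral>\<^sup>+x. ennreal (norm (v x) powr p) \<partial>lborel) < \<infinity>"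
    using Lp_borel_representative[OF u0] by blast
  have "0 \<le> DIM('a) / (2 * p)" using p by simp
  with t have "0 < t" by simp
  then show ?thesis
    using bessel_conv_C0[OF v p fin t] by (simp add: log_solution_eq[OF _ v ae])
qed

text \<open>\<open>u0\<close> is one admissible choice of the function measured by
  \<open>bessel_norm\<close>, and functions in \<open>L\<^sup>p\<close> with the same distribution
  agree almost everywhere. So the norm of whatever is chosen is that of \<open>u0\<close>.\<close>

lemma log_solution_bessel_space:
  fixes u0 :: "'a::euclidean_space \<Rightarrow> complex"
  assumes p: "1 < p" and u0: "u0 \<in> Lp p" and t: "0 < t"
  shows "log_solution u0 t \<in> bessel_space p (2 * t)"
    and "bessel_norm p (2 * t) (log_solution u0 t) = Lp_norm p u0"
proof -
  let ?P = "\<lambda>g. g \<in> Lp p \<and> dist_eq (dist_of g) (bessel_op (2 * t / 2) (dist_of (log_solution u0 t)))"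
  have P: "?P u0" using u0 log_solution_distribution(2)[OF p u0 t] by simp
  then show "log_solution u0 t \<in> bessel_space p (2 * t)"
    using log_solution_Lp(1)[OF p u0 t] by (auto simp: bessel_space_def)
  define g where "g = (SOME g. ?P g)"
  have g: "?P g" unfolding g_def by (rule someI[of ?P, OF P])
  have "dist_eq (dist_of g) (dist_of u0)"
    using g P by (simp add: dist_eq_def)
  then have gu: "AE x in lborel. g x = u0 x"
    using g u0 by (intro Lp_dist_unique[OF p]) auto
  obtain v where v: "v \<in> borel_measurable borel" and ae: "AE x in lborel. u0 x = v x"
    using Lp_borel_representative[OF u0] by blast
  have "AE x in lborel. g x = v x" using gu ae by eventually_elim simp
  then have "Lp_norm p g = Lp_norm p u0"
    by (simp add: Lp_norm_representative[OF v] ae)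
  then show "bessel_norm p (2 * t) (log_solution u0 t) = Lp_norm p u0"
    by (simp add: bessel_norm_def g_def)
qed

theorem proposition4p2:
  fixes p :: real and u0 :: "real ^ 'n \<Rightarrow> complex"
    and u :: "real \<Rightarrow> real ^ 'n \<Rightarrow> complex" and N :: real
  assumes "1 < p"
    and "u0 \<in> Lp p"
    and "u = log_solution u0"
    and "N = real CARD('n)"
  shows "(\<forall>t>0. dist_eq (dist_of (u t)) (bessel_op (- t) (dist_of u0))
               \<and> u t \<in> Lp p \<inter> bessel_space p (2 * t)
               \<and> bessel_norm p (2 * t) (u t) = Lp_norm p u0
               \<and> Lp_norm p (u t) \<le> Lp_norm p u0)
    \<and> (\<forall>t. 0 < t \<and> t < N / (2 * p) \<longrightarrow> u t \<in> Lp p \<inter> Lp (N * p / (N - 2 * p * t)))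
    \<and> (\<forall>t. t = N / (2 * p) \<longrightarrow> (\<forall>q\<ge>p. u t \<in> Lp p \<inter> Lp q))
    \<and> (\<forall>t. t > N / (2 * p) \<longrightarrow> u t \<in> Lp p \<inter> C0)
    \<and> (\<forall>q\<ge>p. \<forall>\<tau>. N * p / (N - 2 * p * \<tau>) = q \<longleftrightarrow> \<tau> = N / 2 * (1 / p - 1 / q))
    \<and> (\<forall>q\<ge>p. \<forall>\<tau>. N * p / (N - 2 * p * \<tau>) = q \<longrightarrow> 0 \<le> \<tau> \<and> u \<tau> \<in> Lp q)"
proof -
  have N: "0 < N" "N = real DIM(real ^ 'n)" using assms(4) by simp_all
  note p = assms(1) and u0 = assms(2)
  have u: "u t = log_solution u0 t" for t using assms(3) by simp
  have time: "N * p / (N - 2 * p * \<tau>) = q \<longleftrightarrow> \<tau> = N / 2 * (1 / p - 1 / q)" if q: "p \<le> q" for q \<tau>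
  proof
    assume eq: "N * p / (N - 2 * p * \<tau>) = q"
    have q0: "0 < q" using p q by simp
    \<comment> \<open>Division by 0 yields 0 here, so a vanishing denominator would force
      \<open>q = 0\<close>.\<close>
    with eq have "N - 2 * p * \<tau> \<noteq> 0" by auto
    with eq have "N * p = q * (N - 2 * p * \<tau>)" by (simp add: field_simps)
    then show "\<tau> = N / 2 * (1 / p - 1 / q)"
      using p q0 by (simp add: field_simps)
  next
    assume "\<tau> = N / 2 * (1 / p - 1 / q)"
    then have "N - 2 * p * \<tau> = N * p / q" using p by (simp add: field_simps)
    then show "N * p / (N - 2 * p * \<tau>) = q" using p q N by simp
  qed
  have pos: "0 < t" if "N / (2 * p) \<le> t" for t
    using that N p by (intro less_le_trans[OF _ that]) simp
  have Lp: "u t \<in> Lp p" if "0 < t" for t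
    unfolding u by (rule log_solution_Lp(1)[OF p u0 that])
  have Lq: "u t \<in> Lp q" if "0 < t" "p \<le> q" "N / 2 * (1 / p - 1 / q) \<le> t" for t q
    unfolding u using that N by (intro log_solution_Lq[OF p u0]) auto
  have sub: "u t \<in> Lp (N * p / (N - 2 * p * t))" if t: "0 < t" "t < N / (2 * p)" for t
  proof -
    have d: "0 < N - 2 * p * t" using t p by (simp add: field_simps)
    have "p * (N - 2 * p * t) \<le> N * p" using t p by (simp add: algebra_simps)
    then have q: "p \<le> N * p / (N - 2 * p * t)" using d by (simp add: field_simps)
    \<comment> \<open>By \<open>time\<close>, \<open>t\<close> is exactly the threshold belonging to
      this exponent, so the endpoint case of \<open>Lq\<close> is used.\<close>
    then show ?thesis using time[OF q, of t] t by (intro Lq) auto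
  qed
  have crit: "u t \<in> Lp q" if "t = N / (2 * p)" "p \<le> q" for t q
  proof (rule Lq)
    have "N / 2 * (1 / p - 1 / q) = N / (2 * p) - N / (2 * q)" by (simp add: right_diff_distrib)
    then show "N / 2 * (1 / p - 1 / q) \<le> t" using that N p by simp
  qed (use that pos[of t] in simp_all)
  have sup: "u t \<in> C0" if "N / (2 * p) < t" for t
    unfolding u using that N by (intro log_solution_C0[OF p u0]) auto
  have entry: "0 \<le> \<tau> \<and> u \<tau> \<in> Lp q" if q: "p \<le> q" and eq: "N * p / (N - 2 * p * \<tau>) = q" for q \<tau>
  proof -
    have \<tau>: "\<tau> = N / 2 * (1 / p - 1 / q)" using time[OF q] eq by simp
    have "1 / q \<le> 1 / p" using p q by (intro divide_left_mono) auto
    then have \<tau>0: "0 \<le> \<tau>" using N by (simp add: \<tau>)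
    show ?thesis
    \<comment> \<open>At time 0 the solution is \<open>u0\<close> by definition, without any kernel,
      and the exponent reduces to \<open>p\<close>.\<close>
    proof (cases "\<tau> = 0")
      case True
      then have "q = p" using eq N by simp
      then show ?thesis using True u0 by (simp add: u log_solution_def)
    next
      case False
      then have "0 < \<tau>" using \<tau>0 by simp
      then have "u \<tau> \<in> Lp q" by (rule Lq[OF _ q eq_refl[OF \<tau>[symmetric]]])
      with \<tau>0 show ?thesis by simp
    qed
  qed
  have pos': "0 < t" if "t = N / (2 * p)" for t using pos[of t] that by simp
  have pos'': "0 < t" if "N / (2 * p) < t" for t using pos[of t] that by simp
  note facts = log_solution_distribution(1)[OF p u0, folded u] log_solution_bessel_space[OF p u0, folded u]
    log_solution_Lp(2)[OF p u0, folded u]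
  show ?thesis
    by (intro conjI allI impI IntI)
       (assumption | erule conjE | rule facts Lp sub crit sup time entry[THEN conjunct1] entry[THEN conjunct2] pos' pos'')+
qed

end
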